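(* Let $\mu>0$ and let $f\in L^2(\mathbb{T},\mathrm{H}^{-1}(I))$. Then the set $$\bigcup_{\lambda\in[0,1]}(\mathcal{L}+\lambda S)^{-1}(\{f\})=\bigl\{u\in \mathrm{H}^{(\frac12,1)}_0 \;:\; \mathcal{L}u+\lambda S(u)=f \text{ for some } \lambda\in[0,1]\bigr\}$$ is bounded in $\mathrm{H}^{(\frac12,1)}_0$. Here $\mathcal{L}u+\lambda S(u)=f$ means that $$(D^{1/2}u,\,D^{1/2}_*v)+\mu\,(u_x,v_x)-\tfrac12\lambda\,(u^2,v_x)=\langle f,v\rangle\qquad\text{for all } v\in \mathrm{H}^{(\frac12,1)}_0.$$
   Context: Let $\mathbb{T}=\mathbb{R}/\mathbb{Z}$ (time variable $t$) and $I=(0,1)$ (space variable $x$). All functions on $\mathbb{T}\times I$ are real-valued. $(\cdot,\cdot)$ denotes the scalar product of $L^2(\mathbb{T}\times I)$. Fractional time derivatives: for a Hilbert space $H$ and an $H$-valued time-periodic distribution with Fourier series $u=\sum_{k\in\mathbb{Z}}u_k e^{2\pi i k t}$ (in $t$), and for $s>0$, $$D^{s}u=\sum_{k\in\mathbb{Z}}|2\pi k|^{s}e^{i\,\mathrm{sgn}(k)s\pi/2}u_k e^{2\pi i k t},\qquad D^{s}_*u=\sum_{k\in\mathbb{Z}}|2\pi k|^{s}e^{-i\,\mathrm{sgn}(k)s\pi/2}u_k e^{2\pi i k t},$$ where $\mathrm{sgn}(k)=k/|k|$ for $k\ne0$ and $\mathrm{sgn}(0)=0$. For $s\in\mathbb{R}$,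 $\mathrm{H}^{(s)}(\mathbb{T},H)$ is the space of $H$-valued time-periodic distributions $u$ with $\sum_{k\in\mathbb{Z}}|1+k^2|^{s}\|u_k\|_H^2<\infty$. $\mathrm{H}^1_0(I)$ is the closure of the test functions $\mathcal{D}(I)$ in the usual Sobolev space $\mathrm{H}^1(I)$, and $\mathrm{H}^{-1}(I)=(\mathrm{H}^1_0(I))^*$. The working space is $$\mathrm{H}^{(\frac12,1)}_0=\mathrm{H}^{(\frac12)}(\mathbb{T},L^2(I))\cap L^2(\mathbb{T},\mathrm{H}^1_0(I)),$$ which is the closure of $\mathcal{D}(\mathbb{T}\times I)$ in $\mathrm{H}^{(\frac12)}(\mathbb{T},L^2(I))\cap L^2(\mathbb{T},\mathrm{H}^1(I))$. It carries the intersection Hilbert norm, given up to equivalence by $\|u\|^2=\|u\|_{L^2}^2+\|D^{1/2}u\|_{L^2}^2+\|u_x\|_{L^2}^2$, where $L^2=L^2(\mathbb{T}\times I)$. One has $\mathrm{H}^{(\frac12,1)}_0\subset L^4(\mathbb{T}\times I)$, so $u^2\in L^2(\mathbb{T}\times I)$ for $u\in \mathrm{H}^{(\frac12,1)}_0$. The space of forcing terms is $L^2(\mathbb{T},\mathrm{H}^{-1}(I))=(L^2(\mathbb{T},\mathrm{H}^1_0(I)))^*$, regarded as a subspace of the dual of $\mathrm{H}^{(\frac12,1)}_0$; $\langle\cdot,\cdot\rangle$ denotes the duality bracket between $\mathrm{H}^{(\frac12,1)}_0$ and its dual. The operators $\mathcal{L}$ and $S$, from $\mathrm{H}^{(\frac12,1)}_0$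 to its dual, are defined by $$\langle\mathcal{L}u,v\rangle=(D^{1/2}u,D^{1/2}_*v)+\mu(u_x,v_x),\qquad \langle S(u),v\rangle=-\tfrac12(u^2,v_x)\qquad\text{for all } v\in \mathrm{H}^{(\frac12,1)}_0,$$ where $\mu$ is the viscosity constant. *)

theory Defs
  imports "HOL-Analysis.Analysis"
begin

text \<open>
  A function on \<open>\<T> = \<real>/\<int>\<close> is given by its values on the fundamental domain \<open>[0,1)\<close>, and a function
  on \<open>\<T> \<times> I\<close> by a function of \<open>(t, x)\<close>. Elements of \<open>L\<^sup>2\<close> are represented by functions rather than by
  classes modulo null sets, so the norms below are seminorms whose kernel is the functions vanishing
  almost everywhere.
\<close>

definition circle :: "real measure"
  where "circle = restrict_space lborel {0..<1}"

definition interval :: "real measure"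
  where "interval = restrict_space lborel {0<..<1}"

abbreviation cylinder :: "(real \<times> real) measure"
  where "cylinder \<equiv> circle \<Otimes>\<^sub>M interval"

definition L2 :: "'a measure \<Rightarrow> ('a \<Rightarrow> real) set"
  where "L2 M = {f \<in> borel_measurable M. integrable M (\<lambda>z. (f z)\<^sup>2)}"

definition L2_inner :: "'a measure \<Rightarrow> ('a \<Rightarrow> real) \<Rightarrow> ('a \<Rightarrow> real) \<Rightarrow> real"
  where "L2_inner M f g = (LINT z|M. f z * g z)"

definition L2_norm :: "'a measure \<Rightarrow> ('a \<Rightarrow> real) \<Rightarrow> real"
  where "L2_norm M f = sqrt (L2_inner M f f)"

definition test_functions :: "(real \<Rightarrow> real) set"
  where "test_functions =
    {\<phi>. (\<forall>n x. (deriv ^^ n) \<phi> field_differentiable at x) \<and>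
         compact (closure {x. \<phi> x \<noteq> 0}) \<and> closure {x. \<phi> x \<noteq> 0} \<subseteq> {0<..<1}}"

definition has_weak_deriv :: "(real \<Rightarrow> real) \<Rightarrow> (real \<Rightarrow> real) \<Rightarrow> bool"
  where "has_weak_deriv g h \<longleftrightarrow>
    g \<in> L2 interval \<and> h \<in> L2 interval \<and>
    (\<forall>\<phi>\<in>test_functions. L2_inner interval g (deriv \<phi>) = - L2_inner interval h \<phi>)"

definition weak_deriv :: "(real \<Rightarrow> real) \<Rightarrow> real \<Rightarrow> real"
  where "weak_deriv g = (SOME h. has_weak_deriv g h)"

definition H1 :: "(real \<Rightarrow> real) set"
  where "H1 = {g. \<exists>h. has_weak_deriv g h}"

definition H1_norm :: "(real \<Rightarrow> real) \<Rightarrow> real"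
  where "H1_norm g = sqrt ((L2_norm interval g)\<^sup>2 + (L2_norm interval (weak_deriv g))\<^sup>2)"

definition H1_0 :: "(real \<Rightarrow> real) set"
  where "H1_0 = {g \<in> H1. \<forall>\<epsilon>>0. \<exists>\<phi>\<in>test_functions. H1_norm (\<lambda>x. g x - \<phi> x) < \<epsilon>}"

text \<open>
  The Bochner space \<open>L\<^sup>2(\<T>, H\<^sup>1(I))\<close> consists of the \<open>u \<in> L\<^sup>2(\<T> \<times> I)\<close> for which the derivatives of the
  slices \<open>u(t, \<cdot>)\<close> form an element of \<open>L\<^sup>2(\<T> \<times> I)\<close>; strong measurability in \<open>H\<^sup>1(I)\<close> is joint
  measurability of \<open>u\<close> and \<open>u\<^sub>x\<close>, because \<open>H\<^sup>1(I)\<close> is separable.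
\<close>

definition has_x_deriv :: "(real \<times> real \<Rightarrow> real) \<Rightarrow> (real \<times> real \<Rightarrow> real) \<Rightarrow> bool"
  where "has_x_deriv u w \<longleftrightarrow>
    u \<in> L2 cylinder \<and> w \<in> L2 cylinder \<and>
    (AE t in circle. has_weak_deriv (\<lambda>x. u (t, x)) (\<lambda>x. w (t, x)))"

definition x_deriv :: "(real \<times> real \<Rightarrow> real) \<Rightarrow> real \<times> real \<Rightarrow> real"
  where "x_deriv u = (SOME w. has_x_deriv u w)"

definition L2_H1_0 :: "(real \<times> real \<Rightarrow> real) set"
  where "L2_H1_0 = {u. (\<exists>w. has_x_deriv u w) \<and> (AE t in circle. (\<lambda>x. u (t, x)) \<in> H1_0)}"

definition L2_H1_norm :: "(real \<times> real \<Rightarrow> real) \<Rightarrow> real"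
  where "L2_H1_norm u = sqrt ((L2_norm cylinder u)\<^sup>2 + (L2_norm cylinder (x_deriv u))\<^sup>2)"

text \<open>The space \<open>L\<^sup>2(\<T>, H\<^sup>-\<^sup>1(I))\<close> as the topological dual of \<open>L\<^sup>2(\<T>, H\<^sup>1\<^sub>0(I))\<close>.
  The bound forces a functional to agree on functions that are equal almost everywhere.\<close>

definition L2_Hminus1 :: "((real \<times> real \<Rightarrow> real) \<Rightarrow> real) set"
  where "L2_Hminus1 = {f.
    (\<forall>v\<in>L2_H1_0. \<forall>w\<in>L2_H1_0. f (\<lambda>z. v z + w z) = f v + f w) \<and>
    (\<forall>c. \<forall>v\<in>L2_H1_0. f (\<lambda>z. c * v z) = c * f v) \<and>
    (\<exists>B. \<forall>v\<in>L2_H1_0. \<bar>f v\<bar> \<le> B * L2_H1_norm v)}"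

definition time_coeff :: "(real \<times> real \<Rightarrow> real) \<Rightarrow> int \<Rightarrow> real \<Rightarrow> complex"
  where "time_coeff u k x = (LINT t|circle. of_real (u (t, x)) * cis (- (2 * pi * of_int k * t)))"

text \<open>For \<open>s \<ge> 0\<close>, the distributions in \<open>H\<^sup>(\<^sup>s\<^sup>)(\<T>, L\<^sup>2(I))\<close> are functions in \<open>L\<^sup>2(\<T> \<times> I)\<close>.\<close>

definition H_time :: "real \<Rightarrow> (real \<times> real \<Rightarrow> real) set"
  where "H_time s = {u \<in> L2 cylinder.
    (\<lambda>k::int. (1 + (of_int k)\<^sup>2) powr s * (LINT x|interval. (cmod (time_coeff u k x))\<^sup>2))
      summable_on UNIV}"

definition is_time_multiplier ::
    "(int \<Rightarrow> complex) \<Rightarrow> (real \<times> real \<Rightarrow> real) \<Rightarrow> (real \<times> real \<Rightarrow> real) \<Rightarrow> bool"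
  where "is_time_multiplier m u w \<longleftrightarrow>
    w \<in> L2 cylinder \<and> (\<forall>k. AE x in interval. time_coeff w k x = m k * time_coeff u k x)"

text \<open>
  \<open>D\<^sup>s u\<close> and \<open>D\<^sup>s\<^sub>* u\<close> for \<open>s > 0\<close> and \<open>u \<in> H\<^sup>(\<^sup>s\<^sup>)(\<T>, L\<^sup>2(I))\<close>: the function in \<open>L\<^sup>2(\<T> \<times> I)\<close>, unique up to
  null sets, with the prescribed Fourier coefficients. It is real because the symbols satisfy
  \<open>m (- k) = cnj (m k)\<close>.
\<close>

definition frac_deriv :: "real \<Rightarrow> (real \<times> real \<Rightarrow> real) \<Rightarrow> real \<times> real \<Rightarrow> real"
  where "frac_deriv s u = (SOME w. is_time_multiplier
    (\<lambda>k. of_real (\<bar>2 * pi * of_int k\<bar> powr s) * cis (of_int (sgn k) * s * pi / 2)) u w)"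

definition frac_deriv_adj :: "real \<Rightarrow> (real \<times> real \<Rightarrow> real) \<Rightarrow> real \<times> real \<Rightarrow> real"
  where "frac_deriv_adj s u = (SOME w. is_time_multiplier
    (\<lambda>k. of_real (\<bar>2 * pi * of_int k\<bar> powr s) * cis (- (of_int (sgn k) * s * pi / 2))) u w)"

definition H_half_1_0 :: "(real \<times> real \<Rightarrow> real) set"
  where "H_half_1_0 = H_time (1/2) \<inter> L2_H1_0"

definition H_half_1_norm :: "(real \<times> real \<Rightarrow> real) \<Rightarrow> real"
  where "H_half_1_norm u = sqrt ((L2_norm cylinder u)\<^sup>2
    + (L2_norm cylinder (frac_deriv (1/2) u))\<^sup>2 + (L2_norm cylinder (x_deriv u))\<^sup>2)"

definition op_L :: "real \<Rightarrow> (real \<times> real \<Rightarrow> real) \<Rightarrow> (real \<times> real \<Rightarrow> real) \<Rightarrow> real"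
  where "op_L \<mu> u v = L2_inner cylinder (frac_deriv (1/2) u) (frac_deriv_adj (1/2) v)
    + \<mu> * L2_inner cylinder (x_deriv u) (x_deriv v)"

definition op_S :: "(real \<times> real \<Rightarrow> real) \<Rightarrow> (real \<times> real \<Rightarrow> real) \<Rightarrow> real"
  where "op_S u v = - (1/2) * L2_inner cylinder (\<lambda>z. (u z)\<^sup>2) (x_deriv v)"

end

theory Submission
  imports Defs "HOL-Probability.Probability_Measure"
begin

text \<open>
  Testing the equation with \<open>u\<close> itself kills the time derivative (its symbol is odd) and the nonlinearity
  (\<open>u\<^sup>2 u\<^sub>x\<close> is an exact derivative), so \<open>\<mu> \<parallel>u\<^sub>x\<parallel>\<^sup>2 = \<langle>f, u\<rangle>\<close> and \<open>R = \<parallel>u\<^sub>x\<parallel>\<close> is bounded. Testing with the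
  Hilbert transform \<open>v\<close> of \<open>u\<close> in time kills the viscous term instead and leaves
  \<open>E\<^sup>2 = \<parallel>D\<^sup>1\<^sup>/\<^sup>2 u\<parallel>\<^sup>2 = \<langle>f, v\<rangle> + \<lambda>/2 (u\<^sup>2, v\<^sub>x)\<close> with \<open>\<parallel>v\<^sub>x\<parallel> \<le> R\<close>. It remains to see that \<open>\<parallel>u\<^sup>2\<parallel>\<close> grows
  slower than \<open>E\<^sup>2\<close>. Agmon's inequality \<open>\<bar>u\<^sub>k(x)\<bar>\<^sup>2 \<le> 4 \<parallel>u\<^sub>k\<parallel> \<parallel>u\<^sub>k'\<parallel>\<close> for the time coefficients bounds \<open>u\<close> in
  \<open>L\<^sup>\<infinity>(I, H\<^sup>(\<^sup>1\<^sup>/\<^sup>4\<^sup>)(\<T>))\<close>; combined with the bound in \<open>L\<^sup>2(I, H\<^sup>(\<^sup>1\<^sup>/\<^sup>2\<^sup>)(\<T>))\<close>, a Cauchy--Schwarz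
  estimate of the convolution of the coefficients gives \<open>\<parallel>u\<^sup>2\<parallel>\<^sup>2 \<le> C R (E\<^sup>2 + R\<^sup>2)\<^sup>3\<^sup>/\<^sup>2\<close>.
\<close>

section \<open>Square-integrable functions\<close>

text \<open>The obstacle is criticality: the embedding into \<open>L4\<close> bounds the norm of
  \<open>u\<^sup>2\<close> by a quadratic expression in the energy norm, so testing with the Hilbert
  transform would bound E^2 only by a constant plus a multiple of E^2, with no smallness to absorb
  it. Knowing R first lowers the growth to E^(3/2), and then the inequality closes. The parameter
  \<open>lam\<close> enters only through \<open>0 \<le> lam\<close> and \<open>lam \<le> 1\<close>,
  so one constant serves the whole homotopy.

  The functions are representatives and all derivatives are \<open>SOME\<close> choices. They are
  controlled through two descriptions: the time coefficients, which determine a function up to null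
  sets and on which D^(1/2), its adjoint and the Hilbert transform act as multipliers; and the
  primitives of mean-zero functions, which make up \<open>H1_0\<close>. Multipliers in t and
  primitives in x commute by Fubini, and this keeps the Hilbert transform inside the space. The
  frequency 0 is invisible both to D^(1/2) and to the Hilbert transform; it is recovered from the
  x-derivative by Poincare.\<close>

lemma L2_measurable [measurable_dest]: "f \<in> L2 M \<Longrightarrow> f \<in> borel_measurable M"
  by (simp add: L2_def)

lemma L2_integrable_square: "f \<in> L2 M \<Longrightarrow> integrable M (\<lambda>z. (f z)\<^sup>2)"
  by (simp add: L2_def)

lemma L2_I: "f \<in> borel_measurable M \<Longrightarrow> integrable M (\<lambda>z. (f z)\<^sup>2) \<Longrightarrow> f \<in> L2 M"
  by (simp add: L2_def)

lemma L2_bound: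
  assumes "g \<in> L2 M" "f \<in> borel_measurable M" "AE z in M. \<bar>f z\<bar> \<le> \<bar>g z\<bar>"
  shows "f \<in> L2 M"
proof (rule L2_I[OF assms(2)], rule Bochner_Integration.integrable_bound[OF L2_integrable_square[OF
    assms(1)]])
  show "(\<lambda>z. (f z)\<^sup>2) \<in> borel_measurable M" using assms(2) by measurable
  show "AE z in M. norm ((f z)\<^sup>2) \<le> norm ((g z)\<^sup>2)"
    using assms(3) by eventually_elim (simp add: abs_le_square_iff)
qed

lemma L2_mult_integrable:
  assumes "f \<in> L2 M" "g \<in> L2 M"
  shows "integrable M (\<lambda>z. f z * g z)"
proof (rule Bochner_Integration.integrable_bound)
  show "integrable M (\<lambda>z. (f z)\<^sup>2 + (g z)\<^sup>2)"
    using assms by (intro Bochner_Integration.integrable_add L2_integrable_square)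
  show "(\<lambda>z. f z * g z) \<in> borel_measurable M"
    using assms by measurable
  show "AE z in M. norm (f z * g z) \<le> norm ((f z)\<^sup>2 + (g z)\<^sup>2)"
  proof (intro AE_I2)
    fix z
    have "2 * \<bar>f z * g z\<bar> \<le> (f z)\<^sup>2 + (g z)\<^sup>2"
      using sum_squares_bound[of "\<bar>f z\<bar>" "\<bar>g z\<bar>"] by (simp add: abs_mult)
    moreover have "\<bar>f z * g z\<bar> \<le> 2 * \<bar>f z * g z\<bar>"
      by simp
    ultimately show "norm (f z * g z) \<le> norm ((f z)\<^sup>2 + (g z)\<^sup>2)"
      unfolding real_norm_def by linarith
  qed
qed

lemma L2_add: "f \<in> L2 M \<Longrightarrow> g \<in> L2 M \<Longrightarrow> (\<lambda>z. f z + g z) \<in> L2 M"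
  using L2_mult_integrable[of f M g]
  by (auto intro!: L2_I Bochner_Integration.integrable_add integrable_mult_right
      dest: L2_integrable_square L2_measurable simp: power2_sum mult.assoc)

lemma L2_scale: "f \<in> L2 M \<Longrightarrow> (\<lambda>z. c * f z) \<in> L2 M"
  by (auto intro!: L2_I dest: L2_integrable_square L2_measurable simp: power_mult_distrib)

lemma L2_diff: "f \<in> L2 M \<Longrightarrow> g \<in> L2 M \<Longrightarrow> (\<lambda>z. f z - g z) \<in> L2 M"
  using L2_add[of f M "\<lambda>z. (-1) * g z"] L2_scale[of g M "-1"] by simp

lemma L2_zero: "(\<lambda>z. 0) \<in> L2 M"
  by (simp add: L2_I)

lemma (in finite_measure) L2_const: "(\<lambda>z. c) \<in> L2 M"
  by (simp add: L2_I)

lemma (in finite_measure) L2_integrable: "f \<in> L2 M \<Longrightarrow> integrable M f"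
  using L2_mult_integrable[of f M "\<lambda>z. 1"] L2_const by simp

section \<open>Seminorm and scalar product of \<open>L2\<close>\<close>

lemma L2_norm_nonneg [simp]: "0 \<le> L2_norm M f"
  by (auto simp: L2_norm_def L2_inner_def intro!: integral_nonneg_AE)

lemma L2_norm_square: "(L2_norm M f)\<^sup>2 = (LINT z|M. (f z)\<^sup>2)"
  by (simp add: L2_norm_def L2_inner_def power2_eq_square[symmetric] integral_nonneg_AE)

lemma L2_inner_self: "L2_inner M f f = (L2_norm M f)\<^sup>2"
  unfolding L2_norm_square by (simp add: L2_inner_def power2_eq_square)

lemma L2_inner_Cauchy_Schwarz:
  assumes "f \<in> L2 M" "g \<in> L2 M"
  shows "\<bar>L2_inner M f g\<bar> \<le> L2_norm M f * L2_norm M g"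
proof -
  have fg: "integrable M (\<lambda>z. f z * g z)" "integrable M (\<lambda>z. (f z)\<^sup>2)" "integrable M (\<lambda>z. (g z)\<^sup>2)"
    using assms by (auto intro: L2_mult_integrable L2_integrable_square)
  have "0 \<le> (L2_norm M f)\<^sup>2 * s\<^sup>2 + 2 * s * L2_inner M f g + (L2_norm M g)\<^sup>2" for s
  proof -
    have "0 \<le> (LINT z|M. (s * f z + g z)\<^sup>2)"
      by (intro integral_nonneg_AE) auto
    also have "\<dots> = (LINT z|M. s\<^sup>2 * (f z)\<^sup>2 + 2 * s * (f z * g z) + (g z)\<^sup>2)"
      by (intro Bochner_Integration.integral_cong) (auto simp: power2_eq_square algebra_simps)
    also have "\<dots> = s\<^sup>2 * (LINT z|M. (f z)\<^sup>2) + 2 * s * L2_inner M f g + (LINT z|M. (g z)\<^sup>2)"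
      using fg by (simp add: L2_inner_def)
    finally show ?thesis
      by (simp add: L2_norm_square mult.commute)
  qed
  note pos = this
  define a b c where "a = (L2_norm M f)\<^sup>2" and "b = L2_inner M f g" and "c = (L2_norm M g)\<^sup>2"
  have pos: "0 \<le> a * s\<^sup>2 + 2 * s * b + c" for s
    using pos[of s] by (simp add: a_def b_def c_def)
  have "b\<^sup>2 \<le> a * c"
  proof (cases "a = 0")
    case True
    have "b = 0"
    proof (rule ccontr)
      assume "b \<noteq> 0"
      \<comment> \<open>For \<open>a = 0\<close> the polynomial is affine in \<open>s\<close>, and
        at this \<open>s\<close> it takes the value -1.\<close>
      with pos[of "-(c + 1) / (2 * b)"] True show False by (simp add: field_simps)
    qed
    with True show ?thesis by simp
  next
    case False
    then have "a > 0" by (simp add: a_def)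
    with pos[of "- b / a"] show ?thesis
      by (simp add: power2_eq_square field_simps)
  qed
  then have "\<bar>b\<bar>\<^sup>2 \<le> (L2_norm M f * L2_norm M g)\<^sup>2"
    by (simp add: a_def c_def power_mult_distrib)
  then show ?thesis
    using power2_le_imp_le[of "\<bar>b\<bar>"] by (simp add: b_def)
qed

lemma L2_norm_triangle:
  assumes "f \<in> L2 M" "g \<in> L2 M"
  shows "L2_norm M (\<lambda>z. f z + g z) \<le> L2_norm M f + L2_norm M g"
proof (rule power2_le_imp_le)
  have "(L2_norm M (\<lambda>z. f z + g z))\<^sup>2 = (LINT z|M. (f z)\<^sup>2 + 2 * (f z * g z) + (g z)\<^sup>2)"
    unfolding L2_norm_square by (intro Bochner_Integration.integral_cong) (auto simp: power2_sum)
  also have "\<dots> = (L2_norm M f)\<^sup>2 + 2 * L2_inner M f g + (L2_norm M g)\<^sup>2"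
    using assms by (simp add: L2_norm_square L2_inner_def L2_mult_integrable L2_integrable_square)
  also have "\<dots> \<le> (L2_norm M f + L2_norm M g)\<^sup>2"
    using L2_inner_Cauchy_Schwarz[OF assms] by (simp add: power2_sum)
  finally show "(L2_norm M (\<lambda>z. f z + g z))\<^sup>2 \<le> (L2_norm M f + L2_norm M g)\<^sup>2" .
qed auto

lemma L2_norm_minus: "L2_norm M (\<lambda>z. - f z) = L2_norm M f"
  by (simp add: L2_norm_def L2_inner_def)

lemma L2_norm_commute: "L2_norm M (\<lambda>z. f z - g z) = L2_norm M (\<lambda>z. g z - f z)"
  using L2_norm_minus[of M "\<lambda>z. f z - g z"] by simp

lemma L2_norm_triangle_diff:
  assumes "f \<in> L2 M" "g \<in> L2 M" "h \<in> L2 M"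
  shows "L2_norm M (\<lambda>z. f z - h z) \<le> L2_norm M (\<lambda>z. f z - g z) + L2_norm M (\<lambda>z. g z - h z)"
  using L2_norm_triangle[OF L2_diff[OF assms(1,2)] L2_diff[OF assms(2,3)]] by simp

lemma L2_norm_triangle_sub:
  assumes "f \<in> L2 M" "g \<in> L2 M"
  shows "L2_norm M f \<le> L2_norm M g + L2_norm M (\<lambda>z. f z - g z)"
  using L2_norm_triangle[OF assms(2) L2_diff[OF assms]] by simp

lemma L2_norm_abs_diff:
  assumes "f \<in> L2 M" "g \<in> L2 M"
  shows "\<bar>L2_norm M f - L2_norm M g\<bar> \<le> L2_norm M (\<lambda>z. f z - g z)"
  using L2_norm_triangle_sub[OF assms] L2_norm_triangle_sub[OF assms(2,1)] L2_norm_commute[of M f g]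
  by linarith

lemma L2_inner_cong_AE:
  assumes "f \<in> borel_measurable M" "f' \<in> borel_measurable M" "AE z in M. f z = f' z"
    and "g \<in> borel_measurable M" "g' \<in> borel_measurable M" "AE z in M. g z = g' z"
  shows "L2_inner M f g = L2_inner M f' g'"
  unfolding L2_inner_def
  using assms by (intro integral_cong_AE) (auto elim: eventually_elim2)

lemma L2_norm_cong_AE:
  assumes "f \<in> borel_measurable M" "g \<in> borel_measurable M" "AE z in M. f z = g z"
  shows "L2_norm M f = L2_norm M g"
  unfolding L2_norm_def using L2_inner_cong_AE[OF assms assms] by simp

lemma L2_norm_mono_AE:
  assumes "g \<in> L2 M" "f \<in> borel_measurable M" "AE z in M. \<bar>f z\<bar> \<le> \<bar>g z\<bar>"
  shows "L2_norm M f \<le> L2_norm M g"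
proof (rule power2_le_imp_le)
  show "(L2_norm M f)\<^sup>2 \<le> (L2_norm M g)\<^sup>2"
    unfolding L2_norm_square using assms L2_bound[OF assms]
    by (intro integral_mono_AE) (auto intro: L2_integrable_square elim: eventually_mono simp:
        abs_le_square_iff)
qed simp

lemma L2_norm_eq_zero:
  assumes "f \<in> L2 M" "L2_norm M f = 0"
  shows "AE z in M. f z = 0"
proof -
  have "(LINT z|M. (f z)\<^sup>2) = 0" using L2_norm_square[of M f] assms(2) by simp
  then have "AE z in M. (f z)\<^sup>2 = 0"
    by (subst (asm) integral_nonneg_eq_0_iff_AE) (auto intro: L2_integrable_square[OF assms(1)])
  then show ?thesis by simp
qed

lemma (in prob_space) integral_le_L2_norm:
  assumes "f \<in> L2 M"
  shows "\<bar>LINT z|M. f z\<bar> \<le> L2_norm M f"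
  using L2_inner_Cauchy_Schwarz[OF assms L2_const[of 1]]
  by (simp add: L2_inner_def L2_norm_def prob_space)

lemma (in prob_space) L2_norm_const_bound:
  assumes "f \<in> borel_measurable M" "AE z in M. \<bar>f z\<bar> \<le> c" "c \<ge> 0"
  shows "L2_norm M f \<le> c"
  using L2_norm_mono_AE[OF L2_const[of c] assms(1)] assms(2,3)
  by (simp add: L2_norm_def L2_inner_def prob_space)

lemma (in finite_measure) L2_bounded:
  assumes "f \<in> borel_measurable M" "AE z in M. \<bar>f z\<bar> \<le> c"
  shows "f \<in> L2 M"
  using assms by (intro L2_bound[OF L2_const[of c]]) (auto elim: eventually_mono)

text \<open>Fatou's lemma in Bochner form. Integrability of the limit is part of the conclusion and
  no dominating function is asked for; the completeness proof and the passage from partial sums to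
  \<open>u\<close> in \<open>square_L2_bound\<close> rely on both.\<close>

lemma integral_le_of_AE_limit:
  fixes f :: "'a \<Rightarrow> real"
  assumes s: "\<And>n. integrable M (s n)" and nn: "\<And>n. AE x in M. 0 \<le> s n x"
    and le: "\<And>n. n \<ge> N \<Longrightarrow> integral\<^sup>L M (s n) \<le> C"
    and lim: "AE x in M. (\<lambda>n. s n x) \<longlonglongrightarrow> f x" and f: "f \<in> borel_measurable M"
  shows "integrable M f" and "integral\<^sup>L M f \<le> C"
proof -
  have fnn: "AE x in M. 0 \<le> f x"
  proof -
    have "AE x in M. \<forall>n. 0 \<le> s n x" using nn by (simp add: AE_all_countable)
    with lim show ?thesis by eventually_elim (auto intro: LIMSEQ_le_const)
  qed
  have C: "0 \<le> C"
    using le[of N] integral_nonneg_AE[OF nn[of N]] by simp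
  have "(\<integral>\<^sup>+x. ennreal (f x) \<partial>M) = (\<integral>\<^sup>+x. liminf (\<lambda>n. ennreal (s n x)) \<partial>M)"
    using lim by (intro nn_integral_cong_AE)
      (auto elim!: eventually_mono intro!: lim_imp_Liminf[symmetric] tendsto_ennrealI)
  also have "\<dots> \<le> liminf (\<lambda>n. \<integral>\<^sup>+x. ennreal (s n x) \<partial>M)"
    using s by (intro nn_integral_liminf) (auto dest: borel_measurable_integrable)
  also have "\<dots> = liminf (\<lambda>n. ennreal (integral\<^sup>L M (s n)))"
    using s nn by (simp add: nn_integral_eq_integral)
  also have "\<dots> \<le> liminf (\<lambda>n. ennreal C)"
    using le by (intro Liminf_mono) (auto intro!: eventually_sequentiallyI[of N] ennreal_leI)
  also have "\<dots> = ennreal C" by (simp add: Liminf_const)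
  finally have le': "(\<integral>\<^sup>+x. ennreal (f x) \<partial>M) \<le> ennreal C" .
  show "integrable M f"
    using le' f fnn by (intro integrableI_nonneg) (auto simp: le_less_trans)
  then show "integral\<^sup>L M f \<le> C"
    using le' fnn C by (simp add: nn_integral_eq_integral)
qed

text \<open>Along a subsequence the increments \<open>d k\<close> have norm below
  \<open>(1/2)^k\<close>. Even with weights \<open>2^k\<close> their squares have a finite
  integrated sum, hence a finite sum almost everywhere, and the inequality of arithmetic and
  geometric means bounds the absolute value of \<open>d k z\<close> by
  \<open>2^k * (d k z)\<^sup>2 + (1/2)^k\<close>. So the subsequence converges pointwise without any
  assumption on the total measure.\<close>

lemma L2_complete:
  fixes f :: "nat \<Rightarrow> 'a \<Rightarrow> real"
  assumes f: "\<And>n. f n \<in> L2 M"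
    and cauchy: "\<And>e. e > 0 \<Longrightarrow> \<exists>N. \<forall>m\<ge>N. \<forall>n\<ge>N. L2_norm M (\<lambda>z. f m z - f n z) < e"
  shows "\<exists>g\<in>L2 M. (\<lambda>n. L2_norm M (\<lambda>z. f n z - g z)) \<longlonglongrightarrow> 0"
proof -
  have "\<exists>N. \<forall>k. \<forall>m\<ge>N k. \<forall>n\<ge>N k. L2_norm M (\<lambda>z. f m z - f n z) < (1/2)^k"
    using cauchy[of "(1/2)^k" for k] by (intro choice allI) auto
  then obtain N where N: "\<And>k m n. m \<ge> N k \<Longrightarrow> n \<ge> N k \<Longrightarrow> L2_norm M (\<lambda>z. f m z - f n z) < (1/2)^k"
    by metis
  \<comment> \<open>Partial sums of \<open>N\<close> replace a running maximum: \<open>r\<close> is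
    nondecreasing, and \<open>r k\<close> is at least \<open>N k\<close> and at least
    \<open>k\<close>.\<close>
  define r where "r k = (\<Sum>i\<le>k. N i) + k" for k :: nat
  have rN: "r k \<ge> N k" for k
    unfolding r_def using member_le_sum[of k "{..k}" N] by auto
  have r_mono: "r k \<le> r (Suc k)" for k by (simp add: r_def)
  have r_ge: "r k \<ge> k" for k by (simp add: r_def)
  define d where "d k z = f (r (Suc k)) z - f (r k) z" for k z
  have dL2: "d k \<in> L2 M" for k unfolding d_def by (intro L2_diff f)
  have dm [measurable]: "d k \<in> borel_measurable M" for k using dL2 by (rule L2_measurable)
  have d: "L2_norm M (d k) < (1/2)^k" for k
    unfolding d_def using N[of k "r (Suc k)" "r k"] rN[of k] r_mono[of k] by auto
  have dint: "(LINT z|M. (d k z)\<^sup>2) \<le> (1/4)^k" for k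
  proof -
    have "(L2_norm M (d k))\<^sup>2 \<le> ((1/2)^k)\<^sup>2" using d[of k] by (intro power_mono) auto
    also have "((1/2)^k)\<^sup>2 = (1/4::real)^k" by (simp add: power2_eq_square flip: power_mult_distrib)
    finally show ?thesis by (simp add: L2_norm_square)
  qed
  have "(\<integral>\<^sup>+z. (\<Sum>k. ennreal (2^k * (d k z)\<^sup>2)) \<partial>M) = (\<Sum>k. \<integral>\<^sup>+z. ennreal (2^k * (d k z)\<^sup>2) \<partial>M)"
    by (intro nn_integral_suminf) measurable
  also have "\<dots> = (\<Sum>k. ennreal (2^k * (LINT z|M. (d k z)\<^sup>2)))"
    using L2_integrable_square[OF dL2] by (subst nn_integral_eq_integral) auto
  also have "\<dots> \<le> (\<Sum>k. ennreal ((1/2)^k))"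
  proof (rule suminf_le)
    fix k
    have "2^k * (LINT z|M. (d k z)\<^sup>2) \<le> 2^k * (1/4)^k"
      using dint[of k] by simp
    also have "\<dots> = (1/2::real)^k" by (simp flip: power_mult_distrib)
    finally show "ennreal (2^k * (LINT z|M. (d k z)\<^sup>2)) \<le> ennreal ((1/2)^k)" by (rule ennreal_leI)
  qed auto
  also have "\<dots> < \<infinity>"
    by (subst suminf_ennreal2) (auto simp: summable_geometric)
  finally have fin: "(\<integral>\<^sup>+z. (\<Sum>k. ennreal (2^k * (d k z)\<^sup>2)) \<partial>M) \<noteq> \<infinity>" by simp
  have "AE z in M. (\<Sum>k. ennreal (2^k * (d k z)\<^sup>2)) \<noteq> \<infinity>"
    by (intro nn_integral_PInf_AE[OF _ fin]) measurable
  then have conv: "AE z in M. convergent (\<lambda>n. f (r n) z)"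
  proof eventually_elim
    case (elim z)
    have "summable (\<lambda>k. 2^k * (d k z)\<^sup>2)"
      using elim by (intro summable_suminf_not_top) auto
    moreover have "summable (\<lambda>k. (1/2::real)^k)" by (simp add: summable_geometric)
    ultimately have s: "summable (\<lambda>k. 2^k * (d k z)\<^sup>2 + (1/2)^k)" by (rule summable_add)
    have "summable (\<lambda>k. d k z)"
    proof (rule summable_comparison_test'[OF s, of 0])
      fix k :: nat
      define a where "a = sqrt (2^k)"
      have a: "a > 0" "a\<^sup>2 = 2^k" by (auto simp: a_def)
      have "2 * (a * \<bar>d k z\<bar>) * (1 / a) \<le> (a * \<bar>d k z\<bar>)\<^sup>2 + (1/a)\<^sup>2"
        by (rule sum_squares_bound)
      then have "2 * \<bar>d k z\<bar> \<le> 2^k * (d k z)\<^sup>2 + (1/2)^k"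
        using a by (simp add: power_mult_distrib power_divide)
      then show "norm (d k z) \<le> 2^k * (d k z)\<^sup>2 + (1/2)^k"
        unfolding real_norm_def by linarith
    qed
    then have "convergent (\<lambda>n. \<Sum>k<n. d k z)" by (simp add: summable_iff_convergent)
    moreover have "(\<Sum>k<n. d k z) = f (r n) z - f (r 0) z" for n
      unfolding d_def by (rule sum_lessThan_telescope)
    ultimately have "convergent (\<lambda>n. f (r n) z - f (r 0) z)" by simp
    then have "convergent (\<lambda>n. (f (r n) z - f (r 0) z) + f (r 0) z)"
      by (intro convergent_add) (auto intro: convergent_const)
    then show ?case by simp
  qed
  define g where "g z = lim (\<lambda>n. f (r n) z)" for z
  have fm [measurable]: "f n \<in> borel_measurable M" for n using f by (rule L2_measurable)
  have gm [measurable]: "g \<in> borel_measurable M"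
    unfolding g_def by measurable
  have glim: "AE z in M. (\<lambda>n. f (r n) z) \<longlonglongrightarrow> g z"
    using conv by eventually_elim (simp add: g_def convergent_LIMSEQ_iff)
  \<comment> \<open>Fatou in the second index, along \<open>r m\<close> with \<open>n\<close> fixed:
    the Cauchy bound survives the limit, and the difference is square integrable.\<close>
  have main: "(\<lambda>z. f n z - g z) \<in> L2 M \<and> L2_norm M (\<lambda>z. f n z - g z) \<le> e"
    if e: "e > 0" and n: "n \<ge> K" and K: "\<And>m n. m \<ge> K \<Longrightarrow> n \<ge> K \<Longrightarrow> L2_norm M (\<lambda>z. f m z - f n z) < e"
    for e n K
  proof -
    have int: "integrable M (\<lambda>z. (f n z - f (r m) z)\<^sup>2)" for m
      by (intro L2_integrable_square L2_diff f)
    have le: "(LINT z|M. (f n z - f (r m) z)\<^sup>2) \<le> e\<^sup>2" if "m \<ge> K" for m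
      unfolding L2_norm_square[symmetric] using K[OF n, of "r m"] r_ge[of m] that
      by (intro power_mono) auto
    have lim: "AE z in M. (\<lambda>m. (f n z - f (r m) z)\<^sup>2) \<longlonglongrightarrow> (f n z - g z)\<^sup>2"
      using glim by eventually_elim (intro tendsto_intros)
    have "integrable M (\<lambda>z. (f n z - g z)\<^sup>2)" "(LINT z|M. (f n z - g z)\<^sup>2) \<le> e\<^sup>2"
      using integral_le_of_AE_limit[OF int _ le lim] by auto
    note g = this
    have "(L2_norm M (\<lambda>z. f n z - g z))\<^sup>2 \<le> e\<^sup>2"
      using g(2) by (simp only: L2_norm_square)
    then have "L2_norm M (\<lambda>z. f n z - g z) \<le> e"
      by (rule power2_le_imp_le) (use e in simp)
    moreover have "(\<lambda>z. f n z - g z) \<in> L2 M"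
      using g(1) by (intro L2_I) measurable
    ultimately show ?thesis by blast
  qed
  have "g \<in> L2 M"
  proof -
    obtain K where K: "\<And>m n. m \<ge> K \<Longrightarrow> n \<ge> K \<Longrightarrow> L2_norm M (\<lambda>z. f m z - f n z) < 1"
      using cauchy[of 1] by auto
    have "(\<lambda>z. f K z - g z) \<in> L2 M" using main[of 1 K K, OF _ _ K] by auto
    from L2_diff[OF f[of K] this] show ?thesis by simp
  qed
  moreover have "(\<lambda>n. L2_norm M (\<lambda>z. f n z - g z)) \<longlonglongrightarrow> 0"
  proof (rule LIMSEQ_I)
    fix e :: real assume e: "e > 0"
    obtain K where K: "\<And>m n. m \<ge> K \<Longrightarrow> n \<ge> K \<Longrightarrow> L2_norm M (\<lambda>z. f m z - f n z) < e/2"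
      using cauchy[of "e/2"] e by auto
    have "norm (L2_norm M (\<lambda>z. f n z - g z) - 0) < e" if "n \<ge> K" for n
      using main[of "e/2" K n, OF _ that K] e by auto
    then show "\<exists>K. \<forall>n\<ge>K. norm (L2_norm M (\<lambda>z. f n z - g z) - 0) < e" by blast
  qed
  ultimately show ?thesis by blast
qed

lemma L2_limit_AE_subseq:
  assumes f: "\<And>n. f n \<in> L2 M" and g: "g \<in> L2 M"
    and lim: "(\<lambda>n. L2_norm M (\<lambda>z. f n z - g z)) \<longlonglongrightarrow> 0"
  shows "\<exists>r::nat\<Rightarrow>nat. strict_mono r \<and> (AE z in M. (\<lambda>n. f (r n) z) \<longlonglongrightarrow> g z)"
proof -
  have "(\<lambda>n. (L2_norm M (\<lambda>z. f n z - g z))\<^sup>2) \<longlonglongrightarrow> 0\<^sup>2"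
    by (intro tendsto_intros lim)
  then have "(\<lambda>n. LINT z|M. norm ((f n z - g z)\<^sup>2)) \<longlonglongrightarrow> 0"
    by (simp add: L2_norm_square)
  then obtain r :: "nat \<Rightarrow> nat" where r: "strict_mono r" "AE z in M. (\<lambda>n. (f (r n) z - g z)\<^sup>2) \<longlonglongrightarrow> 0"
    using tendsto_L1_AE_subseq[of M "\<lambda>n z. (f n z - g z)\<^sup>2"] L2_integrable_square[OF L2_diff[OF f g]] by auto
  have "AE z in M. (\<lambda>n. f (r n) z) \<longlonglongrightarrow> g z"
    using r(2)
  proof eventually_elim
    case (elim z)
    then have "(\<lambda>n. sqrt ((f (r n) z - g z)\<^sup>2)) \<longlonglongrightarrow> sqrt 0" by (intro tendsto_intros)
    then have "(\<lambda>n. f (r n) z - g z) \<longlonglongrightarrow> 0" by (simp add: tendsto_rabs_zero_iff)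
    then show ?case by (simp add: LIM_zero_iff)
  qed
  with r(1) show ?thesis by blast
qed

section \<open>Fourier coefficients on the circle\<close>

lemma prob_space_unit_restrict:
  assumes "A \<in> sets borel" "emeasure lborel A = 1"
  shows "prob_space (restrict_space lborel A)"
  using assms by (intro prob_spaceI) (simp add: space_restrict_space emeasure_restrict_space)

interpretation circle: prob_space circle
  unfolding circle_def by (rule prob_space_unit_restrict) auto

interpretation interval: prob_space interval
  unfolding interval_def by (rule prob_space_unit_restrict) auto

interpretation cylinder: pair_prob_space circle interval ..

lemma space_circle: "space circle = {0..<1}"
  by (simp add: circle_def space_restrict_space)

lemma space_interval: "space interval = {0<..<1}"
  by (simp add: interval_def space_restrict_space)

lemma measurable_circle_borel: "f \<in> measurable borel N \<Longrightarrow> f \<in> measurable circle N"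
  unfolding circle_def by (rule measurable_restrict_space1) simp

lemma measurable_interval_borel: "f \<in> measurable borel N \<Longrightarrow> f \<in> measurable interval N"
  unfolding interval_def by (rule measurable_restrict_space1) simp

lemma measurable_circle_id [measurable]: "(\<lambda>t. t) \<in> borel_measurable circle"
  by (rule measurable_circle_borel) simp

lemma measurable_interval_id [measurable]: "(\<lambda>t. t) \<in> borel_measurable interval"
  by (rule measurable_interval_borel) simp

lemma measurable_cylinder_fst [measurable]: "fst \<in> borel_measurable cylinder"
  using measurable_compose[OF measurable_fst measurable_circle_id] by simp

lemma measurable_cylinder_snd [measurable]: "snd \<in> borel_measurable cylinder"
  using measurable_compose[OF measurable_snd measurable_interval_id] by simp

lemma borel_measurable_cis [measurable (raw)]:
  "f \<in> borel_measurable M \<Longrightarrow> (\<lambda>x. cis (f x)) \<in> borel_measurable M"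
  using measurable_compose[of f M borel cis borel]
  by (simp add: borel_measurable_continuous_onI continuous_on_cis)

lemma integral_circle: "integral\<^sup>L circle f = (LINT t|lborel. indicator {0..<1} t *\<^sub>R f t)"
  for f :: "real \<Rightarrow> 'a::{banach, second_countable_topology}"
  unfolding circle_def by (subst integral_restrict_space) simp_all

lemma integral_interval: "integral\<^sup>L interval f = (LINT t|lborel. indicator {0<..<1} t *\<^sub>R f t)"
  for f :: "real \<Rightarrow> 'a::{banach, second_countable_topology}"
  unfolding interval_def by (subst integral_restrict_space) simp_all

lemma integral_circle_FTC:
  fixes F :: "real \<Rightarrow> 'a::euclidean_space"
  assumes "\<And>x. (F has_vector_derivative f x) (at x)" "continuous_on UNIV f"
  shows "integral\<^sup>L circle f = F 1 - F 0"
proof -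
  have "integral\<^sup>L circle f = (LINT t|lborel. indicator {0..1} t *\<^sub>R f t)"
    unfolding integral_circle
  proof (rule integral_cong_AE)
    have f: "f \<in> borel_measurable lborel"
      using borel_measurable_continuous_onI[OF assms(2)] by simp
    show "(\<lambda>t. indicator {0..<1} t *\<^sub>R f t) \<in> borel_measurable lborel"
      using f by (intro borel_measurable_scaleR) auto
    show "(\<lambda>t. indicator {0..1} t *\<^sub>R f t) \<in> borel_measurable lborel"
      using f by (intro borel_measurable_scaleR) auto
    show "AE t in lborel. indicator {0..<1} t *\<^sub>R f t = indicator {0..1} t *\<^sub>R f t"
      using AE_lborel_singleton[of 1] by eventually_elim (auto simp: indicator_def)
  qed
  also have "\<dots> = F 1 - F 0"
    using assms by (intro integral_FTC_Icc) (auto intro: has_vector_derivative_at_within continuous_on_subset)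
  finally show ?thesis .
qed

lemma integral_circle_cis:
  "(LINT t|circle. cis (2 * pi * of_int k * t)) = (if k = 0 then 1 else 0)"
proof (cases "k = 0")
  case True
  then show ?thesis by (simp add: circle.prob_space)
next
  case False
  define c where "c = 2 * pi * of_int k"
  have c: "c \<noteq> 0" using False by (simp add: c_def)
  have "((\<lambda>t. cis (c * t) / (\<i> * c)) has_vector_derivative cis (c * t)) (at t)" for t
    unfolding has_vector_derivative_def using c
    by (auto intro!: derivative_eq_intros simp: scaleR_conv_of_real field_simps)
  then have "(LINT t|circle. cis (c * t)) = cis (c * 1) / (\<i> * c) - cis (c * 0) / (\<i> * c)"
    by (rule integral_circle_FTC) (intro continuous_intros)
  also have "cis (c * 1) = 1" by (simp add: c_def)
  finally show ?thesis using False by (simp add: c_def)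
qed

lemma integrable_mult_cis:
  fixes g :: "'a \<Rightarrow> complex"
  assumes "integrable M g" "a \<in> borel_measurable M"
  shows "integrable M (\<lambda>t. g t * cis (a t))"
  using assms by (intro Bochner_Integration.integrable_bound[OF assms(1)]) (auto simp: norm_mult)

section \<open>Uniqueness of Fourier coefficients on the circle\<close>

definition circle_coeff :: "(real \<Rightarrow> real) \<Rightarrow> int \<Rightarrow> complex"
  where "circle_coeff g k = (LINT t|circle. of_real (g t) * cis (- (2 * pi * of_int k * t)))"

lemma time_coeff_eq: "time_coeff u k x = circle_coeff (\<lambda>t. u (t, x)) k"
  by (simp add: time_coeff_def circle_coeff_def)

definition no_frequencies :: "(real \<Rightarrow> real) \<Rightarrow> bool"
  where "no_frequencies h \<longleftrightarrow> integrable circle h \<and> (\<forall>k. circle_coeff h k = 0)"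

lemma circle_coeff_integrable:
  "integrable circle h \<Longrightarrow> integrable circle (\<lambda>t. of_real (h t) * cis (- (2 * pi * of_int k * t)))"
  by (intro integrable_mult_cis) auto

lemma circle_coeff_add:
  "integrable circle g \<Longrightarrow> integrable circle h \<Longrightarrow>
    circle_coeff (\<lambda>t. g t + h t) k = circle_coeff g k + circle_coeff h k"
  unfolding circle_coeff_def
  by (subst Bochner_Integration.integral_add[symmetric])
    (auto intro: circle_coeff_integrable simp: distrib_right)

lemma circle_coeff_scale: "circle_coeff (\<lambda>t. c * h t) k = of_real c * circle_coeff h k"
  by (simp add: circle_coeff_def mult.assoc)

lemma circle_coeff_diff:
  "integrable circle g \<Longrightarrow> integrable circle h \<Longrightarrow>
    circle_coeff (\<lambda>t. g t - h t) k = circle_coeff g k - circle_coeff h k"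
  using circle_coeff_add[of g "\<lambda>t. -1 * h t" k] circle_coeff_scale[of "-1" h k] by simp

lemma circle_coeff_cong_AE:
  assumes "g \<in> borel_measurable circle" "h \<in> borel_measurable circle" "AE t in circle. g t = h t"
  shows "circle_coeff g k = circle_coeff h k"
  unfolding circle_coeff_def using assms by (intro integral_cong_AE) (auto elim: eventually_mono)

lemma circle_coeff_cnj: "circle_coeff h (- k) = cnj (circle_coeff h k)"
  unfolding circle_coeff_def
  by (subst Bochner_Integration.integral_cnj[symmetric]) (simp add: cis_cnj)

lemma no_frequencies_mult_linear:
  fixes p :: "complex \<Rightarrow> real"
  assumes "bounded_linear p" "no_frequencies h"
  shows "no_frequencies (\<lambda>t. h t * p (cis (2 * pi * t)))"
proof -
  interpret bounded_linear p by fact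
  have h: "integrable circle h" and h0: "circle_coeff h k = 0" for k
    using assms(2) by (auto simp: no_frequencies_def)
  have p_eq: "p z = p 1 * Re z + p \<i> * Im z" for z
  proof -
    have "p z = p (Re z *\<^sub>R 1 + Im z *\<^sub>R \<i>)" by (simp add: scaleR_conv_of_real complex_eq[symmetric]
        mult.commute)
    also have "\<dots> = p 1 * Re z + p \<i> * Im z" by (simp only: add scaleR) simp
    finally show ?thesis .
  qed
  have "(\<lambda>t. p (cis (2 * pi * t))) = (\<lambda>t. p 1 * cos (2 * pi * t) + p \<i> * sin (2 * pi * t))"
    by (rule ext, subst p_eq) simp
  then have [measurable]: "(\<lambda>t. p (cis (2 * pi * t))) \<in> borel_measurable circle"
    by simp
  obtain K where K: "\<And>z. norm (p z) \<le> norm z * K" using bounded by blast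
  have [measurable]: "h \<in> borel_measurable circle" using h by simp
  have int: "integrable circle (\<lambda>t. h t * p (cis (2 * pi * t)))"
  proof (rule Bochner_Integration.integrable_bound)
    show "integrable circle (\<lambda>t. K * h t)" using h by simp
    show "AE t in circle. norm (h t * p (cis (2 * pi * t))) \<le> norm (K * h t)"
    proof (intro AE_I2)
      fix t :: real
      have "\<bar>p (cis (2 * pi * t))\<bar> \<le> \<bar>K\<bar>"
        using K[of "cis (2 * pi * t)"] by simp
      then show "norm (h t * p (cis (2 * pi * t))) \<le> norm (K * h t)"
        unfolding real_norm_def abs_mult by (subst mult.commute) (rule mult_right_mono, auto)
    qed
  qed measurable
  have "circle_coeff (\<lambda>t. h t * p (cis (2 * pi * t))) k = 0" for k
  proof -
    \<comment> \<open>A real-linear \<open>p\<close> has the form alpha z + beta cnj z; its values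
      at \<open>1\<close> and \<open>\<i>\<close> determine the two coefficients.\<close>
    define \<alpha> where "\<alpha> = (p 1 - \<i> * p \<i>) / 2"
    define \<beta> where "\<beta> = (p 1 + \<i> * p \<i>) / 2"
    define e where "e j t = cis (- (2 * pi * of_int j * t))" for j :: int and t :: real
    have e_shift: "cis (2 * pi * t) * e k t = e (k - 1) t" "cis (- (2 * pi * t)) * e k t = e (k + 1) t" for t
      unfolding e_def cis_mult by (auto intro!: arg_cong[of _ _ cis] simp: algebra_simps)
    have p_cis: "of_real (p (cis a)) = \<alpha> * cis a + \<beta> * cis (- a)" for a
      unfolding p_eq[of "cis a"] by (simp add: complex_eq_iff \<alpha>_def \<beta>_def field_simps)
    have "of_real (h t * p (cis (2 * pi * t))) * e k t
      = \<alpha> * (of_real (h t) * e (k - 1) t) + \<beta> * (of_real (h t) * e (k + 1) t)" for t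
      unfolding of_real_mult p_cis e_shift[symmetric] by (simp add: algebra_simps)
    then have "circle_coeff (\<lambda>t. h t * p (cis (2 * pi * t))) k = (LINT t|circle.
      \<alpha> * (of_real (h t) * e (k - 1) t) + \<beta> * (of_real (h t) * e (k + 1) t))"
      by (simp add: circle_coeff_def e_def)
    also have "\<dots> = \<alpha> * circle_coeff h (k - 1) + \<beta> * circle_coeff h (k + 1)"
      using circle_coeff_integrable[OF h] unfolding circle_coeff_def e_def
      by (subst Bochner_Integration.integral_add) (auto simp del: of_int_diff of_int_add)
    finally show ?thesis using h0 by simp
  qed
  with int show ?thesis by (simp add: no_frequencies_def)
qed

text \<open>On the unit circle a linear function is a combination of \<open>e\<^sup>2\<^sup>\<pi>\<^sup>i\<^sup>t\<close> and its conjugate, which only shift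
  the frequencies; hence the property survives multiplication by every polynomial.\<close>

lemma no_frequencies_mult_polynomial:
  fixes p :: "complex \<Rightarrow> real"
  assumes "real_polynomial_function p"
  shows "no_frequencies h \<Longrightarrow> no_frequencies (\<lambda>t. h t * p (cis (2 * pi * t)))"
  using assms
proof (induction p arbitrary: h rule: real_polynomial_function.induct)
  case (linear f)
  then show ?case by (intro no_frequencies_mult_linear)
next
  case (const c)
  then show ?case
    using circle_coeff_scale[of c h] by (simp add: no_frequencies_def mult.commute)
next
  case (add f g)
  then show ?case
    using circle_coeff_add by (simp add: no_frequencies_def distrib_left)
next
  case (mult f g)
  then show ?case by (simp add: mult.assoc[symmetric])
qed

lemma no_frequencies_integral_zero: "no_frequencies h \<Longrightarrow> integral\<^sup>L circle h = 0"
proof -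
  assume "no_frequencies h"
  then have "circle_coeff h 0 = 0" by (simp add: no_frequencies_def)
  then show ?thesis by (simp add: circle_coeff_def)
qed

text \<open>Stone--Weierstrass on the unit circle as a compact subset of the plane: replacing
  \<open>\<phi>\<close> by a real polynomial within \<open>e\<close> of it changes the integral by
  at most \<open>e\<close> times the \<open>L1\<close> norm of \<open>h\<close>, and against the
  polynomial the integral is 0.\<close>

lemma no_frequencies_orthogonal_continuous:
  fixes \<phi> :: "complex \<Rightarrow> real"
  assumes h: "no_frequencies h" and \<phi>: "continuous_on (sphere 0 1) \<phi>"
    and m: "(\<lambda>t. \<phi> (cis (2 * pi * t))) \<in> borel_measurable circle"
    and b: "\<And>t. \<bar>\<phi> (cis (2 * pi * t))\<bar> \<le> B"
  shows "(LINT t|circle. h t * \<phi> (cis (2 * pi * t))) = 0"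
proof -
  have hi: "integrable circle h" using h by (simp add: no_frequencies_def)
  note [measurable] = m borel_measurable_integrable[OF hi]
  have int\<phi>: "integrable circle (\<lambda>t. h t * \<phi> (cis (2 * pi * t)))"
  proof (rule Bochner_Integration.integrable_bound)
    show "integrable circle (\<lambda>t. B * h t)" using hi by simp
    show "AE t in circle. norm (h t * \<phi> (cis (2 * pi * t))) \<le> norm (B * h t)"
    proof (intro AE_I2)
      fix t :: real
      have "\<bar>\<phi> (cis (2 * pi * t))\<bar> \<le> \<bar>B\<bar>" using b[of t] by simp
      then show "norm (h t * \<phi> (cis (2 * pi * t))) \<le> norm (B * h t)"
        unfolding real_norm_def abs_mult by (subst mult.commute) (rule mult_right_mono, auto)
    qed
  qed measurable
  have "\<bar>LINT t|circle. h t * \<phi> (cis (2 * pi * t))\<bar> \<le> e * (LINT t|circle. \<bar>h t\<bar>)" if e: "e > 0" for e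
  proof -
    obtain p where p: "real_polynomial_function p" "\<And>z. z \<in> sphere 0 1 \<Longrightarrow> \<bar>\<phi> z - p z\<bar> < e"
      using Stone_Weierstrass_real_polynomial_function[OF compact_sphere \<phi> e] by blast
    have hp: "no_frequencies (\<lambda>t. h t * p (cis (2 * pi * t)))"
      by (rule no_frequencies_mult_polynomial[OF p(1) h])
    have intp: "integrable circle (\<lambda>t. h t * p (cis (2 * pi * t)))"
      using hp by (simp add: no_frequencies_def)
    have "(LINT t|circle. h t * \<phi> (cis (2 * pi * t)))
      = (LINT t|circle. h t * \<phi> (cis (2 * pi * t))) - (LINT t|circle. h t * p (cis (2 * pi * t)))"
      using no_frequencies_integral_zero[OF hp] by simp
    also have "\<dots> = (LINT t|circle. h t * (\<phi> (cis (2 * pi * t)) - p (cis (2 * pi * t))))"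
      by (simp add: int\<phi> intp right_diff_distrib)
    also have "\<bar>\<dots>\<bar> \<le> (LINT t|circle. e * \<bar>h t\<bar>)"
    proof (rule order_trans[OF integral_abs_bound])
      show "(LINT t|circle. \<bar>h t * (\<phi> (cis (2 * pi * t)) - p (cis (2 * pi * t)))\<bar>) \<le> (LINT t|circle. e
          * \<bar>h t\<bar>)"
      proof (rule integral_mono)
        show "integrable circle (\<lambda>t. \<bar>h t * (\<phi> (cis (2 * pi * t)) - p (cis (2 * pi * t)))\<bar>)"
          using int\<phi> intp by (simp add: right_diff_distrib)
        show "integrable circle (\<lambda>t. e * \<bar>h t\<bar>)" using hi by simp
        fix t :: real
        have "\<bar>\<phi> (cis (2 * pi * t)) - p (cis (2 * pi * t))\<bar> \<le> e"
          using p(2)[of "cis (2 * pi * t)"] by simp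
        then show "\<bar>h t * (\<phi> (cis (2 * pi * t)) - p (cis (2 * pi * t)))\<bar> \<le> e * \<bar>h t\<bar>"
          unfolding abs_mult by (subst mult.commute) (rule mult_right_mono, auto)
      qed
    qed
    finally show ?thesis by simp
  qed
  note le = this
  define I where "I = (LINT t|circle. \<bar>h t\<bar>)"
  have "I \<ge> 0" by (simp add: I_def)
  have "\<bar>LINT t|circle. h t * \<phi> (cis (2 * pi * t))\<bar> \<le> 0"
  proof (rule field_le_epsilon)
    \<comment> \<open>The bound is applied with \<open>e / (I + 1)\<close>, since \<open>I\<close>
      itself may be 0.\<close>
    fix e :: real assume "e > 0"
    have "\<bar>LINT t|circle. h t * \<phi> (cis (2 * pi * t))\<bar> \<le> e / (I + 1) * I"
      unfolding I_def
    proof (rule le)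
      show "e / ((LINT t|circle. \<bar>h t\<bar>) + 1) > 0"
        using \<open>e > 0\<close> \<open>I \<ge> 0\<close> unfolding I_def by (intro divide_pos_pos) linarith+
    qed
    also have "\<dots> \<le> 0 + e" using \<open>e > 0\<close> \<open>I \<ge> 0\<close> by (simp add: field_simps)
    finally show "\<bar>LINT t|circle. h t * \<phi> (cis (2 * pi * t))\<bar> \<le> 0 + e" .
  qed
  then show ?thesis by simp
qed

lemma cis_2pi_inj:
  assumes "0 \<le> s" "s < 1" "0 \<le> t" "t < 1" "cis (2 * pi * s) = cis (2 * pi * t)"
  shows "s = t"
proof -
  have "cos (2 * pi * s) = cos (2 * pi * t)" "sin (2 * pi * s) = sin (2 * pi * t)"
    using assms(5) by (auto simp: complex_eq_iff)
  then obtain n :: int where n: "2 * pi * s = 2 * pi * t + 2 * pi * of_int n"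
    using sin_cos_eq_iff[of "2 * pi * s" "2 * pi * t"] by (auto simp: algebra_simps)
  then have "2 * pi * s = 2 * pi * (t + of_int n)" by (simp add: algebra_simps)
  then have *: "s = t + of_int n" by simp
  then have "\<bar>of_int n :: real\<bar> < 1" using assms by auto
  then have "n = 0" by linarith
  with * show ?thesis by simp
qed

text \<open>The indicator of an initial segment is the pointwise limit of the continuous functions
  \<open>\<phi> n\<close>, which are 1 on the closed arc \<open>A\<close> and fall off with slope
  \<open>n\<close> in the distance to \<open>A\<close>. A parameter \<open>t > a\<close> in [0,1) is
  not mapped into \<open>A\<close>, because \<open>cis (2 * pi * t)\<close> is injective there, so
  its distance to \<open>A\<close> is positive.\<close>

lemma no_frequencies_integral_initial:
  assumes h: "no_frequencies h"
  shows "(LINT t|circle. indicator {..a} t *\<^sub>R h t) = 0"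
proof -
  have hi: "integrable circle h" using h by (simp add: no_frequencies_def)
  note [measurable] = borel_measurable_integrable[OF hi]
  consider "a < 0" | "a \<ge> 1" | "0 \<le> a" "a < 1" by linarith
  then show ?thesis
  proof cases
    case 1
    then have "(LINT t|circle. indicator {..a} t *\<^sub>R h t) = (LINT t|circle. 0)"
      by (intro Bochner_Integration.integral_cong) (auto simp: space_circle indicator_def)
    then show ?thesis by simp
  next
    case 2
    then have "(LINT t|circle. indicator {..a} t *\<^sub>R h t) = (LINT t|circle. h t)"
      by (intro Bochner_Integration.integral_cong) (auto simp: space_circle indicator_def)
    then show ?thesis using no_frequencies_integral_zero[OF h] by simp
  next
    case 3
    define A where "A = (\<lambda>t. cis (2 * pi * t)) ` {0..a}"
    have "compact A" unfolding A_def
      by (intro compact_continuous_image continuous_intros) auto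
    then have A: "closed A" "A \<noteq> {}" using 3 by (auto simp: compact_imp_closed A_def)
    define \<phi> where "\<phi> n z = max 0 (1 - real n * infdist z A)" for n z
    have \<phi>c: "continuous_on UNIV (\<phi> n)" for n
      unfolding \<phi>_def by (intro continuous_intros continuous_on_infdist)
    have [measurable]: "(\<lambda>t. \<phi> n (cis (2 * pi * t))) \<in> borel_measurable circle" for n
      by (rule measurable_compose[OF _ borel_measurable_continuous_onI[OF \<phi>c]]) measurable
    have \<phi>b: "\<bar>\<phi> n z\<bar> \<le> 1" for n z
      using infdist_nonneg[of z A] by (auto simp: \<phi>_def)
    have "(LINT t|circle. h t * \<phi> n (cis (2 * pi * t))) = 0" for n
      by (rule no_frequencies_orthogonal_continuous[OF h, of _ 1])
        (auto intro: continuous_on_subset[OF \<phi>c] \<phi>b)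
    moreover have "(\<lambda>n. LINT t|circle. h t * \<phi> n (cis (2 * pi * t))) \<longlonglongrightarrow> (LINT t|circle. indicator {..a}
        t *\<^sub>R h t)"
    proof (rule integral_dominated_convergence[where w = "\<lambda>t. \<bar>h t\<bar>"])
      show "AE t in circle. (\<lambda>n. h t * \<phi> n (cis (2 * pi * t))) \<longlonglongrightarrow> indicator {..a} t *\<^sub>R h t"
      proof (rule AE_I2)
        fix t assume "t \<in> space circle"
        then have t: "0 \<le> t" "t < 1" by (auto simp: space_circle)
        have "(\<lambda>n. \<phi> n (cis (2 * pi * t))) \<longlonglongrightarrow> indicator {..a} t"
        proof (cases "t \<le> a")
          case True
          then have "cis (2 * pi * t) \<in> A" using t by (auto simp: A_def)
          then show ?thesis using True by (simp add: \<phi>_def)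
        next
          case False
          have "cis (2 * pi * t) \<notin> A"
          proof
            assume "cis (2 * pi * t) \<in> A"
            then obtain s where s: "0 \<le> s" "s \<le> a" "cis (2 * pi * t) = cis (2 * pi * s)" by (auto simp: A_def)
            then have "t = s" using 3 t by (intro cis_2pi_inj) auto
            with s False show False by simp
          qed
          then have pos: "infdist (cis (2 * pi * t)) A > 0"
            using in_closed_iff_infdist_zero[OF A] infdist_nonneg[of "cis (2 * pi * t)" A] by (simp
                add: less_le)
          then obtain N where N: "real N * infdist (cis (2 * pi * t)) A > 1"
            using reals_Archimedean3 by blast
          have "\<phi> n (cis (2 * pi * t)) = 0" if "n \<ge> N" for n
          proof -
            have "real n * infdist (cis (2 * pi * t)) A \<ge> real N * infdist (cis (2 * pi * t)) A"
              using that pos by (intro mult_right_mono) auto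
            with N show ?thesis by (simp add: \<phi>_def)
          qed
          then have "eventually (\<lambda>n. \<phi> n (cis (2 * pi * t)) = 0) sequentially"
            by (auto simp: eventually_sequentially)
          then show ?thesis using False by (simp add: tendsto_eventually)
        qed
        then have "(\<lambda>n. h t * \<phi> n (cis (2 * pi * t))) \<longlonglongrightarrow> h t * indicator {..a} t"
          by (intro tendsto_intros)
        then show "(\<lambda>n. h t * \<phi> n (cis (2 * pi * t))) \<longlonglongrightarrow> indicator {..a} t *\<^sub>R h t"
          by (simp add: mult.commute)
      qed
      show "AE t in circle. norm (h t * \<phi> n (cis (2 * pi * t))) \<le> \<bar>h t\<bar>" for n
        using mult_left_mono[OF \<phi>b abs_ge_zero] by (auto simp: abs_mult)
    qed (use hi in \<open>auto\<close>)
    ultimately show ?thesis by (simp add: LIMSEQ_const_iff)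
  qed
qed

text \<open>The sets over which \<open>h\<close> integrates to 0 include the half-lines, an
  intersection-stable generator of the Borel sets, and are closed under complements and disjoint
  countable unions. So all Borel sets are among them, and \<open>h\<close> vanishes almost
  everywhere.\<close>

lemma circle_coeff_unique_zero:
  assumes "integrable circle h" "\<And>k. circle_coeff h k = 0"
  shows "AE t in circle. h t = 0"
proof (rule circle.density_zero[OF assms(1)])
  have h: "no_frequencies h" using assms by (simp add: no_frequencies_def)
  note [measurable] = borel_measurable_integrable[OF assms(1)]
  have si: "set_integrable circle A h" if "A \<in> sets borel" for A
  proof -
    have [measurable]: "A \<in> sets borel" by fact
    show ?thesis unfolding set_integrable_def
      by (rule Bochner_Integration.integrable_bound[OF assms(1)]) (auto simp: indicator_def)
  qed
  have *: "(LINT t|circle. indicator A t *\<^sub>R h t) = 0"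
    if "A \<in> sigma_sets UNIV (range (\<lambda>a::real. {..a}))" for A
  proof -
    have "Int_stable (range (\<lambda>a::real. {..a}))" "range (\<lambda>a::real. {..a}) \<subseteq> Pow UNIV"
      by (auto simp: Int_stable_def)
    then show ?thesis using that
    proof (induction A rule: sigma_sets_induct_disjoint)
      case (basic A)
      then show ?case by (auto simp: no_frequencies_integral_initial[OF h, simplified])
    next
      case empty
      then show ?case by simp
    next
      case (compl A)
      then have A [measurable]: "A \<in> sets borel" by (simp add: borel_eq_atMost)
      have "(LINT t|circle. indicator (UNIV - A) t *\<^sub>R h t) = (LINT t|circle. h t - indicator A t *\<^sub>R h t)"
        by (intro Bochner_Integration.integral_cong) (auto simp: indicator_def)
      also have "\<dots> = (LINT t|circle. h t) - (LINT t|circle. indicator A t *\<^sub>R h t)"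
        using si[OF A] assms(1) unfolding set_integrable_def by (rule
            Bochner_Integration.integral_diff[rotated])
      finally show ?case using compl no_frequencies_integral_zero[OF h] by simp
    next
      case (union A)
      then have A: "A i \<in> sets borel" for i by (auto simp: borel_eq_atMost)
      \<comment> \<open>Only subsets of [0,1) belong to \<open>sets circle\<close>; countable
        additivity is applied after intersecting with it, which changes no integral over
        \<open>circle\<close>.\<close>
      have Ac: "A i \<inter> {0..<1} \<in> sets circle" for i
        using A[of i] unfolding circle_def by (auto simp: sets_restrict_space)
      have eq: "indicator (B \<inter> {0..<1}) t *\<^sub>R h t = indicator B t *\<^sub>R h t" if "t \<in> space circle" for t B
        using that by (auto simp: space_circle indicator_def)
      have eq2: "(LINT t|circle. indicator (B \<inter> {0..<1}) t *\<^sub>R h t) = (LINT t|circle. indicator B t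
          *\<^sub>R h t)" for B
        by (intro Bochner_Integration.integral_cong refl eq)
      have U: "(\<Union>i. A i \<inter> {0..<1}) = (\<Union>i. A i) \<inter> {0..<1}" by auto
      have "(LINT t:(\<Union>i. A i \<inter> {0..<1})|circle. h t) = (\<Sum>i. LINT t:(A i \<inter> {0..<1})|circle. h t)"
      proof (rule lebesgue_integral_countable_add[OF Ac])
        show "A i \<inter> {0..<1} \<inter> (A j \<inter> {0..<1}) = {}" if "i \<noteq> j" for i j
          using union(1) that by (auto simp: disjoint_family_on_def)
        have "(\<Union>i. A i) \<inter> {0..<1} \<in> sets borel" using A by auto
        then show "set_integrable circle (\<Union>i. A i \<inter> {0..<1}) h"
          unfolding U by (rule si)
      qed
      then show ?case using union unfolding set_lebesgue_integral_def eq2 U by simp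
    qed
  qed
  fix A assume "A \<in> sets circle"
  then obtain B where B: "B \<in> sets borel" "A = {0..<1} \<inter> B"
    by (auto simp: circle_def sets_restrict_space)
  then have "A \<in> sets borel" by simp
  then show "(LINT t:A|circle. h t) = 0"
    using *[of A] by (simp add: set_lebesgue_integral_def borel_eq_atMost)
qed

section \<open>Fourier series in time\<close>

lemma borel_measurable_cnj [measurable (raw)]:
  "f \<in> borel_measurable M \<Longrightarrow> (\<lambda>x. cnj (f x)) \<in> borel_measurable M"
  using measurable_compose[of f M borel cnj borel]
  by (simp add: borel_measurable_continuous_onI continuous_on_cnj)

definition wave :: "int \<Rightarrow> real \<Rightarrow> complex"
  where "wave k t = cis (2 * pi * of_int k * t)"

lemma norm_wave [simp]: "cmod (wave k t) = 1"
  by (simp add: wave_def)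

lemma wave_measurable [measurable]: "wave k \<in> borel_measurable circle"
  unfolding wave_def by measurable

lemma cnj_wave: "cnj (wave k t) = wave (- k) t"
  by (simp add: wave_def cis_cnj)

lemma wave_mult: "wave j t * wave k t = wave (j + k) t"
  by (simp add: wave_def cis_mult algebra_simps)

lemma wave_integrable: "integrable circle (wave k)"
  by (rule circle.integrable_const_bound[of _ 1]) auto

lemma integral_wave: "(LINT t|circle. wave k t) = (if k = 0 then 1 else 0)"
  unfolding wave_def by (rule integral_circle_cis)

lemma circle_coeff_wave: "circle_coeff g k = (LINT t|circle. of_real (g t) * wave (- k) t)"
  by (simp add: circle_coeff_def wave_def)

lemma circle_coeff_wave_integrable:
  "integrable circle g \<Longrightarrow> integrable circle (\<lambda>t. of_real (g t) * wave k t)"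
  unfolding wave_def by (intro integrable_mult_cis) auto

lemma norm_circle_coeff_le:
  assumes "g \<in> L2 circle"
  shows "cmod (circle_coeff g k) \<le> L2_norm circle g"
proof -
  have [measurable]: "g \<in> borel_measurable circle" using assms by (rule L2_measurable)
  have abs: "(\<lambda>t. \<bar>g t\<bar>) \<in> L2 circle" by (rule L2_bound[OF assms]) auto
  have "cmod (circle_coeff g k) \<le> (LINT t|circle. cmod (of_real (g t) * wave (- k) t))"
    unfolding circle_coeff_wave by (rule integral_norm_bound)
  also have "\<dots> = (LINT t|circle. \<bar>g t\<bar>)" by (simp add: norm_mult)
  also have "\<dots> \<le> L2_norm circle (\<lambda>t. \<bar>g t\<bar>)"
    using circle.integral_le_L2_norm[OF abs] by linarith
  also have "\<dots> = L2_norm circle g"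
    by (simp add: L2_norm_def L2_inner_def)
  finally show ?thesis .
qed

lemma integral_norm_wave_sum_square:
  fixes d :: "int \<Rightarrow> complex"
  assumes "finite K"
  shows "integrable circle (\<lambda>t. (cmod (\<Sum>k\<in>K. d k * wave k t))\<^sup>2)"
    and "(LINT t|circle. (cmod (\<Sum>k\<in>K. d k * wave k t))\<^sup>2) = (\<Sum>k\<in>K. (cmod (d k))\<^sup>2)"
proof -
  have b: "cmod (\<Sum>k\<in>K. d k * wave k t) \<le> (\<Sum>k\<in>K. cmod (d k))" for t
    by (rule order_trans[OF norm_sum]) (simp add: norm_mult)
  show int: "integrable circle (\<lambda>t. (cmod (\<Sum>k\<in>K. d k * wave k t))\<^sup>2)"
    using b by (intro circle.integrable_const_bound[of _ "(\<Sum>k\<in>K. cmod (d k))\<^sup>2"]) (auto intro!: power_mono)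
  have eq: "of_real ((cmod (\<Sum>k\<in>K. d k * wave k t))\<^sup>2) = (\<Sum>j\<in>K. \<Sum>k\<in>K. d j * cnj (d k) * wave (j - k) t)" for t
    unfolding complex_norm_square
    by (simp add: sum_product cnj_wave wave_mult[of _ _ "- _", simplified, symmetric] mult_ac)
  have "complex_of_real (LINT t|circle. (cmod (\<Sum>k\<in>K. d k * wave k t))\<^sup>2)
    = (LINT t|circle. (\<Sum>j\<in>K. \<Sum>k\<in>K. d j * cnj (d k) * wave (j - k) t))"
    unfolding eq[symmetric] by (rule integral_complex_of_real[symmetric])
  also have "\<dots> = (\<Sum>j\<in>K. \<Sum>k\<in>K. d j * cnj (d k) * (if j - k = 0 then 1 else 0))"
    by (simp add: Bochner_Integration.integral_sum wave_integrable integral_wave del: right_minus_eq)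
  also have "\<dots> = (\<Sum>j\<in>K. \<Sum>k\<in>K. if k = j then d j * cnj (d j) else 0)"
    by (intro sum.cong) auto
  also have "\<dots> = of_real (\<Sum>k\<in>K. (cmod (d k))\<^sup>2)"
    using assms by (simp add: complex_norm_square del: of_real_power)
  finally show "(LINT t|circle. (cmod (\<Sum>k\<in>K. d k * wave k t))\<^sup>2) = (\<Sum>k\<in>K. (cmod (d k))\<^sup>2)"
    by (simp only: of_real_eq_iff)
qed

lemma circle_coeff_Bessel:
  assumes g: "g \<in> L2 circle" and "finite K"
  shows "(\<Sum>k\<in>K. (cmod (circle_coeff g k))\<^sup>2) \<le> (LINT t|circle. (g t)\<^sup>2)"
proof -
  define d where "d = circle_coeff g"
  define p where "p t = (\<Sum>k\<in>K. d k * wave k t)" for t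
  have gi: "integrable circle g" using g by (rule circle.L2_integrable)
  have gsq: "integrable circle (\<lambda>t. (g t)\<^sup>2)" using g by (rule L2_integrable_square)
  have psq: "integrable circle (\<lambda>t. (cmod (p t))\<^sup>2)" "(LINT t|circle. (cmod (p t))\<^sup>2) = (\<Sum>k\<in>K. (cmod
      (d k))\<^sup>2)"
    unfolding p_def using integral_norm_wave_sum_square[OF assms(2)] by auto
  have cross: "integrable circle (\<lambda>t. of_real (g t) * cnj (p t))"
    "(LINT t|circle. of_real (g t) * cnj (p t)) = (\<Sum>k\<in>K. cnj (d k) * d k)"
  proof -
    have eq: "of_real (g t) * cnj (p t) = (\<Sum>k\<in>K. cnj (d k) * (of_real (g t) * wave (- k) t))" for t
      by (simp add: p_def sum_distrib_left cnj_wave mult_ac)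
    show "integrable circle (\<lambda>t. of_real (g t) * cnj (p t))"
      unfolding eq using circle_coeff_wave_integrable[OF gi] by auto
    have "(LINT t|circle. of_real (g t) * cnj (p t)) = (\<Sum>k\<in>K. cnj (d k) * circle_coeff g k)"
      unfolding eq circle_coeff_wave using circle_coeff_wave_integrable[OF gi]
      by (subst Bochner_Integration.integral_sum) auto
    then show "(LINT t|circle. of_real (g t) * cnj (p t)) = (\<Sum>k\<in>K. cnj (d k) * d k)"
      by (simp add: d_def)
  qed
  have cr: "(LINT t|circle. Re (of_real (g t) * cnj (p t))) = (\<Sum>k\<in>K. (cmod (d k))\<^sup>2)"
  proof -
    have "(LINT t|circle. Re (of_real (g t) * cnj (p t))) = Re (\<Sum>k\<in>K. cnj (d k) * d k)"
      using cross by (subst integral_Re) auto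
    also have "(\<Sum>k\<in>K. cnj (d k) * d k) = of_real (\<Sum>k\<in>K. (cmod (d k))\<^sup>2)"
      by (simp add: complex_norm_square mult.commute del: of_real_power)
    finally show ?thesis by simp
  qed
  have eq: "(cmod (of_real (g t) - p t))\<^sup>2 = (g t)\<^sup>2 - 2 * Re (of_real (g t) * cnj (p t)) + (cmod (p
      t))\<^sup>2" for t
    unfolding cmod_power2 by (simp add: power2_eq_square algebra_simps)
  have "0 \<le> (LINT t|circle. (cmod (of_real (g t) - p t))\<^sup>2)" by (intro integral_nonneg_AE) auto
  also have "\<dots> = (LINT t|circle. (g t)\<^sup>2) - 2 * (\<Sum>k\<in>K. (cmod (d k))\<^sup>2) + (\<Sum>k\<in>K. (cmod (d k))\<^sup>2)"
    unfolding eq using gsq psq integrable_Re[OF cross(1)] cr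
    by (simp only: Bochner_Integration.integral_add Bochner_Integration.integral_diff
      Bochner_Integration.integrable_diff integrable_mult_right integral_mult_right_zero)
  finally show ?thesis by (simp add: d_def)
qed

text \<open>Conjugation carries the term of frequency \<open>k\<close> to that of
  \<open>- k\<close>, so it only permutes the sum. This is why partial sums run over symmetric sets:
  the \<open>Re\<close> in \<open>wave_sum\<close> then discards nothing.\<close>

lemma wave_sum_real:
  fixes d :: "int \<Rightarrow> complex"
  assumes "finite K" "uminus ` K = K" "\<And>k. d (- k) = cnj (d k)"
  shows "of_real (Re (\<Sum>k\<in>K. d k * wave k t)) = (\<Sum>k\<in>K. d k * wave k t)"
proof -
  have "cnj (\<Sum>k\<in>K. d k * wave k t) = (\<Sum>k\<in>K. d (- k) * wave (- k) t)"
    by (simp add: assms(3) cnj_wave)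
  also have "\<dots> = (\<Sum>k\<in>uminus ` K. d k * wave k t)"
    by (subst sum.reindex) (auto simp: inj_on_def)
  finally have "cnj (\<Sum>k\<in>K. d k * wave k t) = (\<Sum>k\<in>K. d k * wave k t)" by (simp add: assms(2))
  then show ?thesis using Reals_cnj_iff of_real_Re by blast
qed

lemma circle_coeff_wave_sum:
  fixes d :: "int \<Rightarrow> complex"
  assumes K: "finite K" "uminus ` K = K" and d: "\<And>k. d (- k) = cnj (d k)"
  shows "circle_coeff (\<lambda>t. Re (\<Sum>k\<in>K. d k * wave k t)) j = (if j \<in> K then d j else 0)"
proof -
  have "circle_coeff (\<lambda>t. Re (\<Sum>k\<in>K. d k * wave k t)) j = (LINT t|circle. (\<Sum>k\<in>K. d k * wave (k - j) t))"
    unfolding circle_coeff_wave wave_sum_real[where d = d, OF K d]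
    by (simp add: sum_distrib_right mult.assoc wave_mult)
  also have "\<dots> = (\<Sum>k\<in>K. d k * (if k - j = 0 then 1 else 0))"
    by (simp add: Bochner_Integration.integral_sum wave_integrable integral_wave del: right_minus_eq)
  also have "\<dots> = (\<Sum>k\<in>K. if j = k then d k else 0)"
    by (intro sum.cong) auto
  finally show ?thesis using K by simp
qed

section \<open>Time coefficients of functions on the cylinder\<close>

lemma measurable_cylinder_swap [measurable (raw)]:
  "u \<in> measurable cylinder N \<Longrightarrow> (\<lambda>(x, t). u (t, x)) \<in> measurable (interval \<Otimes>\<^sub>M circle) N"
  by (rule measurable_pair_swap)

lemma time_coeff_measurable [measurable (raw)]:
  assumes [measurable]: "u \<in> borel_measurable cylinder"
  shows "time_coeff u k \<in> borel_measurable interval"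
proof -
  have "(\<lambda>(x, t). of_real (u (t, x)) * cis (- (2 * pi * of_int k * t)) :: complex)
    = (\<lambda>p. of_real ((\<lambda>(x, t). u (t, x)) p) * wave (- k) (snd p))"
    by (auto simp: wave_def)
  also have "\<dots> \<in> borel_measurable (interval \<Otimes>\<^sub>M circle)"
    by measurable
  finally show ?thesis
    unfolding time_coeff_def [abs_def] by (rule circle.borel_measurable_lebesgue_integral)
qed

lemma L2_slice_AE:
  assumes "u \<in> L2 cylinder"
  shows "AE x in interval. (\<lambda>t. u (t, x)) \<in> L2 circle"
    and "AE t in circle. (\<lambda>x. u (t, x)) \<in> L2 interval"
proof -
  have [measurable]: "u \<in> borel_measurable cylinder" using assms by (rule L2_measurable)
  have int: "integrable cylinder (case_prod (\<lambda>t x. (u (t, x))\<^sup>2))"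
    using L2_integrable_square[OF assms] by (simp add: case_prod_unfold)
  show "AE x in interval. (\<lambda>t. u (t, x)) \<in> L2 circle"
    using cylinder.AE_integrable_snd[OF int] AE_space
    by eventually_elim (auto intro!: L2_I)
  show "AE t in circle. (\<lambda>x. u (t, x)) \<in> L2 interval"
    using cylinder.AE_integrable_fst[OF int] AE_space
    by eventually_elim (auto intro!: L2_I)
qed

lemma L2_norm_cylinder:
  assumes "u \<in> L2 cylinder"
  shows "integrable interval (\<lambda>x. LINT t|circle. (u (t, x))\<^sup>2)"
    "(L2_norm cylinder u)\<^sup>2 = (LINT x|interval. LINT t|circle. (u (t, x))\<^sup>2)"
    "integrable circle (\<lambda>t. LINT x|interval. (u (t, x))\<^sup>2)"
    "(L2_norm cylinder u)\<^sup>2 = (LINT t|circle. LINT x|interval. (u (t, x))\<^sup>2)"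
proof -
  have int: "integrable cylinder (case_prod (\<lambda>t x. (u (t, x))\<^sup>2))"
    using L2_integrable_square[OF assms] by (simp add: case_prod_unfold)
  show "integrable interval (\<lambda>x. LINT t|circle. (u (t, x))\<^sup>2)"
    using cylinder.integrable_snd[OF int] .
  show "integrable circle (\<lambda>t. LINT x|interval. (u (t, x))\<^sup>2)"
    using cylinder.integrable_fst[OF int] .
  show "(L2_norm cylinder u)\<^sup>2 = (LINT x|interval. LINT t|circle. (u (t, x))\<^sup>2)"
    "(L2_norm cylinder u)\<^sup>2 = (LINT t|circle. LINT x|interval. (u (t, x))\<^sup>2)"
    unfolding L2_norm_square using cylinder.integral_snd[OF int] cylinder.integral_fst[OF int]
    by (simp_all add: case_prod_unfold)
qed

lemma time_coeff_square_integrable: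
  assumes "u \<in> L2 cylinder"
  shows "integrable interval (\<lambda>x. (cmod (time_coeff u k x))\<^sup>2)"
proof (rule Bochner_Integration.integrable_bound[OF L2_norm_cylinder(1)[OF assms]])
  note [measurable] = L2_measurable[OF assms]
  show "(\<lambda>x. (cmod (time_coeff u k x))\<^sup>2) \<in> borel_measurable interval" by measurable
  show "AE x in interval. norm ((cmod (time_coeff u k x))\<^sup>2) \<le> norm (LINT t|circle. (u (t, x))\<^sup>2)"
    using L2_slice_AE(1)[OF assms]
  proof eventually_elim
    case (elim x)
    have "(cmod (time_coeff u k x))\<^sup>2 \<le> (L2_norm circle (\<lambda>t. u (t, x)))\<^sup>2"
      unfolding time_coeff_eq by (intro power_mono norm_circle_coeff_le elim) auto
    then show ?case by (simp add: L2_norm_square)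
  qed
qed

abbreviation time_energy :: "(real \<times> real \<Rightarrow> real) \<Rightarrow> int \<Rightarrow> real"
  where "time_energy u k \<equiv> LINT x|interval. (cmod (time_coeff u k x))\<^sup>2"

lemma time_coeff_Bessel:
  assumes "u \<in> L2 cylinder" "finite K"
  shows "(\<Sum>k\<in>K. time_energy u k) \<le> (L2_norm cylinder u)\<^sup>2"
proof -
  have "(\<Sum>k\<in>K. time_energy u k)
    = (LINT x|interval. (\<Sum>k\<in>K. (cmod (time_coeff u k x))\<^sup>2))"
    using time_coeff_square_integrable[OF assms(1)] by (simp add: Bochner_Integration.integral_sum)
  also have "\<dots> \<le> (LINT x|interval. LINT t|circle. (u (t, x))\<^sup>2)"
  proof (rule integral_mono_AE)
    show "AE x in interval. (\<Sum>k\<in>K. (cmod (time_coeff u k x))\<^sup>2) \<le> (LINT t|circle. (u (t, x))\<^sup>2)"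
      using L2_slice_AE(1)[OF assms(1)]
      by eventually_elim (auto simp: time_coeff_eq intro!: circle_coeff_Bessel assms(2))
  qed (auto intro!: time_coeff_square_integrable L2_norm_cylinder assms)
  also have "\<dots> = (L2_norm cylinder u)\<^sup>2" using L2_norm_cylinder[OF assms(1)] by simp
  finally show ?thesis .
qed

text \<open>The integral is additive on integrable slices, and an \<open>L2\<close> function has
  these for almost every \<open>x\<close>. The exceptional set depends on the two functions alone,
  hence the quantifier over \<open>k\<close> inside.\<close>

lemma time_coeff_add_AE:
  assumes "u \<in> L2 cylinder" "v \<in> L2 cylinder"
  shows "AE x in interval. \<forall>k. time_coeff (\<lambda>z. u z + v z) k x = time_coeff u k x + time_coeff v k x"
  using L2_slice_AE(1)[OF assms(1)] L2_slice_AE(1)[OF assms(2)]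
  by eventually_elim (auto simp: time_coeff_eq intro!: circle_coeff_add circle.L2_integrable)

lemma time_coeff_diff_AE:
  assumes "u \<in> L2 cylinder" "v \<in> L2 cylinder"
  shows "AE x in interval. \<forall>k. time_coeff (\<lambda>z. u z - v z) k x = time_coeff u k x - time_coeff v k x"
  using L2_slice_AE(1)[OF assms(1)] L2_slice_AE(1)[OF assms(2)]
  by eventually_elim (auto simp: time_coeff_eq intro!: circle_coeff_diff circle.L2_integrable)

text \<open>Countably many frequencies share one null set of \<open>x\<close>. Off it, uniqueness on
  the circle applies to the slices, and the two almost-everywhere quantifiers are then
  exchanged.\<close>

lemma time_coeff_unique:
  assumes u: "u \<in> L2 cylinder" and v: "v \<in> L2 cylinder"
    and eq: "\<And>k. AE x in interval. time_coeff u k x = time_coeff v k x"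
  shows "AE z in cylinder. u z = v z"
proof -
  note [measurable] = L2_measurable[OF u] L2_measurable[OF v]
  have "AE x in interval. \<forall>k. time_coeff u k x = time_coeff v k x"
    using eq by (simp add: AE_all_countable)
  then have "AE x in interval. AE t in circle. u (t, x) = v (t, x)"
    using L2_slice_AE(1)[OF u] L2_slice_AE(1)[OF v]
  proof eventually_elim
    case (elim x)
    then have "AE t in circle. u (t, x) - v (t, x) = 0"
      using circle.L2_integrable[OF elim(2)] circle.L2_integrable[OF elim(3)]
      by (intro circle_coeff_unique_zero) (auto simp: circle_coeff_diff time_coeff_eq)
    then show ?case by simp
  qed
  then have "AE t in circle. AE x in interval. u (t, x) = v (t, x)"
    by (subst cylinder.AE_commute) measurable
  then show ?thesis
    by (intro cylinder.AE_pair_measure) measurable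
qed

section \<open>Partial sums, Riesz--Fischer and Parseval in time\<close>

lemma L2_cylinder_snd:
  assumes g: "g \<in> L2 interval"
  shows "(\<lambda>z. g (snd z)) \<in> L2 cylinder" "L2_norm cylinder (\<lambda>z. g (snd z)) = L2_norm interval g"
proof -
  note [measurable] = L2_measurable[OF g]
  have int: "integrable cylinder (\<lambda>z. (g (snd z))\<^sup>2)"
    by (rule cylinder.Fubini_integrable) (auto simp: circle.prob_space L2_integrable_square[OF g])
  then show L: "(\<lambda>z. g (snd z)) \<in> L2 cylinder" by (intro L2_I) measurable
  have "(L2_norm cylinder (\<lambda>z. g (snd z)))\<^sup>2 = (L2_norm interval g)\<^sup>2"
    unfolding L2_norm_cylinder(4)[OF L] by (simp add: L2_norm_square circle.prob_space)
  then show "L2_norm cylinder (\<lambda>z. g (snd z)) = L2_norm interval g" by simp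
qed

definition wave_sum :: "(int \<Rightarrow> real \<Rightarrow> complex) \<Rightarrow> int set \<Rightarrow> real \<times> real \<Rightarrow> real"
  where "wave_sum c K z = Re (\<Sum>k\<in>K. c k (snd z) * wave k (fst z))"

lemma wave_sum_L2:
  assumes c: "\<And>k. c k \<in> borel_measurable interval" "\<And>k. integrable interval (\<lambda>x. (cmod (c k x))\<^sup>2)"
    and K: "finite K"
  shows "wave_sum c K \<in> L2 cylinder"
  using K
proof (induction K rule: finite_induct)
  case empty
  then show ?case using L2_zero by (simp add: wave_sum_def[abs_def])
next
  case (insert k K)
  note [measurable] = c(1)
  have "(\<lambda>x. cmod (c k x)) \<in> L2 interval" using c by (intro L2_I) auto
  then have "(\<lambda>z. cmod (c k (snd z))) \<in> L2 cylinder" by (rule L2_cylinder_snd)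
  then have "(\<lambda>z. Re (c k (snd z) * wave k (fst z))) \<in> L2 cylinder"
  proof (rule L2_bound)
    show "AE z in cylinder. \<bar>Re (c k (snd z) * wave k (fst z))\<bar> \<le> \<bar>cmod (c k (snd z))\<bar>"
      by (intro AE_I2 order_trans[OF abs_Re_le_cmod]) (simp add: norm_mult)
  qed measurable
  from L2_add[OF this insert.IH] show ?case
    using insert.hyps by (simp add: wave_sum_def[abs_def])
qed

lemma wave_sum_norm:
  assumes c: "\<And>k. c k \<in> borel_measurable interval" "\<And>k. integrable interval (\<lambda>x. (cmod (c k x))\<^sup>2)"
    and sym: "\<And>k x. c (- k) x = cnj (c k x)"
    and K: "finite K" "uminus ` K = K"
  shows "(L2_norm cylinder (wave_sum c K))\<^sup>2 = (\<Sum>k\<in>K. LINT x|interval. (cmod (c k x))\<^sup>2)"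
proof -
  have sq: "(wave_sum c K (t, x))\<^sup>2 = (cmod (\<Sum>k\<in>K. c k x * wave k t))\<^sup>2" for t x
  proof -
    have "cmod (of_real (Re (\<Sum>k\<in>K. c k x * wave k t))) = cmod (\<Sum>k\<in>K. c k x * wave k t)"
      by (subst wave_sum_real[OF K]) (auto simp: sym)
    then have "\<bar>Re (\<Sum>k\<in>K. c k x * wave k t)\<bar> = cmod (\<Sum>k\<in>K. c k x * wave k t)"
      by (simp only: norm_of_real)
    then show ?thesis unfolding wave_sum_def fst_conv snd_conv by (metis power2_abs)
  qed
  have "(L2_norm cylinder (wave_sum c K))\<^sup>2 = (LINT x|interval. (\<Sum>k\<in>K. (cmod (c k x))\<^sup>2))"
    unfolding L2_norm_cylinder(2)[OF wave_sum_L2[OF c K(1)]] sq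
    by (simp add: integral_norm_wave_sum_square(2)[OF K(1)])
  also have "\<dots> = (\<Sum>k\<in>K. LINT x|interval. (cmod (c k x))\<^sup>2)"
    using c(2) by (simp add: Bochner_Integration.integral_sum)
  finally show ?thesis .
qed

text \<open>\<open>has_sum\<close> is a limit along all finite index sets; this allows it to be
  evaluated along the symmetric intervals, over which the partial sums are real.\<close>

lemma filterlim_symmetric_intervals:
  "filterlim (\<lambda>N. {- int N..int N}) (finite_subsets_at_top UNIV) sequentially"
  unfolding filterlim_finite_subsets_at_top
proof (intro allI impI)
  fix X :: "int set" assume X: "finite X \<and> X \<subseteq> UNIV"
  obtain N where N: "\<And>k. k \<in> X \<Longrightarrow> \<bar>k\<bar> \<le> int N"
  proof
    fix k assume "k \<in> X"
    then have "nat \<bar>k\<bar> \<le> Max ((\<lambda>k. nat \<bar>k\<bar>) ` X)" using X by auto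
    then show "\<bar>k\<bar> \<le> int (Max ((\<lambda>k. nat \<bar>k\<bar>) ` X))" by linarith
  qed
  have "finite {- int M..int M} \<and> X \<subseteq> {- int M..int M} \<and> {- int M..int M} \<subseteq> UNIV" if "M \<ge> N" for M
    using N that by fastforce
  then show "eventually (\<lambda>N. finite {- int N..int N} \<and> X \<subseteq> {- int N..int N} \<and> {- int N..int N} \<subseteq> UNIV)
      sequentially"
    unfolding eventually_sequentially by blast
qed

lemma has_sum_symmetric_limit:
  "(f has_sum s) UNIV \<Longrightarrow> (\<lambda>N. \<Sum>k\<in>{- int N..int N}. f k) \<longlonglongrightarrow> s"
  unfolding has_sum_def by (rule filterlim_compose[OF _ filterlim_symmetric_intervals])

text \<open>By orthogonality the squared distance of two partial sums is a difference of partial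
  sums of the energies, so they form a Cauchy sequence and \<open>L2_complete\<close> provides
  \<open>w\<close>. The limit inherits the coefficients because, by Bessel for a single frequency,
  taking the coefficient of index \<open>k\<close> is continuous from \<open>L2 cylinder\<close> to
  \<open>L2 interval\<close>.\<close>

lemma Riesz_Fischer_time:
  assumes c: "\<And>k. c k \<in> borel_measurable interval" "\<And>k. integrable interval (\<lambda>x. (cmod (c k x))\<^sup>2)"
    and sym: "\<And>k x. c (- k) x = cnj (c k x)"
    and sum: "(\<lambda>k::int. LINT x|interval. (cmod (c k x))\<^sup>2) summable_on UNIV"
  shows "\<exists>w\<in>L2 cylinder. (\<forall>k. AE x in interval. time_coeff w k x = c k x) \<and>
    (\<lambda>N. L2_norm cylinder (\<lambda>z. wave_sum c {- int N..int N} z - w z)) \<longlonglongrightarrow> 0"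
proof -
  define K where "K N = {- int N..int N}" for N
  define S where "S N = wave_sum c (K N)" for N
  define a where "a k = (LINT x|interval. (cmod (c k x))\<^sup>2)" for k
  have a: "a k \<ge> 0" for k by (simp add: a_def)
  have S: "S N \<in> L2 cylinder" for N unfolding S_def K_def by (intro wave_sum_L2 c) auto
  have "(\<lambda>N. \<Sum>k\<in>K N. a k) \<longlonglongrightarrow> infsum a UNIV"
    unfolding K_def using sum by (intro has_sum_symmetric_limit) (simp add: a_def[abs_def])
  then have Cauchy: "Cauchy (\<lambda>N. \<Sum>k\<in>K N. a k)" by (rule LIMSEQ_imp_Cauchy)
  have diff: "(L2_norm cylinder (\<lambda>z. S N z - S M z))\<^sup>2 = (\<Sum>k\<in>K N. a k) - (\<Sum>k\<in>K M. a k)" if "M \<le> N" for M N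
  proof -
    have sub: "K M \<subseteq> K N" using that by (auto simp: K_def)
    have "(\<lambda>z. S N z - S M z) = wave_sum c (K N - K M)"
      using sub by (auto simp: S_def wave_sum_def K_def sum_diff)
    moreover have "uminus ` (K N - K M) = K N - K M"
      by (subst image_set_diff) (auto simp: K_def)
    ultimately have "(L2_norm cylinder (\<lambda>z. S N z - S M z))\<^sup>2 = (\<Sum>k\<in>K N - K M. a k)"
      unfolding a_def by (simp add: wave_sum_norm[where c = c, OF c sym] K_def)
    also have "\<dots> = (\<Sum>k\<in>K N. a k) - (\<Sum>k\<in>K M. a k)"
      using sub by (simp add: sum_diff K_def)
    finally show ?thesis .
  qed
  have "\<exists>w\<in>L2 cylinder. (\<lambda>N. L2_norm cylinder (\<lambda>z. S N z - w z)) \<longlonglongrightarrow> 0"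
  proof (rule L2_complete[OF S])
    fix e :: real assume e: "e > 0"
    obtain N0 where N0: "\<And>m n. m \<ge> N0 \<Longrightarrow> n \<ge> N0 \<Longrightarrow> norm ((\<Sum>k\<in>K m. a k) - (\<Sum>k\<in>K n. a k)) < e\<^sup>2"
      using CauchyD[OF Cauchy, of "e\<^sup>2"] e by auto
    have *: "L2_norm cylinder (\<lambda>z. S m z - S n z) < e" if "m \<ge> N0" "n \<ge> N0" "n \<le> m" for m n
    proof (rule power2_less_imp_less)
      show "(L2_norm cylinder (\<lambda>z. S m z - S n z))\<^sup>2 < e\<^sup>2"
        unfolding diff[OF that(3)] using N0[OF that(1,2)] by simp
    qed (use e in simp)
    have "L2_norm cylinder (\<lambda>z. S m z - S n z) < e" if "m \<ge> N0" "n \<ge> N0" for m n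
      using *[of m n] *[of n m] that L2_norm_commute[of cylinder "S m" "S n"] by (cases "n \<le> m") auto
    then show "\<exists>N. \<forall>m\<ge>N. \<forall>n\<ge>N. L2_norm cylinder (\<lambda>z. S m z - S n z) < e" by blast
  qed
  then obtain w where w: "w \<in> L2 cylinder" and lim: "(\<lambda>N. L2_norm cylinder (\<lambda>z. S N z - w z)) \<longlonglongrightarrow> 0" by blast
  have "AE x in interval. time_coeff w k x = c k x" for k
  proof -
    note [measurable] = L2_measurable[OF w] c(1)
    \<comment> \<open>\<open>S N\<close> has the exact coefficient \<open>c k\<close> once
      \<open>N\<close> reaches the absolute value of \<open>k\<close>; so the integral of this fixed
      function lies below a null sequence.\<close>
    define D where "D x = (cmod (c k x - time_coeff w k x))\<^sup>2" for x
    have [measurable]: "D \<in> borel_measurable interval" unfolding D_def by measurable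
    have bound: "integrable interval D \<and> integral\<^sup>L interval D \<le> (L2_norm cylinder (\<lambda>z. S N z - w z))\<^sup>2"
      if N: "N \<ge> nat \<bar>k\<bar>" for N
    proof -
      have SL: "(\<lambda>z. S N z - w z) \<in> L2 cylinder" by (intro L2_diff S w)
      have SN: "time_coeff (S N) k x = c k x" for x
      proof -
        have "k \<in> K N" using N by (auto simp: K_def)
        then show ?thesis
          unfolding time_coeff_eq S_def wave_sum_def K_def
          using circle_coeff_wave_sum[of "K N" "\<lambda>k. c k x" k] sym by (simp add: K_def)
      qed
      have ae: "AE x in interval. (cmod (time_coeff (\<lambda>z. S N z - w z) k x))\<^sup>2 = D x"
        using time_coeff_diff_AE[OF S[of N] w] by eventually_elim (simp add: D_def SN)
      note [measurable] = L2_measurable[OF SL]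
      have "integral\<^sup>L interval D = time_energy (\<lambda>z. S N z - w z) k"
        using ae by (intro integral_cong_AE) (auto elim: eventually_mono)
      also have "\<dots> \<le> (L2_norm cylinder (\<lambda>z. S N z - w z))\<^sup>2"
        using time_coeff_Bessel[OF SL, of "{k}"] by simp
      finally have "integral\<^sup>L interval D \<le> (L2_norm cylinder (\<lambda>z. S N z - w z))\<^sup>2" .
      moreover have "integrable interval D"
        using time_coeff_square_integrable[OF SL, of k]
        by (rule Bochner_Integration.integrable_cong_AE_imp) (use ae in \<open>auto elim: eventually_mono\<close>)
      ultimately show ?thesis by simp
    qed
    have "(\<lambda>N. (L2_norm cylinder (\<lambda>z. S N z - w z))\<^sup>2) \<longlonglongrightarrow> 0\<^sup>2" by (intro tendsto_intros lim)
    then have "integral\<^sup>L interval D \<le> 0\<^sup>2"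
      by (rule LIMSEQ_le_const) (use bound in blast)
    moreover have "integral\<^sup>L interval D \<ge> 0" by (simp add: D_def)
    ultimately have "integral\<^sup>L interval D = 0" by simp
    moreover have "integrable interval D" using bound by blast
    ultimately have "AE x in interval. D x = 0"
      by (subst integral_nonneg_eq_0_iff_AE[symmetric]) (auto simp: D_def)
    then show ?thesis by eventually_elim (simp add: D_def)
  qed
  with w lim show ?thesis unfolding S_def K_def by blast
qed

lemma time_coeff_cnj: "time_coeff u (- k) x = cnj (time_coeff u k x)"
  by (simp add: time_coeff_eq circle_coeff_cnj)

lemma time_coeff_square_summable:
  assumes "u \<in> L2 cylinder"
  shows "(\<lambda>k::int. time_energy u k) summable_on UNIV"
proof (rule nonneg_bdd_above_summable_on)
  show "bdd_above (sum (\<lambda>k. time_energy u k) ` {F. F \<subseteq> UNIV \<and> finite F})"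
    using time_coeff_Bessel[OF assms] by (intro bdd_aboveI[of _ "(L2_norm cylinder u)\<^sup>2"]) auto
qed simp

text \<open>\<open>Riesz_Fischer_time\<close> produces some limit with the coefficients of
  \<open>u\<close>; \<open>time_coeff_unique\<close> identifies it with \<open>u\<close>.\<close>

lemma wave_sum_limit:
  assumes u: "u \<in> L2 cylinder"
  shows "(\<lambda>N. L2_norm cylinder (\<lambda>z. wave_sum (time_coeff u) {- int N..int N} z - u z)) \<longlonglongrightarrow> 0"
proof -
  note [measurable] = L2_measurable[OF u]
  obtain w where w: "w \<in> L2 cylinder" "\<And>k. AE x in interval. time_coeff w k x = time_coeff u k x"
    "(\<lambda>N. L2_norm cylinder (\<lambda>z. wave_sum (time_coeff u) {- int N..int N} z - w z)) \<longlonglongrightarrow> 0"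
    using Riesz_Fischer_time[of "time_coeff u"] time_coeff_square_integrable[OF u]
      time_coeff_square_summable[OF u] time_coeff_cnj[of u] by auto
  have ae: "AE z in cylinder. w z = u z" by (rule time_coeff_unique[OF w(1) u w(2)])
  have "L2_norm cylinder (\<lambda>z. wave_sum (time_coeff u) {- int N..int N} z - w z)
    = L2_norm cylinder (\<lambda>z. wave_sum (time_coeff u) {- int N..int N} z - u z)" for N
  proof (rule L2_norm_cong_AE)
    note [measurable] = L2_measurable[OF w(1)]
    have [measurable]: "wave_sum (time_coeff u) {- int N..int N} \<in> borel_measurable cylinder"
      by (intro L2_measurable wave_sum_L2 time_coeff_square_integrable[OF u]) auto
    show "(\<lambda>z. wave_sum (time_coeff u) {- int N..int N} z - w z) \<in> borel_measurable cylinder"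
      "(\<lambda>z. wave_sum (time_coeff u) {- int N..int N} z - u z) \<in> borel_measurable cylinder"
      by measurable
    show "AE z in cylinder. wave_sum (time_coeff u) {- int N..int N} z - w z
      = wave_sum (time_coeff u) {- int N..int N} z - u z"
      using ae by eventually_elim simp
  qed
  with w(3) show ?thesis by simp
qed

lemma Parseval_norm:
  assumes u: "u \<in> L2 cylinder"
  shows "((\<lambda>k. time_energy u k) has_sum (L2_norm cylinder u)\<^sup>2) UNIV"
proof -
  note [measurable] = L2_measurable[OF u]
  define a where "a k = time_energy u k" for k
  define S where "S N = wave_sum (time_coeff u) {- int N..int N}" for N
  have S: "S N \<in> L2 cylinder" for N
    unfolding S_def by (intro wave_sum_L2 time_coeff_square_integrable[OF u]) auto
  have "(a has_sum infsum a UNIV) UNIV"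
    using time_coeff_square_summable[OF u] unfolding a_def by (rule has_sum_infsum)
  then have lim: "(\<lambda>N. \<Sum>k\<in>{- int N..int N}. a k) \<longlonglongrightarrow> infsum a UNIV" and hs: "(a has_sum infsum a UNIV) UNIV"
    by (auto intro: has_sum_symmetric_limit)
  have norm: "(L2_norm cylinder (S N))\<^sup>2 = (\<Sum>k\<in>{- int N..int N}. a k)" for N
    unfolding S_def a_def
    by (intro wave_sum_norm time_coeff_square_integrable[OF u]) (auto simp: time_coeff_cnj)
  have "(\<lambda>N. L2_norm cylinder (S N) - L2_norm cylinder u) \<longlonglongrightarrow> 0"
  proof (rule tendsto_rabs_zero_cancel, rule tendsto_sandwich[OF _ _ tendsto_const wave_sum_limit[OF u]])
    show "\<forall>\<^sub>F N in sequentially. \<bar>L2_norm cylinder (S N) - L2_norm cylinder u\<bar>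
      \<le> L2_norm cylinder (\<lambda>z. wave_sum (time_coeff u) {- int N..int N} z - u z)"
      using L2_norm_abs_diff[OF S u] by (simp add: S_def)
  qed simp
  then have "(\<lambda>N. L2_norm cylinder (S N)) \<longlonglongrightarrow> L2_norm cylinder u" by (simp add: LIM_zero_iff)
  then have "(\<lambda>N. (L2_norm cylinder (S N))\<^sup>2) \<longlonglongrightarrow> (L2_norm cylinder u)\<^sup>2" by (intro tendsto_intros)
  with lim have "infsum a UNIV = (L2_norm cylinder u)\<^sup>2"
    unfolding norm by (rule LIMSEQ_unique)
  with hs show ?thesis by (simp add: a_def[abs_def])
qed

lemma has_sum_diff_real:
  fixes f g :: "'a \<Rightarrow> real"
  shows "(f has_sum a) A \<Longrightarrow> (g has_sum b) A \<Longrightarrow> ((\<lambda>x. f x - g x) has_sum (a - b)) A"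
  using has_sum_add[of f A a "\<lambda>x. - g x" "- b"] has_sum_uminusI[of g A b] by simp

text \<open>Polarization of \<open>Parseval_norm\<close>. The difference of the squared moduli of a
  + b and a - b sees only the real part of a cnj b, which is all that a real scalar product
  needs.\<close>

lemma Parseval_inner:
  assumes u: "u \<in> L2 cylinder" and v: "v \<in> L2 cylinder"
  shows "((\<lambda>k. LINT x|interval. Re (time_coeff u k x * cnj (time_coeff v k x))) has_sum L2_inner
      cylinder u v) UNIV"
proof -
  note [measurable] = L2_measurable[OF u] L2_measurable[OF v]
  have p: "(\<lambda>z. u z + v z) \<in> L2 cylinder" and m: "(\<lambda>z. u z - v z) \<in> L2 cylinder"
    by (intro L2_add L2_diff u v)+
  have "((\<lambda>k. 1/4 * (time_energy (\<lambda>z. u z + v z) k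
      - time_energy (\<lambda>z. u z - v z) k))
    has_sum (1/4 * ((L2_norm cylinder (\<lambda>z. u z + v z))\<^sup>2 - (L2_norm cylinder (\<lambda>z. u z - v z))\<^sup>2))) UNIV"
    by (intro has_sum_cmult_right has_sum_diff_real Parseval_norm p m)
  moreover have "1/4 * (time_energy (\<lambda>z. u z + v z) k
      - time_energy (\<lambda>z. u z - v z) k)
    = (LINT x|interval. Re (time_coeff u k x * cnj (time_coeff v k x)))" for k
  proof -
    have "1/4 * (time_energy (\<lambda>z. u z + v z) k
      - time_energy (\<lambda>z. u z - v z) k)
      = (LINT x|interval. 1/4 * ((cmod (time_coeff (\<lambda>z. u z + v z) k x))\<^sup>2
       - (cmod (time_coeff (\<lambda>z. u z - v z) k x))\<^sup>2))"
      using time_coeff_square_integrable[OF p, of k] time_coeff_square_integrable[OF m, of k] by simp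
    also have "\<dots> = (LINT x|interval. Re (time_coeff u k x * cnj (time_coeff v k x)))"
    proof (rule integral_cong_AE)
      show "AE x in interval. 1/4 * ((cmod (time_coeff (\<lambda>z. u z + v z) k x))\<^sup>2
       - (cmod (time_coeff (\<lambda>z. u z - v z) k x))\<^sup>2) = Re (time_coeff u k x * cnj (time_coeff v k x))"
        using time_coeff_add_AE[OF u v] time_coeff_diff_AE[OF u v]
      proof eventually_elim
        case (elim x)
        show ?case
          unfolding elim(1)[rule_format] elim(2)[rule_format] cmod_power2
          by (simp add: power2_eq_square algebra_simps)
      qed
      show "(\<lambda>x. 1/4 * ((cmod (time_coeff (\<lambda>z. u z + v z) k x))\<^sup>2
        - (cmod (time_coeff (\<lambda>z. u z - v z) k x))\<^sup>2)) \<in> borel_measurable interval"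
        by (intro borel_measurable_times borel_measurable_const borel_measurable_diff
          borel_measurable_integrable time_coeff_square_integrable p m)
      show "(\<lambda>x. Re (time_coeff u k x * cnj (time_coeff v k x))) \<in> borel_measurable interval"
        by measurable
    qed
    finally show ?thesis .
  qed
  moreover have "1/4 * ((L2_norm cylinder (\<lambda>z. u z + v z))\<^sup>2 - (L2_norm cylinder (\<lambda>z. u z - v z))\<^sup>2)
    = L2_inner cylinder u v"
  proof -
    have "(L2_norm cylinder (\<lambda>z. u z + v z))\<^sup>2 - (L2_norm cylinder (\<lambda>z. u z - v z))\<^sup>2
      = (LINT z|cylinder. (u z + v z)\<^sup>2 - (u z - v z)\<^sup>2)"
      unfolding L2_norm_square using L2_integrable_square[OF p] L2_integrable_square[OF m] by simp
    also have "\<dots> = (LINT z|cylinder. 4 * (u z * v z))"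
      by (intro Bochner_Integration.integral_cong) (auto simp: power2_eq_square algebra_simps)
    finally show ?thesis by (simp add: L2_inner_def)
  qed
  ultimately show ?thesis by simp
qed

text \<open>Guarantees that the \<open>SOME\<close> in \<open>frac_deriv\<close> and
  \<open>frac_deriv_adj\<close> picks a genuine multiplier image. The symmetry of \<open>m\<close>
  keeps that image real-valued.\<close>

lemma time_multiplier_exists:
  assumes u: "u \<in> L2 cylinder" and sym: "\<And>k. m (- k) = cnj (m k)"
    and sum: "(\<lambda>k::int. (cmod (m k))\<^sup>2 * time_energy u k) summable_on UNIV"
  shows "\<exists>w. is_time_multiplier m u w"
proof -
  note [measurable] = L2_measurable[OF u]
  have "\<exists>w\<in>L2 cylinder. (\<forall>k. AE x in interval. time_coeff w k x = m k * time_coeff u k x) \<and>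
    (\<lambda>N. L2_norm cylinder (\<lambda>z. wave_sum (\<lambda>k x. m k * time_coeff u k x) {- int N..int N} z - w z)) \<longlonglongrightarrow> 0"
    using time_coeff_square_integrable[OF u] sum
    by (intro Riesz_Fischer_time) (auto simp: time_coeff_cnj sym norm_mult power_mult_distrib)
  then show ?thesis by (auto simp: is_time_multiplier_def)
qed

section \<open>Test functions and weak derivatives\<close>

text \<open>Differentiability read from the outside in: first \<open>f\<close>, then
  \<open>deriv f\<close>. With iterates \<open>(deriv ^^ n) f\<close>, the form used in
  \<open>test_functions\<close>, products would need a Leibniz formula; here closure under sums,
  products and \<open>exp\<close> is a one-step induction. Order 0 demands nothing, not even
  continuity.\<close>

primrec smooth_upto :: "nat \<Rightarrow> (real \<Rightarrow> real) \<Rightarrow> bool"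
  where "smooth_upto 0 f \<longleftrightarrow> True"
  | "smooth_upto (Suc n) f \<longleftrightarrow> (\<forall>x. f field_differentiable at x) \<and> smooth_upto n (deriv f)"

lemma smooth_upto_SucD: "smooth_upto (Suc n) f \<Longrightarrow> smooth_upto n f"
  by (induction n arbitrary: f) auto

lemma smooth_upto_SucI:
  assumes "\<And>x. (f has_real_derivative f' x) (at x)" "smooth_upto n f'"
  shows "smooth_upto (Suc n) f"
proof -
  have "deriv f = f'" using assms(1) by (auto intro: DERIV_imp_deriv)
  then show ?thesis using assms by (auto simp: field_differentiable_def)
qed

lemma smooth_upto_DERIV: "smooth_upto (Suc n) f \<Longrightarrow> (f has_real_derivative deriv f x) (at x)"
  by (simp add: DERIV_deriv_iff_field_differentiable)

lemma smooth_upto_const: "smooth_upto n (\<lambda>x. c)"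
proof (induction n arbitrary: c)
  case (Suc n)
  show ?case by (rule smooth_upto_SucI[where f' = "\<lambda>x. 0"]) (auto intro: Suc)
qed simp

lemma smooth_upto_add: "smooth_upto n f \<Longrightarrow> smooth_upto n g \<Longrightarrow> smooth_upto n (\<lambda>x. f x + g x)"
proof (induction n arbitrary: f g)
  case (Suc n)
  show ?case
    using Suc.prems by (intro smooth_upto_SucI[OF DERIV_add[OF smooth_upto_DERIV smooth_upto_DERIV]]
        Suc.IH) auto
qed simp

lemma smooth_upto_mult: "smooth_upto n f \<Longrightarrow> smooth_upto n g \<Longrightarrow> smooth_upto n (\<lambda>x. f x * g x)"
proof (induction n arbitrary: f g)
  case (Suc n)
  have "smooth_upto n (\<lambda>x. deriv f x * g x + deriv g x * f x)"
    using Suc.prems by (intro smooth_upto_add Suc.IH smooth_upto_SucD[OF Suc.prems(1)]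
        smooth_upto_SucD[OF Suc.prems(2)]) auto
  then show ?case
    using Suc.prems by (intro smooth_upto_SucI[OF DERIV_mult[OF smooth_upto_DERIV smooth_upto_DERIV]]) auto
qed simp

lemma smooth_upto_scale: "smooth_upto n f \<Longrightarrow> smooth_upto n (\<lambda>x. c * f x)"
  by (intro smooth_upto_mult smooth_upto_const)

lemma smooth_upto_diff: "smooth_upto n f \<Longrightarrow> smooth_upto n g \<Longrightarrow> smooth_upto n (\<lambda>x. f x - g x)"
  using smooth_upto_add[of n f "\<lambda>x. -1 * g x"] smooth_upto_scale[of n g "-1"] by simp

lemma smooth_upto_sum: "(\<And>i. i \<in> A \<Longrightarrow> smooth_upto n (f i)) \<Longrightarrow> smooth_upto n (\<lambda>x. \<Sum>i\<in>A. f i x)"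
  by (induction A rule: infinite_finite_induct) (auto intro: smooth_upto_add smooth_upto_const)

lemma smooth_upto_exp: "smooth_upto n f \<Longrightarrow> smooth_upto n (\<lambda>x. exp (f x))"
proof (induction n arbitrary: f)
  case (Suc n)
  have "((\<lambda>x. exp (f x)) has_real_derivative exp (f x) * deriv f x) (at x)" for x
    using smooth_upto_DERIV[OF Suc.prems] by (intro DERIV_chain2[OF DERIV_exp]) auto
  moreover have "smooth_upto n (\<lambda>x. exp (f x) * deriv f x)"
    using Suc.prems by (intro smooth_upto_mult Suc.IH smooth_upto_SucD[OF Suc.prems]) auto
  ultimately show ?case by (rule smooth_upto_SucI)
qed simp

lemma smooth_upto_affine: "smooth_upto n f \<Longrightarrow> smooth_upto n (\<lambda>x. f (a * x + b))"
proof (induction n arbitrary: f)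
  case (Suc n)
  have "((\<lambda>x. f (a * x + b)) has_real_derivative deriv f (a * x + b) * a) (at x)" for x
    by (rule DERIV_chain2[OF smooth_upto_DERIV[OF Suc.prems]]) (auto intro!: derivative_eq_intros)
  moreover have "smooth_upto n (\<lambda>x. deriv f (a * x + b) * a)"
    using Suc.prems by (intro smooth_upto_mult[OF Suc.IH[of "deriv f"] smooth_upto_const]) simp
  ultimately show ?case by (rule smooth_upto_SucI)
qed simp

lemma smooth_upto_cos_sin: "smooth_upto n cos \<and> smooth_upto n sin"
proof (induction n)
  case (Suc n)
  have "smooth_upto n (\<lambda>x. - sin x)" using Suc smooth_upto_scale[of n sin "-1"] by simp
  then show ?case
    using Suc by (auto intro!: smooth_upto_SucI[OF DERIV_cos] smooth_upto_SucI[OF DERIV_sin] simp del: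
        smooth_upto.simps)
qed simp

lemma smooth_upto_funpow: "(\<And>n. smooth_upto n f) \<Longrightarrow> smooth_upto n ((deriv ^^ m) f)"
proof (induction m arbitrary: n)
  case (Suc m)
  then have "smooth_upto (Suc n) ((deriv ^^ m) f)" by blast
  then show ?case by simp
qed simp

text \<open>The flat function exp(-1/x) with an extra factor x^(-m). The derivative of a member is a
  linear combination of members, so a single induction makes the whole family smooth.\<close>

definition exp_inverse_bump :: "nat \<Rightarrow> real \<Rightarrow> real"
  where "exp_inverse_bump m x = (if x > 0 then exp (- inverse x) * inverse x ^ m else 0)"

lemma power_le_fact_exp:
  assumes "y \<ge> (0::real)"
  shows "y ^ n \<le> fact n * exp y"
proof -
  have "(\<Sum>i\<in>{n}. inverse (fact i) * y ^ i) \<le> (\<Sum>i. inverse (fact i) * y ^ i)"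
    using assms by (intro sum_le_suminf summable_exp) auto
  also have "\<dots> = exp y" by (simp add: exp_def)
  finally show ?thesis by (simp add: field_simps)
qed

text \<open>With y = 1/x this is y^(m+1) <= (m+1)! exp(y), a single term of the exponential series.
  The linear decay in \<open>x\<close> is what makes the derivative at 0 vanish.\<close>

lemma exp_inverse_bump_bound: "\<bar>exp_inverse_bump m x\<bar> \<le> fact (Suc m) * \<bar>x\<bar>"
proof (cases "x > 0")
  case True
  define y where "y = inverse x"
  have y: "y > 0" using True by (simp add: y_def)
  have "y ^ m * y \<le> fact (Suc m) * exp y"
    using power_le_fact_exp[of y "Suc m"] y by (simp add: mult.commute)
  then have "exp (- y) * y ^ m \<le> fact (Suc m) * inverse y"
    using y by (simp add: exp_minus field_simps)
  moreover have "exp_inverse_bump m x = exp (- y) * y ^ m" "inverse y = \<bar>x\<bar>"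
    using True by (auto simp: exp_inverse_bump_def y_def)
  moreover have "exp (- y) * y ^ m \<ge> 0" using y by simp
  ultimately show ?thesis by (simp del: fact_Suc)
next
  case False
  then have "exp_inverse_bump m x = 0" by (simp add: exp_inverse_bump_def)
  then show ?thesis by (simp only: abs_zero) simp
qed

lemma exp_inverse_bump_DERIV:
  "(exp_inverse_bump m has_real_derivative exp_inverse_bump (m + 2) x - real m * exp_inverse_bump (m +
      1) x) (at x)"
proof -
  consider "x > 0" | "x < 0" | "x = 0" by linarith
  then show ?thesis
  proof cases
    case 1
    have i: "(inverse has_real_derivative - (inverse x)\<^sup>2) (at x)"
      using DERIV_inverse[of x UNIV] 1 by (simp add: numeral_2_eq_2)
    have "((\<lambda>x. inverse x ^ m) has_real_derivative real m * (- (inverse x)\<^sup>2 * inverse x ^ (m - Suc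
        0))) (at x)"
      by (rule DERIV_power[OF i])
    also have "real m * (- (inverse x)\<^sup>2 * inverse x ^ (m - Suc 0)) = - (real m * inverse x ^ (m + 1))"
      by (cases m) (auto simp: power2_eq_square)
    finally have p: "((\<lambda>x. inverse x ^ m) has_real_derivative - (real m * inverse x ^ (m + 1))) (at x)" .
    have e: "((\<lambda>x. exp (- inverse x)) has_real_derivative exp (- inverse x) * (inverse x)\<^sup>2) (at x)"
      using DERIV_chain2[OF DERIV_exp DERIV_minus[OF i]] by simp
    have "((\<lambda>x. exp (- inverse x) * inverse x ^ m) has_real_derivative
      exp_inverse_bump (m + 2) x - real m * exp_inverse_bump (m + 1) x) (at x)"
      using DERIV_mult[OF e p] 1 by (simp add: exp_inverse_bump_def power2_eq_square algebra_simps)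
    then show ?thesis
      by (rule has_field_derivative_transform_within_open[where S = "{0<..}"]) (use 1 in \<open>auto simp:
          exp_inverse_bump_def\<close>)
  next
    case 2
    have "((\<lambda>x. 0) has_real_derivative 0) (at x)" by simp
    then have "(exp_inverse_bump m has_real_derivative 0) (at x)"
      by (rule has_field_derivative_transform_within_open[where S = "{..<0}"]) (use 2 in \<open>auto simp:
          exp_inverse_bump_def\<close>)
    then show ?thesis using 2 by (simp add: exp_inverse_bump_def)
  next
    case 3
    \<comment> \<open>Dividing by \<open>h\<close> raises the index, so the difference quotient at 0
      is again a member of the family and tends to 0 by the linear bound.\<close>
    have eq: "(exp_inverse_bump m (0 + h) - exp_inverse_bump m 0) / h = exp_inverse_bump (Suc m) h" for h
      by (auto simp: exp_inverse_bump_def divide_inverse)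
    have "(exp_inverse_bump (Suc m) \<longlongrightarrow> 0) (at 0)"
    proof (rule Lim_null_comparison)
      show "\<forall>\<^sub>F x in at 0. norm (exp_inverse_bump (Suc m) x) \<le> fact (Suc (Suc m)) * \<bar>x\<bar>"
        unfolding real_norm_def using exp_inverse_bump_bound by (intro always_eventually) blast
      have "((\<lambda>x::real. fact (Suc (Suc m)) * \<bar>x\<bar>) \<longlongrightarrow> fact (Suc (Suc m)) * \<bar>0\<bar>) (at 0)"
        by (intro tendsto_intros)
      then show "((\<lambda>x::real. fact (Suc (Suc m)) * \<bar>x\<bar>) \<longlongrightarrow> 0) (at 0)" by simp
    qed
    then have "(exp_inverse_bump m has_real_derivative 0) (at 0)"
      unfolding DERIV_def eq by simp
    then show ?thesis using 3 by (simp add: exp_inverse_bump_def)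
  qed
qed

lemma smooth_upto_exp_inverse_bump: "smooth_upto n (exp_inverse_bump m)"
proof (induction n arbitrary: m)
  case (Suc n)
  show ?case
    by (rule smooth_upto_SucI[OF exp_inverse_bump_DERIV]) (intro smooth_upto_diff smooth_upto_scale Suc)
qed simp

text \<open>A plateau function obtained without integration: the product of two flat functions
  vanishes outside the shrunken interval and is positive inside it, and the factor \<open>n\<close>
  in the exponent pushes the value to 1 pointwise. The margin 1/(n+3) is at most 1/3, so that
  interval is nonempty and compact in (0,1) for every \<open>n\<close>.\<close>

definition cutoff :: "nat \<Rightarrow> real \<Rightarrow> real"
  where "cutoff n x = 1 - exp (- (real n * (exp_inverse_bump 0 (x - 1 / (real n + 3)) *
    exp_inverse_bump 0 (1 - 1 / (real n + 3) - x))))"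

lemma smooth_upto_cutoff: "smooth_upto k (cutoff n)"
proof -
  have "smooth_upto k (\<lambda>x. exp_inverse_bump 0 (1 * x + - (1 / (real n + 3))))"
    "smooth_upto k (\<lambda>x. exp_inverse_bump 0 ((-1) * x + (1 - 1 / (real n + 3))))"
    by (rule smooth_upto_affine[OF smooth_upto_exp_inverse_bump])+
  then have "smooth_upto k (\<lambda>x. exp_inverse_bump 0 (x - 1 / (real n + 3)))"
    "smooth_upto k (\<lambda>x. exp_inverse_bump 0 (1 - 1 / (real n + 3) - x))"
    by (simp_all add: algebra_simps)
  then have "smooth_upto k (\<lambda>x. 1 - exp ((- real n) * (exp_inverse_bump 0 (x - 1 / (real n + 3)) *
    exp_inverse_bump 0 (1 - 1 / (real n + 3) - x))))"
    by (intro smooth_upto_diff smooth_upto_exp smooth_upto_scale smooth_upto_mult smooth_upto_const)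
  then show ?thesis by (simp add: cutoff_def[abs_def])
qed

lemma exp_inverse_bump_nonneg: "0 \<le> exp_inverse_bump m x"
  by (simp add: exp_inverse_bump_def)

lemma cutoff_range: "0 \<le> cutoff n x" "cutoff n x \<le> 1"
  using exp_inverse_bump_nonneg by (auto simp: cutoff_def)

lemma cutoff_eq_0: "x \<notin> {1 / (real n + 3)..1 - 1 / (real n + 3)} \<Longrightarrow> cutoff n x = 0"
  by (auto simp: cutoff_def exp_inverse_bump_def)

lemma cutoff_tendsto:
  assumes "0 < x" "x < 1"
  shows "(\<lambda>n. cutoff n x) \<longlonglongrightarrow> 1"
proof -
  have a: "(\<lambda>n. 1 / (real n + 3)) \<longlonglongrightarrow> 0"
    using LIMSEQ_ignore_initial_segment[OF lim_1_over_n[where 'a = real], of 3] by simp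
  have c: "isCont (exp_inverse_bump 0) y" for y
    using exp_inverse_bump_DERIV[of 0 y] by (rule DERIV_isCont)
  define b where "b n = exp_inverse_bump 0 (x - 1 / (real n + 3)) * exp_inverse_bump 0 (1 - 1 / (real
      n + 3) - x)" for n
  have "b \<longlonglongrightarrow> exp_inverse_bump 0 (x - 0) * exp_inverse_bump 0 (1 - 0 - x)"
    unfolding b_def by (intro tendsto_mult isCont_tendsto_compose[OF c] tendsto_intros a)
  moreover have "exp_inverse_bump 0 (x - 0) * exp_inverse_bump 0 (1 - 0 - x) > 0"
    using assms by (simp add: exp_inverse_bump_def)
  ultimately have "filterlim (\<lambda>n. b n * real n) at_top sequentially"
    by (intro filterlim_tendsto_pos_mult_at_top filterlim_real_sequentially)
  then have "filterlim (\<lambda>n. - (b n * real n)) at_bot sequentially"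
    by (simp add: filterlim_uminus_at_top)
  then have "(\<lambda>n. exp (- (b n * real n))) \<longlonglongrightarrow> 0"
    by (rule filterlim_compose[OF exp_at_bot])
  then have "(\<lambda>n. 1 - exp (- (b n * real n))) \<longlonglongrightarrow> 1 - 0" by (intro tendsto_intros)
  then show ?thesis by (simp add: cutoff_def b_def mult.commute)
qed

section \<open>Test functions on the interval\<close>

lemma test_functionI:
  assumes smooth: "\<And>n. smooth_upto n \<phi>" and ab: "0 < a" "b < 1"
    and zero: "\<And>x. x \<notin> {a..b} \<Longrightarrow> \<phi> x = 0"
  shows "\<phi> \<in> test_functions"
proof -
  have sub: "closure {x. \<phi> x \<noteq> 0} \<subseteq> {a..b}"
    using zero by (intro closure_minimal closed_atLeastAtMost) blast
  then have "bounded (closure {x. \<phi> x \<noteq> 0})"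
    using bounded_closed_interval bounded_subset by blast
  then have "compact (closure {x. \<phi> x \<noteq> 0})" by (simp add: compact_eq_bounded_closed)
  moreover have "(deriv ^^ n) \<phi> field_differentiable at x" for n x
    using smooth_upto_funpow[OF smooth, of "Suc 0" n] by simp
  moreover have "closure {x. \<phi> x \<noteq> 0} \<subseteq> {0<..<1}" using sub ab by force
  ultimately show ?thesis by (auto simp: test_functions_def)
qed

lemma test_function_smooth:
  assumes "\<phi> \<in> test_functions"
  shows "smooth_upto n \<phi>"
proof -
  have d: "(deriv ^^ m) \<phi> field_differentiable at x" for m x
    using assms by (simp add: test_functions_def)
  have "smooth_upto n ((deriv ^^ m) \<phi>)" for m
  proof (induction n arbitrary: m)
    case (Suc n)
    show ?case using d[of m] Suc[of "Suc m"] by simp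
  qed simp
  from this[of 0] show ?thesis by simp
qed

lemma test_function_support:
  assumes "\<phi> \<in> test_functions"
  obtains a b where "0 < a" "a < b" "b < 1" "\<And>x. x \<notin> {a..b} \<Longrightarrow> \<phi> x = 0"
proof -
  define K where "K = closure {x. \<phi> x \<noteq> 0}"
  have K: "compact K" "K \<subseteq> {0<..<1}" using assms by (auto simp: test_functions_def K_def)
  show ?thesis
  proof (cases "K = {}")
    case True
    then have "\<phi> x = 0" for x by (auto simp: K_def)
    then show ?thesis by (intro that[of "1/3" "1/2"]) auto
  next
    case False
    obtain s where s: "s \<in> K" "\<And>x. x \<in> K \<Longrightarrow> x \<le> s" using compact_attains_sup[OF K(1) False] by blast
    obtain i where i: "i \<in> K" "\<And>x. x \<in> K \<Longrightarrow> i \<le> x" using compact_attains_inf[OF K(1) False] by blast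
    \<comment> \<open>Half the infimum as left end point gives the strict inequality
      \<open>a < b\<close> without a proof that \<open>i < s\<close>.\<close>
    have "\<phi> x = 0" if "x \<notin> {i / 2..s}" for x
    proof (rule ccontr)
      assume "\<phi> x \<noteq> 0"
      then have "x \<in> K" unfolding K_def by (intro subsetD[OF closure_subset]) simp
      moreover have "i > 0" using i K by auto
      ultimately show False using that s(2)[of x] i(2)[of x] by auto
    qed
    moreover have "0 < i / 2" "i / 2 < s" "s < 1" using i s K(2) i(2)[of s] by force+
    ultimately show ?thesis using that by blast
  qed
qed

lemma test_function_DERIV: "\<phi> \<in> test_functions \<Longrightarrow> (\<phi> has_real_derivative deriv \<phi> x) (at x)"
  using smooth_upto_DERIV[OF test_function_smooth] .

lemma test_function_continuous: "\<phi> \<in> test_functions \<Longrightarrow> continuous_on UNIV \<phi>"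
  by (intro continuous_at_imp_continuous_on ballI DERIV_isCont[OF test_function_DERIV])

lemma test_function_deriv_continuous:
  assumes "\<phi> \<in> test_functions"
  shows "continuous_on UNIV (deriv \<phi>)"
proof -
  have "smooth_upto (Suc (Suc 0)) \<phi>" by (rule test_function_smooth[OF assms])
  then have "smooth_upto (Suc 0) (deriv \<phi>)" by simp
  from smooth_upto_DERIV[OF this] show ?thesis
    by (intro continuous_at_imp_continuous_on ballI DERIV_isCont)
qed

lemma test_function_outside: "\<phi> \<in> test_functions \<Longrightarrow> x \<le> 0 \<or> 1 \<le> x \<Longrightarrow> \<phi> x = 0"
  by (elim test_function_support) auto

section \<open>Primitives on the unit interval\<close>

lemma continuous_bounded_interval:
  fixes f :: "real \<Rightarrow> real"
  assumes "continuous_on UNIV f"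
  obtains B where "B \<ge> 0" "\<And>x. x \<in> {0..1} \<Longrightarrow> \<bar>f x\<bar> \<le> B"
proof -
  have "compact (f ` {0..1})"
    by (intro compact_continuous_image continuous_on_subset[OF assms]) auto
  then have "bounded (f ` {0..1})" by (rule compact_imp_bounded)
  then obtain B where B: "\<forall>y\<in>f ` {0..1}. \<bar>y\<bar> \<le> B" unfolding bounded_real by blast
  show ?thesis
  proof (rule that[of "max 0 B"])
    show "\<bar>f x\<bar> \<le> max 0 B" if "x \<in> {0..1}" for x
      using B that by (auto intro: max.coboundedI2)
  qed simp
qed

lemma continuous_measurable_interval:
  "continuous_on UNIV f \<Longrightarrow> (f :: real \<Rightarrow> real) \<in> borel_measurable interval"
  by (intro measurable_interval_borel borel_measurable_continuous_onI)

lemma continuous_L2_interval: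
  fixes f :: "real \<Rightarrow> real"
  assumes "continuous_on UNIV f"
  shows "f \<in> L2 interval"
proof -
  obtain B where "\<And>x. x \<in> {0..1} \<Longrightarrow> \<bar>f x\<bar> \<le> B" using continuous_bounded_interval[OF assms] by metis
  then show ?thesis
    by (intro interval.L2_bounded[of _ B] continuous_measurable_interval assms AE_I2) (auto simp:
        space_interval)
qed

lemma test_function_L2:
  "\<phi> \<in> test_functions \<Longrightarrow> \<phi> \<in> L2 interval" "\<phi> \<in> test_functions \<Longrightarrow> deriv \<phi> \<in> L2 interval"
  by (intro continuous_L2_interval test_function_continuous test_function_deriv_continuous; assumption)+

text \<open>The primitive of \<open>h\<close> that vanishes at 0. The upper limit sits in a
  conditional under an integral over all of \<open>interval\<close>, so bounds, linearity and
  measurability in \<open>x\<close> are those of a parameter integral on a probability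
  space.\<close>

definition prim :: "(real \<Rightarrow> real) \<Rightarrow> real \<Rightarrow> real"
  where "prim h x = (LINT y|interval. (if y < x then h y else 0))"

lemma prim_integrand_L2: "h \<in> L2 interval \<Longrightarrow> (\<lambda>y. if y < x then h y else 0) \<in> L2 interval"
proof -
  assume h: "h \<in> L2 interval"
  note [measurable] = L2_measurable[OF h]
  show ?thesis by (rule L2_bound[OF h]) auto
qed

text \<open>Cauchy--Schwarz on an interval of length 1. The bound is uniform in \<open>x\<close>, so
  \<open>L2\<close> convergence of derivatives becomes uniform convergence of primitives.\<close>

lemma prim_bound:
  assumes h: "h \<in> L2 interval"
  shows "\<bar>prim h x\<bar> \<le> L2_norm interval h"
proof -
  note [measurable] = L2_measurable[OF h]
  have "\<bar>prim h x\<bar> \<le> L2_norm interval (\<lambda>y. if y < x then h y else 0)"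
    unfolding prim_def by (rule interval.integral_le_L2_norm[OF prim_integrand_L2[OF h]])
  also have "\<dots> \<le> L2_norm interval h"
    by (rule L2_norm_mono_AE[OF h]) auto
  finally show ?thesis .
qed

lemma prim_diff:
  assumes "h \<in> L2 interval" "k \<in> L2 interval"
  shows "prim (\<lambda>y. h y - k y) x = prim h x - prim k x"
proof -
  have "prim h x - prim k x = (LINT y|interval. (if y < x then h y else 0) - (if y < x then k y else 0))"
    unfolding prim_def
    by (intro Bochner_Integration.integral_diff[symmetric] interval.L2_integrable prim_integrand_L2 assms)
  also have "\<dots> = prim (\<lambda>y. h y - k y) x"
    unfolding prim_def by (intro Bochner_Integration.integral_cong) auto
  finally show ?thesis by simp
qed

lemma prim_measurable [measurable]:
  assumes [measurable]: "h \<in> borel_measurable interval"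
  shows "prim h \<in> borel_measurable interval"
proof -
  have "case_prod (\<lambda>x y. if y < x then h y else 0) \<in> borel_measurable (interval \<Otimes>\<^sub>M interval)"
  proof -
    have [measurable]: "fst \<in> borel_measurable (interval \<Otimes>\<^sub>M interval)" "snd \<in> borel_measurable
        (interval \<Otimes>\<^sub>M interval)"
      using measurable_compose[OF measurable_fst measurable_interval_id]
        measurable_compose[OF measurable_snd measurable_interval_id] by auto
    show ?thesis unfolding case_prod_unfold by measurable
  qed
  then show ?thesis
    unfolding prim_def[abs_def] by (rule interval.borel_measurable_lebesgue_integral)
qed

lemma prim_L2: "h \<in> L2 interval \<Longrightarrow> prim h \<in> L2 interval"
  using prim_bound by (intro interval.L2_bounded[of _ "L2_norm interval h"]) (auto dest: L2_measurable)

lemma prim_FTC: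
  assumes d: "\<And>x. 0 \<le> x \<Longrightarrow> x \<le> 1 \<Longrightarrow> (F has_real_derivative f x) (at x)"
    and c: "continuous_on UNIV f" and x: "0 \<le> x" "x \<le> 1"
  shows "prim f x = F x - F 0"
proof -
  have f: "f \<in> borel_measurable lborel"
    using borel_measurable_continuous_onI[OF c] by simp
  have "prim f x = (LINT t|lborel. indicator {0<..<1} t *\<^sub>R (if t < x then f t else 0))"
    unfolding prim_def integral_interval ..
  also have "\<dots> = (LINT t|lborel. indicator {0..x} t *\<^sub>R f t)"
  proof (rule integral_cong_AE)
    show "(\<lambda>t. indicator {0<..<1} t *\<^sub>R (if t < x then f t else 0)) \<in> borel_measurable lborel"
      "(\<lambda>t. indicator {0..x} t *\<^sub>R f t) \<in> borel_measurable lborel"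
      using f by measurable
    show "AE t in lborel. indicator {0<..<1} t *\<^sub>R (if t < x then f t else 0) = indicator {0..x} t *\<^sub>R f t"
      using AE_lborel_singleton[of 0] AE_lborel_singleton[of x]
      by eventually_elim (use x in \<open>auto simp: indicator_def\<close>)
  qed
  also have "\<dots> = F x - F 0"
    using x d c by (intro integral_FTC_Icc)
      (auto intro: has_vector_derivative_at_within continuous_on_subset simp:
          has_real_derivative_iff_has_vector_derivative)
  finally show ?thesis .
qed

lemma prim_one: "prim f 1 = integral\<^sup>L interval f"
  unfolding prim_def by (intro Bochner_Integration.integral_cong) (auto simp: space_interval)

lemma integral_interval_FTC:
  assumes "\<And>x. 0 \<le> x \<Longrightarrow> x \<le> 1 \<Longrightarrow> (F has_real_derivative f x) (at x)" "continuous_on UNIV f"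
  shows "integral\<^sup>L interval f = F 1 - F 0"
  using prim_FTC[OF assms, of 1] by (simp add: prim_one)

lemma prim_test_function:
  assumes "\<phi> \<in> test_functions" "0 \<le> x" "x \<le> 1"
  shows "prim (deriv \<phi>) x = \<phi> x"
  using prim_FTC[OF test_function_DERIV[OF assms(1)] test_function_deriv_continuous[OF assms(1)] assms(2,3)]
    test_function_outside[OF assms(1), of 0] by simp

lemma test_function_has_weak_deriv:
  assumes \<phi>: "\<phi> \<in> test_functions"
  shows "has_weak_deriv \<phi> (deriv \<phi>)"
  unfolding has_weak_deriv_def
proof (intro conjI ballI)
  show "\<phi> \<in> L2 interval" "deriv \<phi> \<in> L2 interval" by (rule test_function_L2[OF \<phi>])+
  fix \<psi> assume \<psi>: "\<psi> \<in> test_functions"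
  have "integral\<^sup>L interval (\<lambda>x. deriv \<phi> x * \<psi> x + deriv \<psi> x * \<phi> x) = \<phi> 1 * \<psi> 1 - \<phi> 0 * \<psi> 0"
    by (intro integral_interval_FTC DERIV_mult test_function_DERIV continuous_intros
      test_function_continuous test_function_deriv_continuous \<phi> \<psi>)
  also have "\<dots> = 0" using test_function_outside[OF \<phi>] by simp
  finally have "integral\<^sup>L interval (\<lambda>x. deriv \<phi> x * \<psi> x + deriv \<psi> x * \<phi> x) = 0" .
  moreover have "integral\<^sup>L interval (\<lambda>x. deriv \<phi> x * \<psi> x + deriv \<psi> x * \<phi> x)
    = L2_inner interval (deriv \<phi>) \<psi> + L2_inner interval \<phi> (deriv \<psi>)"
    unfolding L2_inner_def using L2_mult_integrable test_function_L2[OF \<phi>] test_function_L2[OF \<psi>]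
    by (subst Bochner_Integration.integral_add) (auto simp: mult.commute)
  ultimately show "L2_inner interval \<phi> (deriv \<psi>) = - L2_inner interval (deriv \<phi>) \<psi>" by linarith
qed

section \<open>Density of test functions in \<open>L2 interval\<close>\<close>

lemma measurable_circle_interval: "f \<in> borel_measurable circle \<Longrightarrow> f \<in> borel_measurable interval"
  unfolding circle_def interval_def
  by (rule measurable_restrict_mono) auto

lemma integral_circle_eq_interval:
  fixes f :: "real \<Rightarrow> real"
  assumes "f \<in> borel_measurable circle"
  shows "integral\<^sup>L circle f = integral\<^sup>L interval f"
proof -
  have "(\<lambda>t. indicator {0..<1} t *\<^sub>R f t) \<in> borel_measurable lborel"
    using assms unfolding circle_def by (subst (asm) borel_measurable_restrict_space_iff) auto
  moreover have "(\<lambda>t. indicator {0<..<1} t *\<^sub>R f t) \<in> borel_measurable lborel"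
    using measurable_circle_interval[OF assms] unfolding interval_def
    by (subst (asm) borel_measurable_restrict_space_iff) auto
  ultimately show ?thesis
    unfolding integral_circle integral_interval using AE_lborel_singleton[of 0]
    by (intro integral_cong_AE) (auto simp: indicator_def elim!: eventually_mono)
qed

lemma L2_cylinder_fst:
  assumes g: "g \<in> L2 circle"
  shows "(\<lambda>z. g (fst z)) \<in> L2 cylinder" "L2_norm cylinder (\<lambda>z. g (fst z)) = L2_norm circle g"
proof -
  note [measurable] = L2_measurable[OF g]
  have int: "integrable cylinder (\<lambda>z. (g (fst z))\<^sup>2)"
    by (rule cylinder.Fubini_integrable) (auto simp: interval.prob_space L2_integrable_square[OF g])
  then show L: "(\<lambda>z. g (fst z)) \<in> L2 cylinder" by (intro L2_I) measurable
  have "(L2_norm cylinder (\<lambda>z. g (fst z)))\<^sup>2 = (L2_norm circle g)\<^sup>2"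
    unfolding L2_norm_cylinder(4)[OF L] by (simp add: L2_norm_square interval.prob_space)
  then show "L2_norm cylinder (\<lambda>z. g (fst z)) = L2_norm circle g" by simp
qed

text \<open>The Fourier theory in time is reused for the space variable in place of mollification:
  \<open>h\<close> is moved to the circle and read as a function on the cylinder that depends on
  \<open>t\<close> alone, and \<open>wave_sum_limit\<close> approximates it by trigonometric
  polynomials, which are smooth on the whole line.\<close>

lemma smooth_dense_L2_interval:
  assumes h: "h \<in> L2 interval" and e: "e > 0"
  shows "\<exists>p. (\<forall>n. smooth_upto n p) \<and> L2_norm interval (\<lambda>x. h x - p x) < e"
proof -
  \<comment> \<open>\<open>circle\<close> contains the point 0, about which measurability on
    \<open>interval\<close> says nothing; the value there is set to 0.\<close>
  define g where "g t = (if 0 < t then h t else 0)" for t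
  have gm: "g \<in> borel_measurable circle"
  proof -
    have "(\<lambda>t. indicator {0<..<1} t *\<^sub>R h t) \<in> borel_measurable lborel"
      using L2_measurable[OF h] unfolding interval_def
      by (subst (asm) borel_measurable_restrict_space_iff) auto
    then have "(\<lambda>t. indicator {0<..<1} t *\<^sub>R h t) \<in> borel_measurable circle"
      by (intro measurable_circle_borel) simp
    then show ?thesis
      by (rule measurable_cong[THEN iffD1, rotated]) (auto simp: space_circle g_def indicator_def)
  qed
  have gi: "integral\<^sup>L interval (\<lambda>t. F t (g t)) = integral\<^sup>L interval (\<lambda>t. F t (h t))" for F :: "real
      \<Rightarrow> real \<Rightarrow> real"
    by (intro Bochner_Integration.integral_cong) (auto simp: g_def space_interval)
  have "g \<in> L2 circle"
  proof (intro L2_I gm)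
    note [measurable] = gm
    have i: "integrable interval (\<lambda>t. (g t)\<^sup>2)"
      using L2_integrable_square[OF h] by (rule Bochner_Integration.integrable_cong[THEN iffD1,
          rotated -1]) (auto simp: g_def space_interval)
    have "integrable lborel (\<lambda>t. indicator {0<..<1} t *\<^sub>R (g t)\<^sup>2)"
      using i unfolding interval_def by (subst (asm) integrable_restrict_space) auto
    moreover have "(\<lambda>t. indicator {0<..<1} t *\<^sub>R (g t)\<^sup>2) = (\<lambda>t. indicator {0..<1} t *\<^sub>R (g t)\<^sup>2)"
      by (auto simp: g_def indicator_def)
    ultimately show "integrable circle (\<lambda>t. (g t)\<^sup>2)"
      unfolding circle_def by (subst integrable_restrict_space) auto
  qed
  note g = this
  define u where "u = (\<lambda>z::real\<times>real. g (fst z))"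
  have u: "u \<in> L2 cylinder" unfolding u_def using L2_cylinder_fst[OF g] by simp
  define p where "p N t = Re (\<Sum>k\<in>{- int N..int N}. circle_coeff g k * wave k t)" for N t
  have S: "wave_sum (time_coeff u) {- int N..int N} = (\<lambda>z. p N (fst z))" for N
    by (auto simp: wave_sum_def p_def time_coeff_eq u_def)
  have p_eq: "p N t = (\<Sum>k\<in>{- int N..int N}. Re (circle_coeff g k) * cos ((2 * pi * of_int k) * t + 0)
    - Im (circle_coeff g k) * sin ((2 * pi * of_int k) * t + 0))" for N t
    by (simp add: p_def wave_def)
  have smooth: "smooth_upto n (p N)" for n N
    unfolding p_eq[abs_def] using smooth_upto_cos_sin[of n]
    by (intro smooth_upto_sum smooth_upto_diff smooth_upto_scale smooth_upto_affine[of _ cos]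
        smooth_upto_affine[of _ sin]) auto
  have pc: "continuous_on UNIV (p N)" for N
    unfolding p_eq[abs_def] by (intro continuous_intros)
  have pm: "p N \<in> borel_measurable circle" for N
    by (intro measurable_circle_borel borel_measurable_continuous_onI pc)
  have pL: "p N \<in> L2 circle" for N
  proof -
    obtain B where "\<And>x. x \<in> {0..1} \<Longrightarrow> \<bar>p N x\<bar> \<le> B" using continuous_bounded_interval[OF pc] by metis
    then show ?thesis by (intro circle.L2_bounded[of _ B] pm AE_I2) (auto simp: space_circle)
  qed
  have "(\<lambda>N. L2_norm cylinder (\<lambda>z. p N (fst z) - g (fst z))) \<longlonglongrightarrow> 0"
    using wave_sum_limit[OF u] unfolding S by (simp add: u_def)
  then have "(\<lambda>N. L2_norm circle (\<lambda>t. p N t - g t)) \<longlonglongrightarrow> 0"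
    using L2_cylinder_fst(2)[OF L2_diff[OF pL g]] by simp
  then obtain N where N: "L2_norm circle (\<lambda>t. p N t - g t) < e"
    using LIMSEQ_D[of _ 0 e] e by fastforce
  have "(L2_norm circle (\<lambda>t. p N t - g t))\<^sup>2 = (L2_norm interval (\<lambda>t. p N t - g t))\<^sup>2"
    unfolding L2_norm_square by (rule integral_circle_eq_interval) (use pm gm in measurable)
  then have "L2_norm interval (\<lambda>t. p N t - g t) < e" using N by simp
  moreover have "L2_norm interval (\<lambda>t. p N t - g t) = L2_norm interval (\<lambda>t. h t - p N t)"
    unfolding L2_norm_commute[of _ "p N"] unfolding L2_norm_def L2_inner_def using gi[of "\<lambda>t y. (y - p
        N t) * (y - p N t)"] by simp
  ultimately show ?thesis using smooth by auto
qed

lemma test_dense_L2_interval: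
  assumes h: "h \<in> L2 interval" and e: "e > 0"
  shows "\<exists>\<phi>\<in>test_functions. L2_norm interval (\<lambda>x. h x - \<phi> x) < e"
proof -
  obtain p where p: "\<And>n. smooth_upto n p" "L2_norm interval (\<lambda>x. h x - p x) < e / 2"
    using smooth_dense_L2_interval[OF h, of "e/2"] e by auto
  have pc: "continuous_on UNIV p"
    using smooth_upto_DERIV[OF p(1)[of "Suc 0"]] by (intro continuous_at_imp_continuous_on ballI DERIV_isCont)
  have cc: "continuous_on UNIV (cutoff n)" for n
    using smooth_upto_DERIV[OF smooth_upto_cutoff[of "Suc 0" n]] by (intro
        continuous_at_imp_continuous_on ballI DERIV_isCont)
  define q where "q n x = p x * cutoff n x" for n x
  have q: "q n \<in> test_functions" for n
    by (rule test_functionI[of _ "1 / (real n + 3)" "1 - 1 / (real n + 3)"])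
      (auto simp: q_def[abs_def] intro!: smooth_upto_mult p smooth_upto_cutoff cutoff_eq_0)
  note [measurable] = continuous_measurable_interval[OF pc] continuous_measurable_interval[OF cc]
  have "(\<lambda>n. LINT x|interval. (p x - q n x)\<^sup>2) \<longlonglongrightarrow> (LINT x|interval. 0)"
  proof (rule integral_dominated_convergence[where w = "\<lambda>x. (p x)\<^sup>2"])
    show "integrable interval (\<lambda>x. (p x)\<^sup>2)" by (rule L2_integrable_square[OF continuous_L2_interval[OF pc]])
    show "AE x in interval. (\<lambda>n. (p x - q n x)\<^sup>2) \<longlonglongrightarrow> 0"
    proof (rule AE_I2)
      fix x assume "x \<in> space interval"
      then have "(\<lambda>n. cutoff n x) \<longlonglongrightarrow> 1" by (intro cutoff_tendsto) (auto simp: space_interval)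
      then have "(\<lambda>n. (p x - p x * cutoff n x)\<^sup>2) \<longlonglongrightarrow> (p x - p x * 1)\<^sup>2" by (intro tendsto_intros)
      then show "(\<lambda>n. (p x - q n x)\<^sup>2) \<longlonglongrightarrow> 0" by (simp add: q_def)
    qed
    show "AE x in interval. norm ((p x - q n x)\<^sup>2) \<le> (p x)\<^sup>2" for n
    proof (rule AE_I2)
      fix x
      have "(p x - q n x)\<^sup>2 = (p x)\<^sup>2 * (1 - cutoff n x)\<^sup>2"
        by (simp add: q_def power2_eq_square algebra_simps)
      also have "\<dots> \<le> (p x)\<^sup>2 * 1"
        using cutoff_range[of n x] by (intro mult_left_mono power_le_one) auto
      finally show "norm ((p x - q n x)\<^sup>2) \<le> (p x)\<^sup>2" by simp
    qed
  qed (auto simp: q_def)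
  then have "(\<lambda>n. (L2_norm interval (\<lambda>x. p x - q n x))\<^sup>2) \<longlonglongrightarrow> 0"
    by (simp add: L2_norm_square)
  then have "(\<lambda>n. sqrt ((L2_norm interval (\<lambda>x. p x - q n x))\<^sup>2)) \<longlonglongrightarrow> sqrt 0" by (intro tendsto_intros)
  then have "(\<lambda>n. L2_norm interval (\<lambda>x. p x - q n x)) \<longlonglongrightarrow> 0" by simp
  then obtain n where n: "L2_norm interval (\<lambda>x. p x - q n x) < e / 2"
    using LIMSEQ_D[of _ 0 "e / 2"] e by fastforce
  have "L2_norm interval (\<lambda>x. h x - q n x) < e"
    using L2_norm_triangle_diff[OF h continuous_L2_interval[OF pc] test_function_L2(1)[OF q[of n]]] n
        p(2) by simp
  then show ?thesis using q by blast
qed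

text \<open>Approximating \<open>h\<close> itself within \<open>e\<close> turns orthogonality into
  \<open>(L2_norm interval h)\<^sup>2 \<le> L2_norm interval h * e\<close>.\<close>

lemma orthogonal_to_test_functions:
  assumes h: "h \<in> L2 interval" and orth: "\<And>\<phi>. \<phi> \<in> test_functions \<Longrightarrow> L2_inner interval h \<phi> = 0"
  shows "AE x in interval. h x = 0"
proof (rule L2_norm_eq_zero[OF h])
  have "L2_norm interval h \<le> 0 + e" if e: "e > 0" for e
  proof -
    obtain \<phi> where \<phi>: "\<phi> \<in> test_functions" "L2_norm interval (\<lambda>x. h x - \<phi> x) < e"
      using test_dense_L2_interval[OF h e] by blast
    have "(L2_norm interval h)\<^sup>2 = L2_inner interval h (\<lambda>x. h x - \<phi> x) + L2_inner interval h \<phi>"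
      unfolding L2_inner_self[symmetric] L2_inner_def
      using L2_mult_integrable[OF h h] L2_mult_integrable[OF h test_function_L2(1)[OF \<phi>(1)]]
      by (simp add: right_diff_distrib)
    also have "\<dots> \<le> L2_norm interval h * e"
      using L2_inner_Cauchy_Schwarz[OF h L2_diff[OF h test_function_L2(1)[OF \<phi>(1)]]] orth[OF \<phi>(1)]
        mult_left_mono[OF less_imp_le[OF \<phi>(2)] L2_norm_nonneg[of interval h]] by linarith
    finally show ?thesis
      using e by (cases "L2_norm interval h = 0") (auto simp: power2_eq_square less_le)
  qed
  then have "L2_norm interval h \<le> 0" by (rule field_le_epsilon)
  then show "L2_norm interval h = 0" using L2_norm_nonneg[of interval h] by linarith
qed

lemma weak_deriv_unique:
  assumes "has_weak_deriv g h" "has_weak_deriv g k"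
  shows "AE x in interval. h x = k x"
proof -
  have L: "h \<in> L2 interval" "k \<in> L2 interval" using assms by (auto simp: has_weak_deriv_def)
  have "AE x in interval. h x - k x = 0"
  proof (rule orthogonal_to_test_functions[OF L2_diff[OF L]])
    fix \<phi> assume \<phi>: "\<phi> \<in> test_functions"
    have "L2_inner interval (\<lambda>x. h x - k x) \<phi> = L2_inner interval h \<phi> - L2_inner interval k \<phi>"
      unfolding L2_inner_def using L2_mult_integrable[OF L(1) test_function_L2(1)[OF \<phi>]]
          L2_mult_integrable[OF L(2) test_function_L2(1)[OF \<phi>]]
      by (simp add: left_diff_distrib)
    also have "\<dots> = 0" using assms \<phi> unfolding has_weak_deriv_def by force
    finally show "L2_inner interval (\<lambda>x. h x - k x) \<phi> = 0" .
  qed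
  then show ?thesis by simp
qed

section \<open>Primitives and the space \<open>H\<^sup>1\<^sub>0(I)\<close>\<close>

text \<open>An antiderivative is constant on either side of the support of \<open>\<psi>\<close>.
  Mean zero makes the two constants equal, so subtracting \<open>g 0\<close> leaves a compactly
  supported function.\<close>

lemma test_function_antiderivative:
  assumes \<psi>: "\<psi> \<in> test_functions" and zero: "integral\<^sup>L interval \<psi> = 0"
  shows "\<exists>\<phi>\<in>test_functions. deriv \<phi> = \<psi>"
proof -
  note c = test_function_continuous[OF \<psi>]
  obtain a b where ab: "0 < a" "a < b" "b < 1" "\<And>x. x \<notin> {a..b} \<Longrightarrow> \<psi> x = 0"
    using test_function_support[OF \<psi>] by blast
  \<comment> \<open>Working on a neighbourhood of [0,1] gives two-sided derivatives at 0 and 1;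
    outside (-1,2) the function is glued to 0.\<close>
  obtain g where "\<And>x. x \<in> {-1..2} \<Longrightarrow> (g has_vector_derivative \<psi> x) (at x within {-1..2})"
    using antiderivative_continuous[OF continuous_on_subset[OF c subset_UNIV]] by metis
  note g' = this
  have g: "(g has_real_derivative \<psi> x) (at x)" if "-1 < x" "x < 2" for x
    using g'[of x] that at_within_Icc_at[OF that] by (simp add: has_real_derivative_iff_has_vector_derivative)
  define \<phi> where "\<phi> x = (if -1 < x \<and> x < 2 then g x - g 0 else 0)" for x
  have left: "g x = g 0" if "-1 < x" "x < a" for x
  proof -
    have "\<exists>k. \<forall>x\<in>{-1<..<a}. g x = k"
    proof (rule has_field_derivative_zero_constant)
      fix x assume x: "x \<in> {-1<..<a}"
      then have "(g has_real_derivative \<psi> x) (at x)" using g[of x] ab(1-3) by simp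
      moreover have "\<psi> x = 0" using x ab(4) by auto
      ultimately show "(g has_real_derivative 0) (at x within {-1<..<a})" by (simp add:
          has_field_derivative_at_within)
    qed auto
    then show ?thesis using that ab by force
  qed
  have right: "g x = g 1" if "b < x" "x < 2" for x
  proof -
    have "\<exists>k. \<forall>x\<in>{b<..<2}. g x = k"
    proof (rule has_field_derivative_zero_constant)
      fix x assume x: "x \<in> {b<..<2}"
      then have "(g has_real_derivative \<psi> x) (at x)" using g[of x] ab(1-3) by simp
      moreover have "\<psi> x = 0" using x ab(4) by auto
      ultimately show "(g has_real_derivative 0) (at x within {b<..<2})" by (simp add:
          has_field_derivative_at_within)
    qed auto
    then show ?thesis using that ab by force
  qed
  have "g 1 - g 0 = integral\<^sup>L interval \<psi>"
    by (rule integral_interval_FTC[symmetric]) (auto intro: g c)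
  then have g1: "g 1 = g 0" using zero by simp
  have \<phi>0: "\<phi> x = 0" if "x \<notin> {a..b}" for x
    using that left[of x] right[of x] g1 by (auto simp: \<phi>_def)
  have D: "(\<phi> has_real_derivative \<psi> x) (at x)" for x
  proof (cases "x \<in> {-1<..<2}")
    case True
    have "((\<lambda>x. g x - g 0) has_real_derivative \<psi> x) (at x)"
      using True g by (auto intro!: derivative_eq_intros)
    then show ?thesis
      by (rule has_field_derivative_transform_within_open[where S = "{-1<..<2}"]) (use True in \<open>auto
          simp: \<phi>_def\<close>)
  next
    case False
    then have x: "x \<in> - {a..b}" using ab by auto
    have "((\<lambda>x. 0) has_real_derivative 0) (at x)" by simp
    then have "(\<phi> has_real_derivative 0) (at x)"
      by (rule has_field_derivative_transform_within_open[where S = "- {a..b}"]) (use x in \<open>auto simp: \<phi>0\<close>)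
    then show ?thesis using x ab(4) by simp
  qed
  have "smooth_upto n \<phi>" for n
    by (cases n) (auto intro: smooth_upto_SucI[OF D test_function_smooth[OF \<psi>]] simp del:
        smooth_upto.simps(2))
  then have "\<phi> \<in> test_functions"
    using ab \<phi>0 by (intro test_functionI[of _ a b]) auto
  moreover have "deriv \<phi> = \<psi>" using D by (auto intro: DERIV_imp_deriv)
  ultimately show ?thesis by blast
qed

lemma L2_norm_scale: "L2_norm M (\<lambda>z. c * f z) = \<bar>c\<bar> * L2_norm M f"
proof -
  have "L2_inner M (\<lambda>z. c * f z) (\<lambda>z. c * f z) = (LINT z|M. c\<^sup>2 * (f z * f z))"
    unfolding L2_inner_def by (intro Bochner_Integration.integral_cong) (auto simp: power2_eq_square)
  then show ?thesis by (simp add: L2_norm_def L2_inner_def real_sqrt_mult)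
qed

text \<open>Because \<open>h\<close> has mean zero, a test function near \<open>h\<close> has a mean
  no larger than its distance to \<open>h\<close>. That mean is removed by a multiple of a fixed
  test function \<open>\<rho>\<close> near 1, and the result is a derivative by
  \<open>test_function_antiderivative\<close>.\<close>

lemma mean_zero_test_dense:
  assumes h: "h \<in> L2 interval" and zero: "integral\<^sup>L interval h = 0" and e: "e > 0"
  shows "\<exists>\<phi>\<in>test_functions. L2_norm interval (\<lambda>x. h x - deriv \<phi> x) < e"
proof -
  have one: "(\<lambda>x. 1) \<in> L2 interval" by (rule interval.L2_const)
  obtain \<rho> where \<rho>: "\<rho> \<in> test_functions" "L2_norm interval (\<lambda>x. 1 - \<rho> x) < 1 / 2"
    using test_dense_L2_interval[OF one, of "1/2"] by auto
  note \<rho>L = test_function_L2(1)[OF \<rho>(1)]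
  define r where "r = integral\<^sup>L interval \<rho>"
  have "\<bar>LINT x|interval. 1 - \<rho> x\<bar> < 1 / 2"
    using interval.integral_le_L2_norm[OF L2_diff[OF one \<rho>L]] \<rho>(2) by linarith
  then have r: "r > 1 / 2"
  proof -
    have "(LINT x|interval. 1 - \<rho> x) = 1 - r"
      using interval.L2_integrable[OF \<rho>L] by (simp add: r_def interval.prob_space)
    with \<open>\<bar>LINT x|interval. 1 - \<rho> x\<bar> < 1 / 2\<close> show ?thesis by linarith
  qed
  \<comment> \<open>The mean of \<open>\<rho>\<close> exceeds 1/2, so removing the mean costs at
    most \<open>2 * L2_norm interval \<rho>\<close> times the first error; \<open>c\<close> is the
    total amplification.\<close>
  define c where "c = 1 + 2 * L2_norm interval \<rho>"
  have c: "c > 0" by (simp add: c_def add_pos_nonneg)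
  obtain \<psi> where \<psi>: "\<psi> \<in> test_functions" "L2_norm interval (\<lambda>x. h x - \<psi> x) < e / c"
    using test_dense_L2_interval[OF h, of "e / c"] e c by auto
  note \<psi>L = test_function_L2(1)[OF \<psi>(1)]
  define s where "s = integral\<^sup>L interval \<psi> / r"
  have s: "\<bar>s\<bar> \<le> 2 * L2_norm interval (\<lambda>x. h x - \<psi> x)"
  proof -
    have "\<bar>integral\<^sup>L interval \<psi>\<bar> \<le> L2_norm interval (\<lambda>x. h x - \<psi> x)"
      using interval.integral_le_L2_norm[OF L2_diff[OF h \<psi>L]] zero
        interval.L2_integrable[OF h] interval.L2_integrable[OF \<psi>L] by simp
    moreover have "\<bar>s\<bar> \<le> 2 * \<bar>integral\<^sup>L interval \<psi>\<bar>"
      using r mult_right_mono[of 1 "2 * r" "\<bar>integral\<^sup>L interval \<psi>\<bar>"] by (simp add: s_def abs_divide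
          field_simps)
    ultimately show ?thesis by linarith
  qed
  define \<psi>' where "\<psi>' x = \<psi> x - s * \<rho> x" for x
  have "\<psi>' \<in> test_functions"
  proof -
    obtain a b where ab: "0 < a" "a < b" "b < 1" "\<And>x. x \<notin> {a..b} \<Longrightarrow> \<psi> x = 0"
      using test_function_support[OF \<psi>(1)] by blast
    obtain a' b' where ab': "0 < a'" "a' < b'" "b' < 1" "\<And>x. x \<notin> {a'..b'} \<Longrightarrow> \<rho> x = 0"
      using test_function_support[OF \<rho>(1)] by blast
    show ?thesis
    proof (rule test_functionI[of _ "min a a'" "max b b'"])
      show "smooth_upto n \<psi>'" for n unfolding \<psi>'_def[abs_def]
        by (intro smooth_upto_diff smooth_upto_scale test_function_smooth \<psi> \<rho>)
      show "\<psi>' x = 0" if "x \<notin> {min a a'..max b b'}" for x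
      proof -
        have "x \<notin> {a..b}" "x \<notin> {a'..b'}" using that by auto
        from ab(4)[OF this(1)] ab'(4)[OF this(2)] show ?thesis by (simp add: \<psi>'_def)
      qed
    qed (use ab ab' in auto)
  qed
  moreover have "integral\<^sup>L interval \<psi>' = 0"
    unfolding \<psi>'_def using interval.L2_integrable[OF \<psi>L] interval.L2_integrable[OF \<rho>L] r
    by (simp add: s_def r_def[symmetric])
  ultimately obtain \<phi> where \<phi>: "\<phi> \<in> test_functions" "deriv \<phi> = \<psi>'"
    using test_function_antiderivative by blast
  have "L2_norm interval (\<lambda>x. h x - deriv \<phi> x) = L2_norm interval (\<lambda>x. (h x - \<psi> x) + s * \<rho> x)"
    by (simp add: \<phi>(2) \<psi>'_def algebra_simps)
  also have "\<dots> \<le> L2_norm interval (\<lambda>x. h x - \<psi> x) + L2_norm interval (\<lambda>x. s * \<rho> x)"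
    by (intro L2_norm_triangle L2_diff h \<psi>L L2_scale \<rho>L)
  also have "L2_norm interval (\<lambda>x. s * \<rho> x) = \<bar>s\<bar> * L2_norm interval \<rho>"
    by (rule L2_norm_scale)
  also have "L2_norm interval (\<lambda>x. h x - \<psi> x) + \<bar>s\<bar> * L2_norm interval \<rho>
    \<le> L2_norm interval (\<lambda>x. h x - \<psi> x) * c"
    using mult_right_mono[OF s L2_norm_nonneg[of interval \<rho>]] by (simp add: c_def algebra_simps)
  also have "\<dots> < e" using \<psi>(2) c by (simp add: field_simps)
  finally show ?thesis using \<phi>(1) by blast
qed

text \<open>The common tool for primitives of mean-zero functions: identities valid for test
  functions pass to \<open>prim h\<close> along a sequence whose derivatives converge in
  \<open>L2\<close> and whose values converge uniformly on [0,1], at the rate supplied by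
  \<open>prim_bound\<close>.\<close>

lemma mean_zero_test_sequence:
  assumes h: "h \<in> L2 interval" and zero: "integral\<^sup>L interval h = 0"
  obtains \<phi> :: "nat \<Rightarrow> real \<Rightarrow> real"
  where "\<And>n. \<phi> n \<in> test_functions" "(\<lambda>n. L2_norm interval (\<lambda>x. deriv (\<phi> n) x - h x)) \<longlonglongrightarrow> 0"
    "\<And>n x. x \<in> {0..1} \<Longrightarrow> \<bar>\<phi> n x - prim h x\<bar> \<le> L2_norm interval (\<lambda>x. deriv (\<phi> n) x - h x)"
proof -
  have "\<forall>n. \<exists>\<phi>\<in>test_functions. L2_norm interval (\<lambda>x. h x - deriv \<phi> x) < inverse (real (Suc n))"
    using mean_zero_test_dense[OF h zero] by simp
  then obtain \<phi> where \<phi>: "\<And>n. \<phi> n \<in> test_functions"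
    "\<And>n. L2_norm interval (\<lambda>x. h x - deriv (\<phi> n) x) < inverse (real (Suc n))" by metis
  have "(\<lambda>n. L2_norm interval (\<lambda>x. deriv (\<phi> n) x - h x)) \<longlonglongrightarrow> 0"
    unfolding L2_norm_commute[of _ "deriv _"]
    by (rule tendsto_sandwich[OF _ _ tendsto_const LIMSEQ_inverse_real_of_nat])
      (auto intro!: always_eventually less_imp_le \<phi>(2) simp del: of_nat_Suc)
  moreover have "\<bar>\<phi> n x - prim h x\<bar> \<le> L2_norm interval (\<lambda>x. deriv (\<phi> n) x - h x)" if "x \<in> {0..1}" for n x
    using prim_bound[OF L2_diff[OF test_function_L2(2)[OF \<phi>(1)] h], of n x] that
    by (simp add: prim_diff[OF test_function_L2(2)[OF \<phi>(1)] h] prim_test_function[OF \<phi>(1)])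
  ultimately show ?thesis using that \<phi>(1) by blast
qed

lemma L2_inner_tendsto:
  assumes f: "\<And>n. f n \<in> L2 M" "f' \<in> L2 M" "(\<lambda>n. L2_norm M (\<lambda>x. f n x - f' x)) \<longlonglongrightarrow> 0"
    and g: "\<And>n. g n \<in> L2 M" "g' \<in> L2 M" "(\<lambda>n. L2_norm M (\<lambda>x. g n x - g' x)) \<longlonglongrightarrow> 0"
  shows "(\<lambda>n. L2_inner M (f n) (g n)) \<longlonglongrightarrow> L2_inner M f' g'"
proof -
  define a where "a n = L2_norm M (\<lambda>x. f n x - f' x)" for n
  define b where "b n = L2_norm M (\<lambda>x. g n x - g' x)" for n
  have le: "\<bar>L2_inner M (f n) (g n) - L2_inner M f' g'\<bar> \<le> a n * (L2_norm M g' + b n) + L2_norm M f' *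
      b n" for n
  proof -
    have "L2_inner M (f n) (g n) - L2_inner M f' g' = (LINT x|M. f n x * g n x - f' x * g' x)"
      unfolding L2_inner_def by (simp add: L2_mult_integrable f g)
    also have "\<dots> = (LINT x|M. (f n x - f' x) * g n x + f' x * (g n x - g' x))"
      by (simp add: algebra_simps)
    also have "\<dots> = L2_inner M (\<lambda>x. f n x - f' x) (g n) + L2_inner M f' (\<lambda>x. g n x - g' x)"
      unfolding L2_inner_def by (intro Bochner_Integration.integral_add L2_mult_integrable L2_diff f g)
    finally have eq: "L2_inner M (f n) (g n) - L2_inner M f' g'
      = L2_inner M (\<lambda>x. f n x - f' x) (g n) + L2_inner M f' (\<lambda>x. g n x - g' x)" .
    have "\<bar>L2_inner M (\<lambda>x. f n x - f' x) (g n)\<bar> \<le> a n * L2_norm M (g n)"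
      unfolding a_def by (intro L2_inner_Cauchy_Schwarz L2_diff f g)
    also have "\<dots> \<le> a n * (L2_norm M g' + b n)"
      unfolding a_def b_def by (intro mult_left_mono L2_norm_triangle_sub g) auto
    finally have 1: "\<bar>L2_inner M (\<lambda>x. f n x - f' x) (g n)\<bar> \<le> a n * (L2_norm M g' + b n)" .
    have 2: "\<bar>L2_inner M f' (\<lambda>x. g n x - g' x)\<bar> \<le> L2_norm M f' * b n"
      unfolding b_def by (intro L2_inner_Cauchy_Schwarz L2_diff f g)
    show ?thesis using 1 2 unfolding eq by linarith
  qed
  have lim: "(\<lambda>n. a n * (L2_norm M g' + b n) + L2_norm M f' * b n) \<longlonglongrightarrow> 0 * (L2_norm M g' + 0) + L2_norm
      M f' * 0"
    using f(3) g(3) unfolding a_def b_def by (intro tendsto_intros)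
  have "(\<lambda>n. L2_inner M (f n) (g n) - L2_inner M f' g') \<longlonglongrightarrow> 0"
  proof (rule Lim_null_comparison)
    show "\<forall>\<^sub>F n in sequentially. norm (L2_inner M (f n) (g n) - L2_inner M f' g')
      \<le> a n * (L2_norm M g' + b n) + L2_norm M f' * b n"
      using le by (intro always_eventually allI) (simp only: real_norm_def)
  qed (use lim in simp)
  then show ?thesis by (simp add: LIM_zero_iff)
qed

lemma L2_norm_const_seq: "(\<lambda>n. L2_norm M (\<lambda>x. f x - f x)) \<longlonglongrightarrow> 0"
  by (simp add: L2_norm_def L2_inner_def)

lemma L2_limit_uniform:
  assumes "\<And>n x. x \<in> {0..1} \<Longrightarrow> \<bar>f n x - g x\<bar> \<le> b n" "b \<longlonglongrightarrow> 0"
    and "\<And>n. f n \<in> borel_measurable interval" "g \<in> borel_measurable interval"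
  shows "(\<lambda>n. L2_norm interval (\<lambda>x. f n x - g x)) \<longlonglongrightarrow> 0"
proof (rule tendsto_sandwich[OF _ _ tendsto_const assms(2)])
  have "L2_norm interval (\<lambda>x. f n x - g x) \<le> b n" for n
  proof (rule interval.L2_norm_const_bound)
    show "b n \<ge> 0" using assms(1)[of 0 n] by force
  qed (use assms in \<open>auto simp: space_interval\<close>)
  then show "\<forall>\<^sub>F n in sequentially. L2_norm interval (\<lambda>x. f n x - g x) \<le> b n" by simp
qed simp

lemma prim_has_weak_deriv:
  assumes h: "h \<in> L2 interval" and zero: "integral\<^sup>L interval h = 0"
  shows "has_weak_deriv (prim h) h"
  unfolding has_weak_deriv_def
proof (intro conjI ballI h prim_L2)
  fix \<psi> assume \<psi>: "\<psi> \<in> test_functions"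
  obtain \<phi> where \<phi>: "\<And>n. \<phi> n \<in> test_functions" and lim: "(\<lambda>n. L2_norm interval (\<lambda>x. deriv (\<phi> n) x - h x)) \<longlonglongrightarrow> 0"
    and unif: "\<And>n x. x \<in> {0..1} \<Longrightarrow> \<bar>\<phi> n x - prim h x\<bar> \<le> L2_norm interval (\<lambda>x. deriv (\<phi> n) x - h x)"
    using mean_zero_test_sequence[OF h zero] by blast
  have lim': "(\<lambda>n. L2_norm interval (\<lambda>x. \<phi> n x - prim h x)) \<longlonglongrightarrow> 0"
    using L2_measurable[OF test_function_L2(1)[OF \<phi>]] L2_measurable[OF prim_L2[OF h]]
    by (intro L2_limit_uniform[OF unif lim]) auto
  have "(\<lambda>n. L2_inner interval (\<phi> n) (deriv \<psi>)) \<longlonglongrightarrow> L2_inner interval (prim h) (deriv \<psi>)"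
    by (rule L2_inner_tendsto; (rule lim lim' L2_norm_const_seq h prim_L2[OF h] test_function_L2[OF \<phi>]
        test_function_L2[OF \<psi>]))
  moreover have "(\<lambda>n. - L2_inner interval (deriv (\<phi> n)) \<psi>) \<longlonglongrightarrow> - L2_inner interval h \<psi>"
    by (rule tendsto_minus, rule L2_inner_tendsto; (rule lim lim' L2_norm_const_seq h prim_L2[OF h]
        test_function_L2[OF \<phi>] test_function_L2[OF \<psi>]))
  moreover have "L2_inner interval (\<phi> n) (deriv \<psi>) = - L2_inner interval (deriv (\<phi> n)) \<psi>" for n
    using test_function_has_weak_deriv[OF \<phi>] \<psi> by (simp add: has_weak_deriv_def)
  ultimately show "L2_inner interval (prim h) (deriv \<psi>) = - L2_inner interval h \<psi>"
    using LIMSEQ_unique by simp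
qed

lemma has_weak_deriv_diff:
  assumes "has_weak_deriv g h" "has_weak_deriv g' h'"
  shows "has_weak_deriv (\<lambda>x. g x - g' x) (\<lambda>x. h x - h' x)"
  unfolding has_weak_deriv_def
proof (intro conjI ballI)
  have L: "g \<in> L2 interval" "h \<in> L2 interval" "g' \<in> L2 interval" "h' \<in> L2 interval"
    using assms by (auto simp: has_weak_deriv_def)
  show "(\<lambda>x. g x - g' x) \<in> L2 interval" "(\<lambda>x. h x - h' x) \<in> L2 interval"
    by (intro L2_diff L)+
  fix \<phi> assume \<phi>: "\<phi> \<in> test_functions"
  note \<phi>L = test_function_L2[OF \<phi>]
  have "L2_inner interval (\<lambda>x. g x - g' x) (deriv \<phi>) = L2_inner interval g (deriv \<phi>) - L2_inner
      interval g' (deriv \<phi>)"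
    unfolding L2_inner_def left_diff_distrib by (intro Bochner_Integration.integral_diff
        L2_mult_integrable L \<phi>L)
  also have "\<dots> = - (L2_inner interval h \<phi> - L2_inner interval h' \<phi>)"
    using assms \<phi> by (simp add: has_weak_deriv_def)
  also have "L2_inner interval h \<phi> - L2_inner interval h' \<phi> = L2_inner interval (\<lambda>x. h x - h' x) \<phi>"
    unfolding L2_inner_def left_diff_distrib by (intro Bochner_Integration.integral_diff[symmetric]
        L2_mult_integrable L \<phi>L)
  finally show "L2_inner interval (\<lambda>x. g x - g' x) (deriv \<phi>) = - L2_inner interval (\<lambda>x. h x - h' x) \<phi>" .
qed

lemma H1_norm_eq:
  assumes "has_weak_deriv g h"
  shows "H1_norm g = sqrt ((L2_norm interval g)\<^sup>2 + (L2_norm interval h)\<^sup>2)"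
proof -
  have w: "has_weak_deriv g (weak_deriv g)" unfolding weak_deriv_def using assms by (rule someI[of
      "has_weak_deriv g"])
  have "L2_norm interval (weak_deriv g) = L2_norm interval h"
    using w assms weak_deriv_unique[OF w assms]
    by (intro L2_norm_cong_AE) (auto simp: has_weak_deriv_def dest: L2_measurable)
  then show ?thesis by (simp add: H1_norm_def)
qed

lemma prim_in_H1_0:
  assumes h: "h \<in> L2 interval" and zero: "integral\<^sup>L interval h = 0"
  shows "prim h \<in> H1_0"
  unfolding H1_0_def
proof (intro CollectI conjI allI impI)
  note w = prim_has_weak_deriv[OF h zero]
  then show "prim h \<in> H1" by (auto simp: H1_def)
  fix \<epsilon> :: real assume e: "\<epsilon> > 0"
  obtain \<phi> where \<phi>: "\<And>n. \<phi> n \<in> test_functions" and lim: "(\<lambda>n. L2_norm interval (\<lambda>x. deriv (\<phi> n) x - h x)) \<longlonglongrightarrow> 0"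
    and unif: "\<And>n x. x \<in> {0..1} \<Longrightarrow> \<bar>\<phi> n x - prim h x\<bar> \<le> L2_norm interval (\<lambda>x. deriv (\<phi> n) x - h x)"
    using mean_zero_test_sequence[OF h zero] by blast
  have lim': "(\<lambda>n. L2_norm interval (\<lambda>x. \<phi> n x - prim h x)) \<longlonglongrightarrow> 0"
    using L2_measurable[OF test_function_L2(1)[OF \<phi>]] L2_measurable[OF prim_L2[OF h]]
    by (intro L2_limit_uniform[OF unif lim]) auto
  have "(\<lambda>n. sqrt ((L2_norm interval (\<lambda>x. \<phi> n x - prim h x))\<^sup>2 + (L2_norm interval (\<lambda>x. deriv (\<phi> n) x
      - h x))\<^sup>2)) \<longlonglongrightarrow> sqrt (0\<^sup>2 + 0\<^sup>2)"
    by (intro tendsto_intros lim lim')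
  then obtain n where "sqrt ((L2_norm interval (\<lambda>x. \<phi> n x - prim h x))\<^sup>2 + (L2_norm interval (\<lambda>x.
      deriv (\<phi> n) x - h x))\<^sup>2) < \<epsilon>"
    using LIMSEQ_D[of _ 0 \<epsilon>] e by fastforce
  moreover have "H1_norm (\<lambda>x. prim h x - \<phi> n x)
    = sqrt ((L2_norm interval (\<lambda>x. \<phi> n x - prim h x))\<^sup>2 + (L2_norm interval (\<lambda>x. deriv (\<phi> n) x - h x))\<^sup>2)"
    unfolding H1_norm_eq[OF has_weak_deriv_diff[OF w test_function_has_weak_deriv[OF \<phi>]]]
    by (simp add: L2_norm_commute[of _ "prim h"] L2_norm_commute[of _ h])
  ultimately have "H1_norm (\<lambda>x. prim h x - \<phi> n x) < \<epsilon>" by (simp only:)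
  with \<phi>[of n] show "\<exists>\<phi>\<in>test_functions. H1_norm (\<lambda>x. prim h x - \<phi> x) < \<epsilon>" by (intro bexI[where x = "\<phi> n"])
qed

text \<open>Converse of \<open>prim_in_H1_0\<close>: together they describe \<open>H1_0\<close> by
  primitives of mean-zero functions. A test function is exactly the primitive of its derivative on
  [0,1], so \<open>prim_bound\<close> controls both defects by the \<open>H1\<close> distance; at
  \<open>x = 1\<close>, where the test function vanishes, the defect is the mean of
  \<open>h\<close>.\<close>

lemma H1_0_prim:
  assumes g: "g \<in> H1_0" and w: "has_weak_deriv g h"
  shows "integral\<^sup>L interval h = 0" "AE x in interval. g x = prim h x"
proof -
  have L: "g \<in> L2 interval" "h \<in> L2 interval" using w by (auto simp: has_weak_deriv_def)
  have approx: "\<bar>integral\<^sup>L interval h\<bar> \<le> 0 + e \<and> L2_norm interval (\<lambda>x. g x - prim h x) \<le> 0 + e"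
    if e: "e > 0" for e
  proof -
    obtain \<phi> where \<phi>: "\<phi> \<in> test_functions" "H1_norm (\<lambda>x. g x - \<phi> x) < e / 2"
      using g e unfolding H1_0_def by (auto dest!: spec[of _ "e / 2"])
    note \<phi>L = test_function_L2[OF \<phi>(1)]
    have n: "sqrt ((L2_norm interval (\<lambda>x. g x - \<phi> x))\<^sup>2 + (L2_norm interval (\<lambda>x. h x - deriv \<phi> x))\<^sup>2) < e / 2"
      using \<phi>(2) unfolding H1_norm_eq[OF has_weak_deriv_diff[OF w test_function_has_weak_deriv[OF \<phi>(1)]]] .
    have n1: "L2_norm interval (\<lambda>x. g x - \<phi> x) < e / 2"
      using n real_sqrt_sum_squares_ge1 by (rule order.strict_trans1[rotated])
    have n2: "L2_norm interval (\<lambda>x. h x - deriv \<phi> x) < e / 2"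
      using n real_sqrt_sum_squares_ge2 by (rule order.strict_trans1[rotated])
    have p: "\<bar>\<phi> x - prim h x\<bar> \<le> L2_norm interval (\<lambda>x. h x - deriv \<phi> x)" if "x \<in> {0..1}" for x
      using prim_bound[OF L2_diff[OF L(2) \<phi>L(2)], of x] that
      by (simp add: prim_diff[OF L(2) \<phi>L(2)] prim_test_function[OF \<phi>(1)] abs_minus_commute)
    have "\<bar>integral\<^sup>L interval h\<bar> \<le> 0 + e"
      using p[of 1] n2 e test_function_outside[OF \<phi>(1), of 1] by (simp add: prim_one)
    moreover have "L2_norm interval (\<lambda>x. \<phi> x - prim h x) \<le> L2_norm interval (\<lambda>x. h x - deriv \<phi> x)"
      using p L2_measurable[OF \<phi>L(1)] L2_measurable[OF prim_L2[OF L(2)]]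
      by (intro interval.L2_norm_const_bound AE_I2) (auto simp: space_interval)
    then have "L2_norm interval (\<lambda>x. g x - prim h x) \<le> 0 + e"
      using L2_norm_triangle_diff[OF L(1) \<phi>L(1) prim_L2[OF L(2)]] n1 n2 by linarith
    ultimately show ?thesis by blast
  qed
  have "\<bar>integral\<^sup>L interval h\<bar> \<le> 0" by (rule field_le_epsilon) (use approx in blast)
  then show "integral\<^sup>L interval h = 0" by simp
  have "L2_norm interval (\<lambda>x. g x - prim h x) \<le> 0" by (rule field_le_epsilon) (use approx in blast)
  then have "L2_norm interval (\<lambda>x. g x - prim h x) = 0"
    using L2_norm_nonneg[of interval "\<lambda>x. g x - prim h x"] by linarith
  then have "AE x in interval. g x - prim h x = 0"
    by (rule L2_norm_eq_zero[OF L2_diff[OF L(1) prim_L2[OF L(2)]]])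
  then show "AE x in interval. g x = prim h x" by simp
qed

text \<open>For a test function the integrand is the derivative of a third of its cube, which
  vanishes at both ends. In the limit the squares converge uniformly, hence in \<open>L2\<close>,
  against derivatives that converge in \<open>L2\<close>.\<close>

lemma integral_prim_square_deriv:
  assumes h: "h \<in> L2 interval" and zero: "integral\<^sup>L interval h = 0"
  shows "L2_inner interval (\<lambda>x. (prim h x)\<^sup>2) h = 0"
proof -
  obtain \<phi> where \<phi>: "\<And>n. \<phi> n \<in> test_functions" and lim: "(\<lambda>n. L2_norm interval (\<lambda>x. deriv (\<phi> n) x - h x)) \<longlonglongrightarrow> 0"
    and unif: "\<And>n x. x \<in> {0..1} \<Longrightarrow> \<bar>\<phi> n x - prim h x\<bar> \<le> L2_norm interval (\<lambda>x. deriv (\<phi> n) x - h x)"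
    using mean_zero_test_sequence[OF h zero] by blast
  define B where "B = L2_norm interval h"
  define b where "b n = L2_norm interval (\<lambda>x. deriv (\<phi> n) x - h x)" for n
  have sq: "\<bar>(\<phi> n x)\<^sup>2 - (prim h x)\<^sup>2\<bar> \<le> b n * (2 * B + b n)" if x: "x \<in> {0..1}" for n x
  proof -
    have "\<bar>(\<phi> n x)\<^sup>2 - (prim h x)\<^sup>2\<bar> = \<bar>\<phi> n x - prim h x\<bar> * \<bar>\<phi> n x + prim h x\<bar>"
      unfolding abs_mult[symmetric] by (simp add: power2_eq_square algebra_simps)
    also have "\<dots> \<le> b n * (2 * B + b n)"
    proof (rule mult_mono)
      show "\<bar>\<phi> n x - prim h x\<bar> \<le> b n" using unif[OF x] by (simp add: b_def)
      then show "\<bar>\<phi> n x + prim h x\<bar> \<le> 2 * B + b n" using prim_bound[OF h, of x] by (simp add: B_def)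
    qed (auto simp: b_def)
    finally show ?thesis .
  qed
  have "(\<lambda>n. b n * (2 * B + b n)) \<longlonglongrightarrow> 0 * (2 * B + 0)"
    using lim unfolding b_def by (intro tendsto_intros)
  then have blim: "(\<lambda>n. b n * (2 * B + b n)) \<longlonglongrightarrow> 0" by simp
  have \<phi>sq: "(\<lambda>x. (\<phi> n x)\<^sup>2) \<in> L2 interval" for n
    by (intro continuous_L2_interval continuous_intros test_function_continuous \<phi>)
  note [measurable] = L2_measurable[OF h] L2_measurable[OF test_function_L2(1)[OF \<phi>]] L2_measurable[OF
      prim_L2[OF h]]
  have psq: "(\<lambda>x. (prim h x)\<^sup>2) \<in> L2 interval"
  proof (rule interval.L2_bounded[of _ "B\<^sup>2"])
    have "\<bar>prim h x\<bar>\<^sup>2 \<le> B\<^sup>2" for x unfolding B_def by (intro power_mono prim_bound h) auto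
    then show "AE x in interval. \<bar>(prim h x)\<^sup>2\<bar> \<le> B\<^sup>2" by simp
  qed measurable
  have "(\<lambda>n. L2_norm interval (\<lambda>x. (\<phi> n x)\<^sup>2 - (prim h x)\<^sup>2)) \<longlonglongrightarrow> 0"
    by (rule L2_limit_uniform[OF sq blim]) measurable
  then have "(\<lambda>n. L2_inner interval (\<lambda>x. (\<phi> n x)\<^sup>2) (deriv (\<phi> n))) \<longlonglongrightarrow> L2_inner interval (\<lambda>x. (prim h x)\<^sup>2) h"
    by (intro L2_inner_tendsto[OF \<phi>sq psq _ test_function_L2(2)[OF \<phi>] h lim])
  moreover have "L2_inner interval (\<lambda>x. (\<phi> n x)\<^sup>2) (deriv (\<phi> n)) = 0" for n
  proof -
    have "integral\<^sup>L interval (\<lambda>x. (\<phi> n x)\<^sup>2 * deriv (\<phi> n) x) = \<phi> n 1 ^ 3 / 3 - \<phi> n 0 ^ 3 / 3"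
    proof (rule integral_interval_FTC)
      show "((\<lambda>x. \<phi> n x ^ 3 / 3) has_real_derivative (\<phi> n x)\<^sup>2 * deriv (\<phi> n) x) (at x)" for x
        using test_function_DERIV[OF \<phi>, of n x] by (auto intro!: derivative_eq_intros)
      show "continuous_on UNIV (\<lambda>x. (\<phi> n x)\<^sup>2 * deriv (\<phi> n) x)"
        by (intro continuous_intros test_function_continuous test_function_deriv_continuous \<phi>)
    qed
    then show ?thesis using test_function_outside[OF \<phi>] by (simp add: L2_inner_def)
  qed
  ultimately show ?thesis by (simp add: LIMSEQ_const_iff)
qed

text \<open>Agmon's inequality: for test functions it is \<open>\<phi>(x)\<^sup>2 = 2 \<integral>\<^sub>0\<^sup>x \<phi> \<phi>'\<close>.\<close>

lemma prim_square_bound: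
  assumes h: "h \<in> L2 interval" and zero: "integral\<^sup>L interval h = 0" and x: "x \<in> {0..1}"
  shows "(prim h x)\<^sup>2 \<le> 2 * L2_norm interval (prim h) * L2_norm interval h"
proof -
  obtain \<phi> where \<phi>: "\<And>n. \<phi> n \<in> test_functions" and lim: "(\<lambda>n. L2_norm interval (\<lambda>x. deriv (\<phi> n) x - h x)) \<longlonglongrightarrow> 0"
    and unif: "\<And>n x. x \<in> {0..1} \<Longrightarrow> \<bar>\<phi> n x - prim h x\<bar> \<le> L2_norm interval (\<lambda>x. deriv (\<phi> n) x - h x)"
    using mean_zero_test_sequence[OF h zero] by blast
  have le: "(\<phi> n x)\<^sup>2 \<le> 2 * L2_norm interval (\<phi> n) * L2_norm interval (deriv (\<phi> n))" for n
  proof -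
    note \<phi>L = test_function_L2[OF \<phi>[of n]]
    have "prim (\<lambda>x. 2 * \<phi> n x * deriv (\<phi> n) x) x = (\<phi> n x)\<^sup>2 - (\<phi> n 0)\<^sup>2"
    proof (rule prim_FTC)
      show "((\<lambda>x. (\<phi> n x)\<^sup>2) has_real_derivative 2 * \<phi> n x * deriv (\<phi> n) x) (at x)" for x
        using test_function_DERIV[OF \<phi>, of n x] by (auto intro!: derivative_eq_intros)
      show "continuous_on UNIV (\<lambda>x. 2 * \<phi> n x * deriv (\<phi> n) x)"
        by (intro continuous_intros test_function_continuous test_function_deriv_continuous \<phi>)
    qed (use x in auto)
    then have "(\<phi> n x)\<^sup>2 = prim (\<lambda>x. 2 * \<phi> n x * deriv (\<phi> n) x) x"
      using test_function_outside[OF \<phi>, of 0 n] by simp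
    also have "\<dots> = 2 * L2_inner interval (\<phi> n) (\<lambda>y. if y < x then deriv (\<phi> n) y else 0)"
      unfolding prim_def L2_inner_def
      by (subst integral_mult_right_zero[symmetric]) (intro Bochner_Integration.integral_cong; auto)
    also have "\<dots> \<le> 2 * (L2_norm interval (\<phi> n) * L2_norm interval (\<lambda>y. if y < x then deriv (\<phi> n) y else 0))"
      using L2_inner_Cauchy_Schwarz[OF \<phi>L(1) prim_integrand_L2[OF \<phi>L(2), of x]] by linarith
    also have "\<dots> \<le> 2 * (L2_norm interval (\<phi> n) * L2_norm interval (deriv (\<phi> n)))"
      using L2_measurable[OF prim_integrand_L2[OF \<phi>L(2), of x]]
      by (intro mult_left_mono L2_norm_mono_AE \<phi>L AE_I2) auto
    finally show ?thesis by simp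
  qed
  have lim': "(\<lambda>n. L2_norm interval (\<lambda>x. \<phi> n x - prim h x)) \<longlonglongrightarrow> 0"
    using L2_measurable[OF test_function_L2(1)[OF \<phi>]] L2_measurable[OF prim_L2[OF h]]
    by (intro L2_limit_uniform[OF unif lim]) auto
  have norm_lim: "(\<lambda>n. L2_norm interval (f n)) \<longlonglongrightarrow> L2_norm interval g"
    if "\<And>n. f n \<in> L2 interval" "g \<in> L2 interval" "(\<lambda>n. L2_norm interval (\<lambda>x. f n x - g x)) \<longlonglongrightarrow> 0" for f g
    using L2_inner_tendsto[OF that that] unfolding L2_norm_def by (rule tendsto_real_sqrt)
  have "(\<lambda>n. \<phi> n x - prim h x) \<longlonglongrightarrow> 0"
    by (rule Lim_null_comparison[OF always_eventually lim]) (use unif[OF x] in auto)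
  then have "(\<lambda>n. \<phi> n x) \<longlonglongrightarrow> prim h x" by (simp add: LIM_zero_iff)
  then have "(\<lambda>n. (\<phi> n x)\<^sup>2) \<longlonglongrightarrow> (prim h x)\<^sup>2" by (intro tendsto_intros)
  moreover have "(\<lambda>n. 2 * L2_norm interval (\<phi> n) * L2_norm interval (deriv (\<phi> n)))
    \<longlonglongrightarrow> 2 * L2_norm interval (prim h) * L2_norm interval h"
    by (rule tendsto_mult[OF tendsto_mult[OF tendsto_const]]; rule norm_lim;
      (rule lim lim' h prim_L2[OF h] test_function_L2[OF \<phi>]))
  ultimately show ?thesis by (rule LIMSEQ_le) (use le in blast)
qed

section \<open>Derivatives in space and in time\<close>

definition xprim :: "(real \<times> real \<Rightarrow> real) \<Rightarrow> real \<times> real \<Rightarrow> real"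
  where "xprim w z = prim (\<lambda>y. w (fst z, y)) (snd z)"

lemma xprim_measurable:
  assumes w: "w \<in> borel_measurable cylinder"
  shows "xprim w \<in> borel_measurable cylinder"
proof -
  have "(\<lambda>q. (fst (fst q), snd q)) \<in> measurable (cylinder \<Otimes>\<^sub>M interval) cylinder"
    by measurable
  from measurable_compose[OF this w]
  have [measurable]: "(\<lambda>q. w (fst (fst q), snd q)) \<in> borel_measurable (cylinder \<Otimes>\<^sub>M interval)" .
  have [measurable]: "(\<lambda>q. snd (fst q)) \<in> borel_measurable (cylinder \<Otimes>\<^sub>M interval)"
    using measurable_compose[OF measurable_fst measurable_cylinder_snd] by simp
  have [measurable]: "snd \<in> borel_measurable (cylinder \<Otimes>\<^sub>M interval)"
    using measurable_compose[OF measurable_snd measurable_interval_id] by simp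
  have "case_prod (\<lambda>z y. if y < snd z then w (fst z, y) else 0) \<in> borel_measurable (cylinder \<Otimes>\<^sub>M interval)"
    unfolding case_prod_unfold by measurable
  then show ?thesis
    unfolding xprim_def[abs_def] prim_def by (rule interval.borel_measurable_lebesgue_integral)
qed

lemma cylinder_AE_I:
  assumes "{z \<in> space cylinder. P z} \<in> sets cylinder" "AE t in circle. AE x in interval. P (t, x)"
  shows "AE z in cylinder. P z"
  using assms by (rule cylinder.AE_pair_measure)

lemma cylinder_AE_I':
  assumes "{z \<in> space cylinder. P z} \<in> sets cylinder" "AE x in interval. AE t in circle. P (t, x)"
  shows "AE z in cylinder. P z"
proof (rule cylinder_AE_I[OF assms(1)])
  show "AE t in circle. AE x in interval. P (t, x)"
    by (subst cylinder.AE_commute) (use assms in auto)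
qed

lemma L2_norm_slice:
  assumes "w \<in> L2 cylinder"
  shows "(\<lambda>t. L2_norm interval (\<lambda>x. w (t, x))) \<in> L2 circle"
    "L2_norm circle (\<lambda>t. L2_norm interval (\<lambda>x. w (t, x))) = L2_norm cylinder w"
proof -
  note N = L2_norm_cylinder(3,4)[OF assms]
  have eq: "(\<lambda>t. L2_norm interval (\<lambda>x. w (t, x))) = (\<lambda>t. sqrt (LINT x|interval. (w (t, x))\<^sup>2))"
    using L2_norm_square[of interval] by (metis L2_norm_nonneg real_sqrt_abs abs_of_nonneg)
  show "(\<lambda>t. L2_norm interval (\<lambda>x. w (t, x))) \<in> L2 circle"
  proof (rule L2_I)
    show "(\<lambda>t. L2_norm interval (\<lambda>x. w (t, x))) \<in> borel_measurable circle"
      unfolding eq using N(1) by simp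
    show "integrable circle (\<lambda>t. (L2_norm interval (\<lambda>x. w (t, x)))\<^sup>2)"
      unfolding L2_norm_square by (rule N(1))
  qed
  have "(L2_norm circle (\<lambda>t. L2_norm interval (\<lambda>x. w (t, x))))\<^sup>2 = (L2_norm cylinder w)\<^sup>2"
    unfolding N(2) L2_norm_square[of circle] L2_norm_square[of interval] ..
  then show "L2_norm circle (\<lambda>t. L2_norm interval (\<lambda>x. w (t, x))) = L2_norm cylinder w" by simp
qed

lemma xprim_L2:
  assumes w: "w \<in> L2 cylinder"
  shows "xprim w \<in> L2 cylinder" "L2_norm cylinder (xprim w) \<le> L2_norm cylinder w"
proof -
  define g where "g t = L2_norm interval (\<lambda>x. w (t, x))" for t
  have g: "g \<in> L2 circle" "L2_norm circle g = L2_norm cylinder w"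
    using L2_norm_slice[OF w] by (simp_all add: g_def[abs_def])
  note G = L2_cylinder_fst[OF g(1)]
  note m [measurable] = xprim_measurable[OF L2_measurable[OF w]] L2_measurable[OF G(1)]
  have ae: "AE z in cylinder. \<bar>xprim w z\<bar> \<le> \<bar>g (fst z)\<bar>"
  proof (rule cylinder_AE_I)
    show "{z \<in> space cylinder. \<bar>xprim w z\<bar> \<le> \<bar>g (fst z)\<bar>} \<in> sets cylinder" by measurable
    show "AE t in circle. AE x in interval. \<bar>xprim w (t, x)\<bar> \<le> \<bar>g (fst (t, x))\<bar>"
      using L2_slice_AE(2)[OF w] by eventually_elim (auto simp: xprim_def g_def prim_bound)
  qed
  show "xprim w \<in> L2 cylinder" by (rule L2_bound[OF G(1) m(1) ae])
  show "L2_norm cylinder (xprim w) \<le> L2_norm cylinder w"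
    using L2_norm_mono_AE[OF G(1) m(1) ae] G(2) g(2) by simp
qed

lemma has_x_deriv_unique:
  assumes "has_x_deriv u w" "has_x_deriv u w'"
  shows "AE z in cylinder. w z = w' z"
proof (rule cylinder_AE_I)
  have [measurable]: "w \<in> borel_measurable cylinder" "w' \<in> borel_measurable cylinder"
    using assms by (auto simp: has_x_deriv_def dest: L2_measurable)
  show "{z \<in> space cylinder. w z = w' z} \<in> sets cylinder" by measurable
  have "AE t in circle. has_weak_deriv (\<lambda>x. u (t, x)) (\<lambda>x. w (t, x))"
    "AE t in circle. has_weak_deriv (\<lambda>x. u (t, x)) (\<lambda>x. w' (t, x))"
    using assms by (auto simp: has_x_deriv_def)
  then show "AE t in circle. AE x in interval. w (t, x) = w' (t, x)"
    by eventually_elim (rule weak_deriv_unique)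
qed

lemma has_x_deriv_x_deriv: "has_x_deriv u w \<Longrightarrow> has_x_deriv u (x_deriv u)"
  unfolding x_deriv_def by (rule someI[of "has_x_deriv u"])

lemma L2_H1_0_slices:
  assumes u: "u \<in> L2_H1_0"
  shows "u \<in> L2 cylinder" "x_deriv u \<in> L2 cylinder"
    "AE t in circle. (\<lambda>x. x_deriv u (t, x)) \<in> L2 interval \<and> (LINT x|interval. x_deriv u (t, x)) = 0 \<and>
      (AE x in interval. u (t, x) = xprim (x_deriv u) (t, x))"
proof -
  have h: "has_x_deriv u (x_deriv u)" using u has_x_deriv_x_deriv by (auto simp: L2_H1_0_def)
  then show "u \<in> L2 cylinder" "x_deriv u \<in> L2 cylinder" by (auto simp: has_x_deriv_def)
  have "AE t in circle. has_weak_deriv (\<lambda>x. u (t, x)) (\<lambda>x. x_deriv u (t, x))"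
    "AE t in circle. (\<lambda>x. u (t, x)) \<in> H1_0"
    using h u by (auto simp: has_x_deriv_def L2_H1_0_def)
  then show "AE t in circle. (\<lambda>x. x_deriv u (t, x)) \<in> L2 interval \<and> (LINT x|interval. x_deriv u (t, x)) = 0 \<and>
      (AE x in interval. u (t, x) = xprim (x_deriv u) (t, x))"
  proof eventually_elim
    case (elim t)
    then show ?case
      using H1_0_prim[OF elim(2,1)] by (auto simp: has_weak_deriv_def xprim_def)
  qed
qed

lemma L2_H1_0_xprim:
  assumes u: "u \<in> L2_H1_0"
  shows "AE z in cylinder. u z = xprim (x_deriv u) z"
proof (rule cylinder_AE_I)
  note [measurable] = L2_measurable[OF L2_H1_0_slices(1)[OF u]]
    xprim_measurable[OF L2_measurable[OF L2_H1_0_slices(2)[OF u]]]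
  show "{z \<in> space cylinder. u z = xprim (x_deriv u) z} \<in> sets cylinder" by measurable
  show "AE t in circle. AE x in interval. u (t, x) = xprim (x_deriv u) (t, x)"
    using L2_H1_0_slices(3)[OF u] by eventually_elim simp
qed

text \<open>The function is almost everywhere the primitive of its \<open>x\<close>-derivative, and
  primitives contract on an interval of length 1; hence the constant 1.\<close>

lemma L2_H1_0_Poincare:
  assumes u: "u \<in> L2_H1_0"
  shows "L2_norm cylinder u \<le> L2_norm cylinder (x_deriv u)"
proof -
  note L = L2_H1_0_slices[OF u]
  have "L2_norm cylinder u = L2_norm cylinder (xprim (x_deriv u))"
    using L2_H1_0_xprim[OF u] xprim_L2[OF L(2)] L by (intro L2_norm_cong_AE) (auto intro: L2_measurable)
  then show ?thesis using xprim_L2(2)[OF L(2)] by simp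
qed

text \<open>The way to build an element of \<open>L2_H1_0\<close>: prescribe its
  \<open>x\<close>-derivative and integrate. The condition on the slice means is the boundary
  condition at \<open>x = 1\<close>.\<close>

lemma xprim_in_L2_H1_0:
  assumes w: "w \<in> L2 cylinder" and zero: "AE t in circle. (LINT x|interval. w (t, x)) = 0"
  shows "xprim w \<in> L2_H1_0" "AE z in cylinder. x_deriv (xprim w) z = w z"
proof -
  have "AE t in circle. has_weak_deriv (\<lambda>x. xprim w (t, x)) (\<lambda>x. w (t, x)) \<and> (\<lambda>x. xprim w (t, x)) \<in> H1_0"
    using zero L2_slice_AE(2)[OF w]
  proof eventually_elim
    case (elim t)
    have "(\<lambda>x. xprim w (t, x)) = prim (\<lambda>x. w (t, x))" by (auto simp: xprim_def)
    then show ?case using prim_has_weak_deriv[OF elim(2,1)] prim_in_H1_0[OF elim(2,1)] by simp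
  qed
  then have h: "has_x_deriv (xprim w) w" and h0: "AE t in circle. (\<lambda>x. xprim w (t, x)) \<in> H1_0"
    using w xprim_L2(1)[OF w] by (auto simp: has_x_deriv_def)
  then show "xprim w \<in> L2_H1_0" by (auto simp: L2_H1_0_def)
  show "AE z in cylinder. x_deriv (xprim w) z = w z"
    using has_x_deriv_unique[OF has_x_deriv_x_deriv[OF h] h] .
qed

section \<open>Time coefficients against primitives and means in space\<close>

lemma integrable_time_coeff_integrand:
  fixes F :: "real \<times> real \<Rightarrow> real"
  assumes "F \<in> L2 cylinder"
  shows "integrable cylinder (\<lambda>(t, x). of_real (F (t, x)) * cis (- (2 * pi * of_int k * t)))"
proof -
  have "integrable cylinder (\<lambda>z. of_real (F z) * cis (- (2 * pi * of_int k * fst z)))"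
    using cylinder.L2_integrable[OF assms] by (intro integrable_mult_cis) auto
  then show ?thesis by (simp add: case_prod_unfold)
qed

lemma integral_time_coeff:
  assumes F: "F \<in> L2 cylinder"
  shows "(LINT x|interval. time_coeff F k x) = circle_coeff (\<lambda>t. LINT x|interval. F (t, x)) k"
    "integrable circle (\<lambda>t. LINT x|interval. F (t, x))"
proof -
  have "(LINT x|interval. time_coeff F k x)
    = (LINT t|circle. LINT x|interval. of_real (F (t, x)) * cis (- (2 * pi * of_int k * t)))"
    unfolding time_coeff_def by (rule cylinder.Fubini_integral[OF integrable_time_coeff_integrand[OF F]])
  also have "\<dots> = circle_coeff (\<lambda>t. LINT x|interval. F (t, x)) k"
    unfolding circle_coeff_def by (simp add: integral_complex_of_real)
  finally show "(LINT x|interval. time_coeff F k x) = circle_coeff (\<lambda>t. LINT x|interval. F (t, x)) k" .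
  show "integrable circle (\<lambda>t. LINT x|interval. F (t, x))"
    using cylinder.integrable_fst[of "\<lambda>t x. F (t, x)"] cylinder.L2_integrable[OF F] by simp
qed

text \<open>Fubini for \<open>w\<close> cut off at a fixed \<open>x\<close>. The cut-off function is
  in \<open>L2 cylinder\<close> whatever \<open>x\<close> is, so the identity holds for every
  \<open>x\<close> and not merely almost everywhere.\<close>

lemma time_coeff_xprim:
  assumes w: "w \<in> L2 cylinder"
  shows "time_coeff (xprim w) k x = (LINT y|interval. (if y < x then time_coeff w k y else 0))"
proof -
  define F where "F z = (if snd z < x then w z else 0)" for z
  note [measurable] = L2_measurable[OF w]
  have F: "F \<in> L2 cylinder"
  proof (rule L2_bound[OF w])
    show "F \<in> borel_measurable cylinder" unfolding F_def by measurable
  qed (auto simp: F_def)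
  have "time_coeff (xprim w) k x = circle_coeff (\<lambda>t. LINT y|interval. F (t, y)) k"
    by (simp add: time_coeff_eq xprim_def prim_def F_def)
  also have "\<dots> = (LINT y|interval. time_coeff F k y)" by (rule integral_time_coeff(1)[OF F, symmetric])
  also have "\<dots> = (LINT y|interval. (if y < x then time_coeff w k y else 0))"
    by (intro Bochner_Integration.integral_cong) (auto simp: time_coeff_def F_def)
  finally show ?thesis .
qed

text \<open>By Fubini the spatial means of the time coefficients are the Fourier coefficients of the
  slice means, and uniqueness on the circle gives the converse. The boundary condition thus becomes
  one linear condition per frequency, which a multiplier preserves.\<close>

lemma mean_zero_iff_time_coeff:
  assumes w: "w \<in> L2 cylinder"
  shows "(AE t in circle. (LINT x|interval. w (t, x)) = 0) \<longleftrightarrow> (\<forall>k. (LINT x|interval. time_coeff w k x) = 0)"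
proof
  assume ae: "AE t in circle. (LINT x|interval. w (t, x)) = 0"
  show "\<forall>k. (LINT x|interval. time_coeff w k x) = 0"
  proof
    fix k
    have "circle_coeff (\<lambda>t. LINT x|interval. w (t, x)) k = circle_coeff (\<lambda>t. 0) k"
      using ae integral_time_coeff(2)[OF w] by (intro circle_coeff_cong_AE) auto
    then show "(LINT x|interval. time_coeff w k x) = 0"
      unfolding integral_time_coeff(1)[OF w] by (simp add: circle_coeff_def)
  qed
next
  assume "\<forall>k. (LINT x|interval. time_coeff w k x) = 0"
  then show "AE t in circle. (LINT x|interval. w (t, x)) = 0"
    using integral_time_coeff[OF w] by (intro circle_coeff_unique_zero) auto
qed

lemma time_coeff_cong_AE:
  assumes "u \<in> borel_measurable cylinder" "v \<in> borel_measurable cylinder" "AE z in cylinder. u z = v z"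
  shows "AE x in interval. \<forall>k. time_coeff u k x = time_coeff v k x"
proof -
  note [measurable] = assms(1,2)
  have "AE t in circle. AE x in interval. u (t, x) = v (t, x)"
    by (rule cylinder.AE_pair[OF assms(3)])
  then have "AE x in interval. AE t in circle. u (t, x) = v (t, x)"
    by (subst (asm) cylinder.AE_commute) measurable
  then show ?thesis using AE_space
  proof eventually_elim
    case (elim x)
    then show ?case unfolding time_coeff_eq by (auto intro!: circle_coeff_cong_AE)
  qed
qed

lemma time_coeff_L2_H1_0:
  assumes u: "u \<in> L2_H1_0"
  shows "AE x in interval. \<forall>k. time_coeff u k x = (LINT y|interval. (if y < x then time_coeff (x_deriv
      u) k y else 0))"
    "(LINT x|interval. time_coeff (x_deriv u) k x) = 0"
proof -
  note L = L2_H1_0_slices[OF u]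
  show "AE x in interval. \<forall>k. time_coeff u k x = (LINT y|interval. (if y < x then time_coeff (x_deriv
      u) k y else 0))"
    using time_coeff_cong_AE[OF L2_measurable[OF L(1)] xprim_measurable[OF L2_measurable[OF L(2)]]
        L2_H1_0_xprim[OF u]]
    unfolding time_coeff_xprim[OF L(2)] .
  have "AE t in circle. (LINT x|interval. x_deriv u (t, x)) = 0"
    using L(3) by eventually_elim simp
  then show "(LINT x|interval. time_coeff (x_deriv u) k x) = 0"
    using mean_zero_iff_time_coeff[OF L(2)] by blast
qed

lemma L2_inner_square_x_deriv:
  assumes u: "u \<in> L2_H1_0"
  shows "L2_inner cylinder (\<lambda>z. (u z)\<^sup>2) (x_deriv u) = 0"
\<comment> \<open>The bound that would give integrability comes only later. It is bypassed: a
  nonintegrable function has Bochner integral 0, which is the claimed value.\<close>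
proof (cases "integrable cylinder (\<lambda>z. (u z)\<^sup>2 * x_deriv u z)")
  case True
  note L = L2_H1_0_slices[OF u]
  have "L2_inner cylinder (\<lambda>z. (u z)\<^sup>2) (x_deriv u) = (LINT t|circle. LINT x|interval. (u (t, x))\<^sup>2 *
      x_deriv u (t, x))"
    unfolding L2_inner_def using cylinder.integral_fst'[OF True] by simp
  also have "\<dots> = (LINT t|circle. 0)"
  proof (rule integral_cong_AE)
    show "(\<lambda>t. LINT x|interval. (u (t, x))\<^sup>2 * x_deriv u (t, x)) \<in> borel_measurable circle"
      using cylinder.integrable_fst'[OF True] by simp
    show "AE t in circle. (LINT x|interval. (u (t, x))\<^sup>2 * x_deriv u (t, x)) = 0"
      using L(3) L2_slice_AE(2)[OF L(1)] AE_space
    proof eventually_elim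
      case (elim t)
      then have h: "(\<lambda>x. x_deriv u (t, x)) \<in> L2 interval" "(LINT x|interval. x_deriv u (t, x)) = 0"
        "AE x in interval. u (t, x) = prim (\<lambda>x. x_deriv u (t, x)) x"
        by (auto simp: xprim_def)
      note [measurable] = L2_measurable[OF h(1)] L2_measurable[OF elim(2)]
      have "(LINT x|interval. (u (t, x))\<^sup>2 * x_deriv u (t, x))
        = L2_inner interval (\<lambda>x. (prim (\<lambda>x. x_deriv u (t, x)) x)\<^sup>2) (\<lambda>x. x_deriv u (t, x))"
        unfolding L2_inner_def using h(3) by (intro integral_cong_AE) (auto elim!: eventually_mono)
      then show ?case using integral_prim_square_deriv[OF h(1,2)] by simp
    qed
  qed simp
  finally show ?thesis by simp
next
  case False
  then show ?thesis by (simp add: L2_inner_def not_integrable_integral_eq)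
qed

text \<open>The symbol of D^(1/2), with \<open>s = 1/2\<close> left unsimplified so that it matches
  the unfolded \<open>frac_deriv\<close>. Its conjugate is the symbol of
  \<open>frac_deriv_adj (1/2)\<close>.\<close>

definition half_symbol :: "int \<Rightarrow> complex"
  where "half_symbol k = of_real (\<bar>2 * pi * of_int k\<bar> powr (1/2)) * cis (of_int (sgn k) * (1/2) * pi / 2)"

lemma half_symbol_uminus: "half_symbol (- k) = cnj (half_symbol k)"
  by (simp add: half_symbol_def cis_cnj sgn_minus)

lemma cmod_half_symbol: "(cmod (half_symbol k))\<^sup>2 = 2 * pi * \<bar>of_int k\<bar>"
  by (simp add: half_symbol_def norm_mult powr_half_sqrt abs_mult)

text \<open>This is 2 pi i k, the symbol of d/dt. Being imaginary, it makes the pairing of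
  \<open>u\<close> with itself vanish; the factor \<open>\<i> * of_int (sgn k)\<close> is kept apart
  because it is the symbol of the Hilbert transform.\<close>

lemma half_symbol_square: "half_symbol k * half_symbol k = \<i> * of_int (sgn k) * of_real (2 * pi * \<bar>of_int k\<bar>)"
proof -
  have "half_symbol k * half_symbol k = of_real (\<bar>2 * pi * of_int k\<bar> powr (1/2) * \<bar>2 * pi * of_int k\<bar>
      powr (1/2))
    * (cis (of_int (sgn k) * (1/2) * pi / 2) * cis (of_int (sgn k) * (1/2) * pi / 2))"
    by (simp add: half_symbol_def)
  also have "\<bar>2 * pi * of_int k\<bar> powr (1/2) * \<bar>2 * pi * of_int k\<bar> powr (1/2) = 2 * pi * \<bar>of_int k :: real\<bar>"
    by (simp add: powr_half_sqrt abs_mult)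
  also have "cis (of_int (sgn k) * (1/2) * pi / 2) * cis (of_int (sgn k) * (1/2) * pi / 2) = cis
      (of_int (sgn k) * (pi / 2))"
    unfolding cis_mult by (rule arg_cong[where f = cis]) (simp add: field_simps)
  finally show ?thesis by (cases "k = 0"; cases "k > 0") (auto simp: sgn_if)
qed

lemma H_time_half_summable:
  assumes "u \<in> H_time (1/2)"
  shows "(\<lambda>k::int. (cmod (half_symbol k))\<^sup>2 * time_energy u k) summable_on UNIV"
proof (rule summable_on_comparison_test)
  show "(\<lambda>k::int. 2 * pi * ((1 + (of_int k)\<^sup>2) powr (1/2) * time_energy u k)) summable_on UNIV"
    using assms by (intro summable_on_cmult_right) (simp add: H_time_def)
  fix k :: int
  have "\<bar>real_of_int k\<bar> \<le> (1 + (of_int k)\<^sup>2) powr (1/2)"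
    by (simp add: powr_half_sqrt real_le_rsqrt)
  then have "2 * pi * \<bar>real_of_int k\<bar> * time_energy u k
    \<le> 2 * pi * (1 + (of_int k)\<^sup>2) powr (1/2) * time_energy u k"
    by (intro mult_right_mono) auto
  then show "(cmod (half_symbol k))\<^sup>2 * time_energy u k
    \<le> 2 * pi * ((1 + (of_int k)\<^sup>2) powr (1/2) * time_energy u k)"
    unfolding cmod_half_symbol by (simp add: mult.assoc)
qed simp

lemma frac_deriv_half:
  assumes u: "u \<in> H_time (1/2)"
  shows "is_time_multiplier half_symbol u (frac_deriv (1/2) u)"
    "is_time_multiplier (\<lambda>k. cnj (half_symbol k)) u (frac_deriv_adj (1/2) u)"
proof -
  have uL: "u \<in> L2 cylinder" using u by (simp add: H_time_def)
  have "\<exists>w. is_time_multiplier half_symbol u w"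
    by (rule time_multiplier_exists[OF uL half_symbol_uminus H_time_half_summable[OF u]])
  then show "is_time_multiplier half_symbol u (frac_deriv (1/2) u)"
    unfolding frac_deriv_def half_symbol_def[abs_def] by (rule someI_ex)
  have "\<exists>w. is_time_multiplier (\<lambda>k. cnj (half_symbol k)) u w"
    using H_time_half_summable[OF u] by (intro time_multiplier_exists[OF uL]) (auto simp: half_symbol_uminus)
  moreover have "(\<lambda>k. cnj (half_symbol k)) = (\<lambda>k. of_real (\<bar>2 * pi * of_int k\<bar> powr (1/2)) * cis (-
      (of_int (sgn k) * (1/2) * pi / 2)))"
    by (simp add: half_symbol_def cis_cnj)
  ultimately show "is_time_multiplier (\<lambda>k. cnj (half_symbol k)) u (frac_deriv_adj (1/2) u)"
    unfolding frac_deriv_adj_def by (simp add: someI_ex)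
qed

text \<open>Parseval for multiplier images of a single function: \<open>v\<close> is itself the
  image of \<open>u\<close> under \<open>h\<close>, so each pairing is a weighted sum of the
  energies of \<open>u\<close>. Different symbols give the vanishing of the time term, the
  orthogonality and the norm bound of the Hilbert transform, and the identity for E^2.\<close>

lemma L2_inner_time_multiplier:
  assumes u: "u \<in> L2 cylinder" "v \<in> L2 cylinder" and w: "is_time_multiplier m u w" "is_time_multiplier n v z"
    and rel: "\<And>k. AE x in interval. time_coeff v k x = h k * time_coeff u k x"
  shows "((\<lambda>k. Re (m k * cnj (n k * h k)) * time_energy u k) has_sum L2_inner cylinder w z) UNIV"
proof -
  have L: "w \<in> L2 cylinder" "z \<in> L2 cylinder" using w by (auto simp: is_time_multiplier_def)
  note [measurable] = L2_measurable[OF L(1)] L2_measurable[OF L(2)] L2_measurable[OF u(1)]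
  have "(LINT x|interval. Re (time_coeff w k x * cnj (time_coeff z k x)))
    = Re (m k * cnj (n k * h k)) * time_energy u k" for k
  proof -
    have ae: "AE x in interval. time_coeff w k x = m k * time_coeff u k x"
      "AE x in interval. time_coeff z k x = n k * time_coeff v k x"
      using w by (auto simp: is_time_multiplier_def)
    have "(LINT x|interval. Re (time_coeff w k x * cnj (time_coeff z k x)))
      = (LINT x|interval. Re (m k * cnj (n k * h k)) * (cmod (time_coeff u k x))\<^sup>2)"
    proof (rule integral_cong_AE)
      show "AE x in interval. Re (time_coeff w k x * cnj (time_coeff z k x))
        = Re (m k * cnj (n k * h k)) * (cmod (time_coeff u k x))\<^sup>2"
        using ae rel[of k]
      proof eventually_elim
        case (elim x)
        have "time_coeff w k x * cnj (time_coeff z k x)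
          = (m k * cnj (n k * h k)) * (time_coeff u k x * cnj (time_coeff u k x))"
          unfolding elim by (simp add: mult_ac)
        also have "time_coeff u k x * cnj (time_coeff u k x) = of_real ((cmod (time_coeff u k x))\<^sup>2)"
          by (simp add: complex_norm_square del: of_real_power)
        finally show ?case by (simp del: of_real_power complex_cnj_mult)
      qed
    qed measurable
    then show ?thesis by simp
  qed
  then show ?thesis using Parseval_inner[OF L] by simp
qed

section \<open>The quartic estimate\<close>

lemma powr_neg_three_halves: "0 < a \<Longrightarrow> a powr (-3/2) = 1 / (sqrt a * a)" for a :: real
proof -
  assume a: "0 < a"
  have "a powr (-3/2) = 1 / a powr (1/2 + 1)" using powr_minus_divide[of a "3/2"] by simp
  also have "a powr (1/2 + 1) = sqrt a * a" using a unfolding powr_add by (simp add: powr_half_sqrt)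
  finally show ?thesis .
qed

text \<open>Replacing the larger of the two weights by the smaller leaves one of the two summands.
  The exponent 1/2 + 1 exceeds 1, so each summand is summable over the integers.\<close>

lemma weight_product_le:
  fixes a c :: real
  assumes "a \<ge> 1" "c \<ge> 1"
  shows "1 / (sqrt a * c) \<le> a powr (-3/2) + c powr (-3/2)"
proof (cases "a \<le> c")
  case True
  then have "1 / (sqrt a * c) \<le> 1 / (sqrt a * a)"
    using assms by (intro divide_left_mono mult_left_mono mult_pos_pos) auto
  then show ?thesis using assms powr_neg_three_halves[of a] by (simp add: add_increasing2)
next
  case False
  then have "1 / (sqrt a * c) \<le> 1 / (sqrt c * c)"
    using assms by (intro divide_left_mono mult_right_mono mult_pos_pos) auto
  then show ?thesis using assms powr_neg_three_halves[of c] by (simp add: add_increasing)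
qed

lemma weight_sum_bounded:
  "\<exists>S\<ge>0. \<forall>F::int set. finite F \<longrightarrow> (\<Sum>k\<in>F. (1 + \<bar>real_of_int k\<bar>) powr (-3/2)) \<le> S"
proof -
  define f where "f n = real (Suc n) powr (-3/2)" for n
  have "summable (\<lambda>n. real n powr (-3/2))" by (subst summable_real_powr_iff) simp
  then have f: "summable f" unfolding f_def by (subst summable_Suc_iff)
  have half: "(\<Sum>k\<in>A. f (nat \<bar>k\<bar>)) \<le> suminf f" if "finite A" "inj_on (\<lambda>k. nat \<bar>k\<bar>) A" for A :: "int set"
  proof -
    have "(\<Sum>k\<in>A. f (nat \<bar>k\<bar>)) = sum f ((\<lambda>k. nat \<bar>k\<bar>) ` A)"
      using that by (simp add: sum.reindex)
    also have "\<dots> \<le> suminf f" using that by (intro sum_le_suminf f) (auto simp: f_def)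
    finally show ?thesis .
  qed
  have "(\<Sum>k\<in>F. (1 + \<bar>real_of_int k\<bar>) powr (-3/2)) \<le> 2 * suminf f" if "finite F" for F :: "int set"
  proof -
    have "(\<Sum>k\<in>F. (1 + \<bar>real_of_int k\<bar>) powr (-3/2)) = (\<Sum>k\<in>F. f (nat \<bar>k\<bar>))"
      by (simp add: f_def)
    also have "\<dots> = (\<Sum>k\<in>F \<inter> {0..}. f (nat \<bar>k\<bar>)) + (\<Sum>k\<in>F \<inter> {..<0}. f (nat \<bar>k\<bar>))"
      using that by (subst sum.union_disjoint[symmetric]) (auto intro!: sum.cong)
    also have "\<dots> \<le> suminf f + suminf f"
      using that by (intro add_mono half) (auto simp: inj_on_def)
    finally show ?thesis by simp
  qed
  moreover have "0 \<le> 2 * suminf f" using f by (simp add: suminf_nonneg f_def)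
  ultimately show ?thesis by blast
qed

text \<open>The substitution m = l + j in a convolution. \<open>M\<close> may be any finite set
  containing the shifted indices, so one \<open>M\<close> serves all \<open>j\<close>.\<close>

lemma sum_shift_if:
  fixes K M :: "int set"
  assumes "finite M" "(\<lambda>l. l + j) ` K \<subseteq> M"
  shows "(\<Sum>m\<in>M. if m - j \<in> K then G m else 0) = (\<Sum>l\<in>K. G (l + j))"
proof -
  have "(\<Sum>m\<in>M. if m - j \<in> K then G m else 0) = (\<Sum>m\<in>(\<lambda>l. l + j) ` K. G m)"
  proof (rule sum.mono_neutral_cong_right[OF assms])
    show "\<forall>m\<in>M - (\<lambda>l. l + j) ` K. (if m - j \<in> K then G m else 0) = 0"
      by (auto simp: image_iff) (metis add.commute add_diff_cancel diff_add_cancel)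
  qed auto
  also have "\<dots> = (\<Sum>l\<in>K. G (l + j))" by (subst sum.reindex) (auto simp: inj_on_def)
  finally show ?thesis .
qed

text \<open>
  The coefficients of the square of the trigonometric polynomial are convolutions; the weights
  \<open>(1 + \<bar>j\<bar>)\<^sup>1\<^sup>/\<^sup>2\<close> and \<open>1 + \<bar>l\<bar>\<close> on the two factors make the Cauchy--Schwarz constant
  \<open>\<Sum>\<^sub>j (1 + \<bar>j\<bar>)\<^sup>-\<^sup>1\<^sup>/\<^sup>2 (1 + \<bar>m - j\<bar>)\<^sup>-\<^sup>1\<close> bounded uniformly in \<open>m\<close>.
\<close>

lemma integral_wave_sum_fourth:
  fixes d :: "int \<Rightarrow> complex"
  assumes S: "\<And>F::int set. finite F \<Longrightarrow> (\<Sum>k\<in>F. (1 + \<bar>real_of_int k\<bar>) powr (-3/2)) \<le> S"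
    and K: "K = {- int N..int N}"
  shows "(LINT t|circle. (cmod (\<Sum>k\<in>K. d k * wave k t)) ^ 4)
    \<le> 2 * S * (\<Sum>k\<in>K. sqrt (1 + \<bar>real_of_int k\<bar>) * (cmod (d k))\<^sup>2) * (\<Sum>k\<in>K. (1 + \<bar>real_of_int k\<bar>) *
        (cmod (d k))\<^sup>2)"
proof -
  define b where "b k = 1 + \<bar>real_of_int k\<bar>" for k
  have b: "b k \<ge> 1" for k by (simp add: b_def)
  \<comment> \<open>Squaring a polynomial with frequencies up to \<open>N\<close> doubles the
    range.\<close>
  define M where "M = {- (2 * int N)..2 * int N}"
  have sub: "(\<lambda>l. l + j) ` K \<subseteq> M" if "j \<in> K" for j using that by (auto simp: K M_def)
  have fin: "finite K" "finite M" by (auto simp: K M_def)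
  define D where "D m = (\<Sum>j\<in>K. if m - j \<in> K then d j * d (m - j) else 0)" for m
  have square: "(\<Sum>k\<in>K. d k * wave k t)\<^sup>2 = (\<Sum>m\<in>M. D m * wave m t)" for t
  proof -
    have "(\<Sum>m\<in>M. D m * wave m t) = (\<Sum>m\<in>M. \<Sum>j\<in>K. if m - j \<in> K then d j * d (m - j) * wave m t else 0)"
      unfolding D_def sum_distrib_right by (intro sum.cong) auto
    also have "\<dots> = (\<Sum>j\<in>K. \<Sum>m\<in>M. if m - j \<in> K then d j * d (m - j) * wave m t else 0)"
      by (rule sum.swap)
    also have "\<dots> = (\<Sum>j\<in>K. \<Sum>l\<in>K. d j * d l * wave (l + j) t)"
    proof (rule sum.cong[OF refl])
      fix j assume "j \<in> K"
      then show "(\<Sum>m\<in>M. if m - j \<in> K then d j * d (m - j) * wave m t else 0) = (\<Sum>l\<in>K. d j * d l * wave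
          (l + j) t)"
        using sum_shift_if[OF fin(2) sub, of j "\<lambda>m. d j * d (m - j) * wave m t"] by simp
    qed
    also have "\<dots> = (\<Sum>j\<in>K. \<Sum>l\<in>K. (d j * wave j t) * (d l * wave l t))"
      by (intro sum.cong refl) (simp add: wave_mult[symmetric] mult_ac)
    also have "\<dots> = (\<Sum>k\<in>K. d k * wave k t)\<^sup>2" by (simp add: power2_eq_square sum_product)
    finally show ?thesis ..
  qed
  have fourth: "(cmod (\<Sum>k\<in>K. d k * wave k t)) ^ 4 = (cmod (\<Sum>m\<in>M. D m * wave m t))\<^sup>2" for t
    unfolding square[symmetric] by (simp add: norm_power)
  define q where "q m j = (if m - j \<in> K then (sqrt (b j) * (cmod (d j))\<^sup>2) * (b (m - j) * (cmod (d (m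
      - j)))\<^sup>2) else 0)" for m j
  have q: "q m j \<ge> 0" for m j using b[of j] b[of "m - j"] by (simp add: q_def)
  have D_le: "(cmod (D m))\<^sup>2 \<le> 2 * S * (\<Sum>j\<in>K. q m j)" for m
  proof -
    \<comment> \<open>The reciprocal of the weights in \<open>q\<close>: for
      \<open>m - j \<in> K\<close> the product \<open>p j * q m j\<close> is the squared modulus of
      one term of the convolution.\<close>
    define p where "p j = 1 / (sqrt (b j) * b (m - j))" for j
    have p: "p j \<ge> 0" for j using b[of j] b[of "m - j"] by (simp add: p_def)
    have "cmod (D m) \<le> (\<Sum>j\<in>K. sqrt (p j) * sqrt (q m j))"
      unfolding D_def
    proof (rule sum_norm_le)
      fix j
      have "p j * q m j = (cmod (d j) * cmod (d (m - j)))\<^sup>2" if "m - j \<in> K"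
        using b[of j] b[of "m - j"] that by (simp add: p_def q_def power_mult_distrib)
      then have "sqrt (p j) * sqrt (q m j) = cmod (d j) * cmod (d (m - j))" if "m - j \<in> K"
        using that by (simp flip: real_sqrt_mult)
      then show "cmod (if m - j \<in> K then d j * d (m - j) else 0) \<le> sqrt (p j) * sqrt (q m j)"
        using p[of j] q[of m j] by (simp add: norm_mult)
    qed
    then have "(cmod (D m))\<^sup>2 \<le> (\<Sum>j\<in>K. sqrt (p j) * sqrt (q m j))\<^sup>2" by (intro power_mono) auto
    also have "\<dots> \<le> (\<Sum>j\<in>K. (sqrt (p j))\<^sup>2) * (\<Sum>j\<in>K. (sqrt (q m j))\<^sup>2)" by (rule Cauchy_Schwarz_ineq_sum)
    also have "\<dots> = (\<Sum>j\<in>K. p j) * (\<Sum>j\<in>K. q m j)" using p q by simp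
    also have "\<dots> \<le> (2 * S) * (\<Sum>j\<in>K. q m j)"
    proof (rule mult_right_mono)
      \<comment> \<open>The reflection \<open>j \<mapsto> m - j\<close> is injective, so both
        resulting sums run over finite sets of integers and are at most \<open>S\<close>, whatever
        \<open>m\<close> is.\<close>
      have "(\<Sum>j\<in>K. p j) \<le> (\<Sum>j\<in>K. b j powr (-3/2) + b (m - j) powr (-3/2))"
        unfolding p_def by (intro sum_mono weight_product_le b)
      also have "\<dots> = (\<Sum>j\<in>K. b j powr (-3/2)) + (\<Sum>i\<in>(\<lambda>j. m - j) ` K. b i powr (-3/2))"
        by (subst sum.reindex) (auto simp: inj_on_def sum.distrib)
      also have "\<dots> \<le> S + S" unfolding b_def using fin by (intro add_mono S) auto
      finally show "(\<Sum>j\<in>K. p j) \<le> 2 * S" by simp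
    qed (use q in \<open>auto intro: sum_nonneg\<close>)
    finally show ?thesis .
  qed
  have "(LINT t|circle. (cmod (\<Sum>k\<in>K. d k * wave k t)) ^ 4) = (\<Sum>m\<in>M. (cmod (D m))\<^sup>2)"
    unfolding fourth by (rule integral_norm_wave_sum_square(2)[OF fin(2)])
  also have "\<dots> \<le> (\<Sum>m\<in>M. 2 * S * (\<Sum>j\<in>K. q m j))" by (intro sum_mono D_le)
  also have "\<dots> = 2 * S * (\<Sum>j\<in>K. \<Sum>m\<in>M. q m j)"
    unfolding sum_distrib_left[symmetric] by (subst sum.swap) simp
  also have "(\<Sum>j\<in>K. \<Sum>m\<in>M. q m j)
    = (\<Sum>j\<in>K. \<Sum>l\<in>K. (sqrt (b j) * (cmod (d j))\<^sup>2) * (b l * (cmod (d l))\<^sup>2))"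
  proof (rule sum.cong[OF refl])
    fix j assume "j \<in> K"
    then show "(\<Sum>m\<in>M. q m j) = (\<Sum>l\<in>K. (sqrt (b j) * (cmod (d j))\<^sup>2) * (b l * (cmod (d l))\<^sup>2))"
      unfolding q_def
      using sum_shift_if[OF fin(2) sub, of j "\<lambda>m. (sqrt (b j) * (cmod (d j))\<^sup>2) * (b (m - j) * (cmod
          (d (m - j)))\<^sup>2)"] by simp
  qed
  also have "\<dots> = (\<Sum>k\<in>K. sqrt (b k) * (cmod (d k))\<^sup>2) * (\<Sum>k\<in>K. b k * (cmod (d k))\<^sup>2)"
    by (simp add: sum_product)
  finally show ?thesis by (simp add: b_def mult.assoc)
qed

section \<open>From coefficient bounds to the square of \<open>u\<close>\<close>

lemma L2_Re_Im:
  fixes c :: "real \<Rightarrow> complex"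
  assumes [measurable]: "c \<in> borel_measurable interval" and int: "integrable interval (\<lambda>x. (cmod (c x))\<^sup>2)"
  shows "(\<lambda>x. Re (c x)) \<in> L2 interval" "(\<lambda>x. Im (c x)) \<in> L2 interval" "integrable interval c"
    "L2_norm interval (\<lambda>x. Re (c x)) \<le> sqrt (LINT x|interval. (cmod (c x))\<^sup>2)"
    "L2_norm interval (\<lambda>x. Im (c x)) \<le> sqrt (LINT x|interval. (cmod (c x))\<^sup>2)"
proof -
  have n: "(\<lambda>x. cmod (c x)) \<in> L2 interval" using int by (intro L2_I) auto
  have eq: "L2_norm interval (\<lambda>x. cmod (c x)) = sqrt (LINT x|interval. (cmod (c x))\<^sup>2)"
    by (simp add: L2_norm_def L2_inner_def power2_eq_square)
  show "(\<lambda>x. Re (c x)) \<in> L2 interval" "(\<lambda>x. Im (c x)) \<in> L2 interval"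
    by (rule L2_bound[OF n]; auto simp: abs_Re_le_cmod abs_Im_le_cmod)+
  show "integrable interval c"
    using interval.L2_integrable[OF n] by (rule integrable_norm_cancel) measurable
  show "L2_norm interval (\<lambda>x. Re (c x)) \<le> sqrt (LINT x|interval. (cmod (c x))\<^sup>2)"
    "L2_norm interval (\<lambda>x. Im (c x)) \<le> sqrt (LINT x|interval. (cmod (c x))\<^sup>2)"
    unfolding eq[symmetric] by (rule L2_norm_mono_AE[OF n]; auto simp: abs_Re_le_cmod abs_Im_le_cmod)+
qed

text \<open>Each coefficient is the primitive of a mean-zero coefficient of
  \<open>x_deriv u\<close>, so \<open>prim_square_bound\<close> applies to its real and imaginary
  parts, and each contributes the constant 2.\<close>

lemma time_coeff_sup_bound:
  assumes u: "u \<in> L2_H1_0"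
  shows "AE x in interval. \<forall>k. (cmod (time_coeff u k x))\<^sup>2 \<le>
    4 * sqrt (time_energy u k) * sqrt (time_energy (x_deriv u) k)"
  unfolding AE_all_countable
proof
  fix k
  note L = L2_H1_0_slices[OF u]
  define c where "c = time_coeff u k"
  define h where "h = time_coeff (x_deriv u) k"
  define U where "U = sqrt (LINT x|interval. (cmod (c x))\<^sup>2)"
  define W where "W = sqrt (LINT x|interval. (cmod (h x))\<^sup>2)"
  have cm [measurable]: "c \<in> borel_measurable interval" and hm [measurable]: "h \<in> borel_measurable interval"
    unfolding c_def h_def using L by (auto intro: time_coeff_measurable L2_measurable)
  have c: "integrable interval (\<lambda>x. (cmod (c x))\<^sup>2)" and h: "integrable interval (\<lambda>x. (cmod (h x))\<^sup>2)"
    unfolding c_def h_def by (intro time_coeff_square_integrable L)+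
  note C = L2_Re_Im[OF cm c] and H = L2_Re_Im[OF hm h]
  have hp: "integrable interval (\<lambda>y. if y < x then h y else 0)" for x
    by (rule Bochner_Integration.integrable_bound[OF H(3)]) auto
  have "integral\<^sup>L interval h = 0" unfolding h_def by (rule time_coeff_L2_H1_0(2)[OF u])
  then have zero: "(LINT x|interval. Re (h x)) = 0" "(LINT x|interval. Im (h x)) = 0"
    using H(3) by auto
  have ae: "AE x in interval. Re (c x) = prim (\<lambda>y. Re (h y)) x \<and> Im (c x) = prim (\<lambda>y. Im (h y)) x"
    using time_coeff_L2_H1_0(1)[OF u]
  proof eventually_elim
    case (elim x)
    then have cx: "c x = (LINT y|interval. (if y < x then h y else 0))" unfolding c_def h_def by blast
    show ?case
      unfolding cx prim_def integral_Re[OF hp, symmetric] integral_Im[OF hp, symmetric]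
      by (auto intro!: Bochner_Integration.integral_cong)
  qed
  have "L2_norm interval (prim (\<lambda>y. Re (h y))) = L2_norm interval (\<lambda>x. Re (c x))"
    "L2_norm interval (prim (\<lambda>y. Im (h y))) = L2_norm interval (\<lambda>x. Im (c x))"
    by (rule L2_norm_cong_AE; use ae in \<open>auto elim: eventually_mono\<close>)+
  then have n: "L2_norm interval (prim (\<lambda>y. Re (h y))) \<le> U" "L2_norm interval (prim (\<lambda>y. Im (h y))) \<le> U"
    using C by (auto simp: U_def)
  have nh: "L2_norm interval (\<lambda>y. Re (h y)) \<le> W" "L2_norm interval (\<lambda>y. Im (h y)) \<le> W"
    using H by (auto simp: W_def)
  have "AE x in interval. (cmod (c x))\<^sup>2 \<le> 4 * U * W"
    using ae AE_space
  proof eventually_elim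
    case (elim x)
    then have x: "x \<in> {0..1}" by (auto simp: space_interval)
    have "(Re (c x))\<^sup>2 \<le> 2 * (L2_norm interval (prim (\<lambda>y. Re (h y))) * L2_norm interval (\<lambda>y. Re (h y)))"
      using prim_square_bound[OF H(1) zero(1) x] elim(1) by simp
    also have "\<dots> \<le> 2 * (U * W)" using n nh by (intro mult_left_mono mult_mono) (auto simp: U_def)
    finally have r: "(Re (c x))\<^sup>2 \<le> 2 * (U * W)" .
    have "(Im (c x))\<^sup>2 \<le> 2 * (L2_norm interval (prim (\<lambda>y. Im (h y))) * L2_norm interval (\<lambda>y. Im (h y)))"
      using prim_square_bound[OF H(2) zero(2) x] elim(1) by simp
    also have "\<dots> \<le> 2 * (U * W)" using n nh by (intro mult_left_mono mult_mono) (auto simp: U_def)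
    finally have i: "(Im (c x))\<^sup>2 \<le> 2 * (U * W)" .
    show ?case using r i by (simp add: cmod_power2)
  qed
  then show "AE x in interval. (cmod (time_coeff u k x))\<^sup>2 \<le>
    4 * sqrt (time_energy u k) * sqrt (time_energy (x_deriv u) k)"
    by (simp add: c_def h_def U_def W_def)
qed

text \<open>The two weighted sums in \<open>integral_wave_sum_fourth\<close> are treated
  differently. The one with weight \<open>sqrt (b k)\<close> is bounded for almost every fixed
  \<open>x\<close>: by \<open>time_coeff_sup_bound\<close> it is at most 4 times the sum of
  \<open>sqrt (b k * U k) * sqrt (W k)\<close>, hence at most \<open>4 * (sqrt X * R)\<close> by
  Cauchy--Schwarz. The one with weight \<open>b k\<close> is bounded by \<open>X\<close> only after
  integration over \<open>x\<close>. With the factor \<open>2 * S\<close> this gives the constant 8,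
  uniformly in \<open>N\<close>, and Fatou carries the bound to \<open>u\<close>.\<close>

lemma square_L2_bound:
  assumes S: "S \<ge> 0" "\<And>F::int set. finite F \<Longrightarrow> (\<Sum>k\<in>F. (1 + \<bar>real_of_int k\<bar>) powr (-3/2)) \<le> S"
    and u: "u \<in> L2_H1_0"
    and X: "\<And>F::int set. finite F \<Longrightarrow>
      (\<Sum>k\<in>F. (1 + \<bar>real_of_int k\<bar>) * time_energy u k) \<le> X"
  shows "(\<lambda>z. (u z)\<^sup>2) \<in> L2 cylinder"
    and "(L2_norm cylinder (\<lambda>z. (u z)\<^sup>2))\<^sup>2 \<le> 8 * S * L2_norm cylinder (x_deriv u) * (X * sqrt X)"
proof -
  note L = L2_H1_0_slices[OF u]
  note [measurable] = L2_measurable[OF L(1)]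
  define R where "R = L2_norm cylinder (x_deriv u)"
  define c where "c = time_coeff u"
  define U where "U k = (LINT x|interval. (cmod (c k x))\<^sup>2)" for k
  define W where "W k = time_energy (x_deriv u) k" for k
  define b where "b k = 1 + \<bar>real_of_int k\<bar>" for k
  define K where "K N = {- int N..int N}" for N
  define w where "w N = wave_sum c (K N)" for N
  have fin: "finite (K N)" for N by (simp add: K_def)
  have nn: "U k \<ge> 0" "W k \<ge> 0" "b k \<ge> 1" for k by (auto simp: U_def W_def b_def)
  have X0: "X \<ge> 0" using X[of "{}"] by simp
  have cm [measurable]: "c k \<in> borel_measurable interval" for k
    unfolding c_def by measurable
  have c2: "integrable interval (\<lambda>x. (cmod (c k x))\<^sup>2)" for k
    unfolding c_def by (rule time_coeff_square_integrable[OF L(1)])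
  have wL: "w N \<in> L2 cylinder" for N unfolding w_def by (intro wave_sum_L2 cm c2 fin)
  have wm [measurable]: "w N \<in> borel_measurable cylinder" for N using wL by (rule L2_measurable)
  have sup: "AE x in interval. \<forall>k. (cmod (c k x))\<^sup>2 \<le> 4 * sqrt (U k) * sqrt (W k)"
    using time_coeff_sup_bound[OF u] by (simp add: c_def U_def W_def)
  \<comment> \<open>A crude bound depending on \<open>N\<close>; it serves to make the fourth power
    of the partial sum integrable.\<close>
  define B where "B N = (\<Sum>k\<in>K N. sqrt (4 * sqrt (U k) * sqrt (W k)))" for N
  have w_le: "\<bar>w N (t, x)\<bar> \<le> cmod (\<Sum>k\<in>K N. c k x * wave k t)" for N t x
    unfolding w_def wave_sum_def fst_conv snd_conv by (rule abs_Re_le_cmod)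
  have bounded: "AE z in cylinder. \<bar>w N z\<bar> \<le> B N" for N
  proof (rule cylinder_AE_I')
    show "{z \<in> space cylinder. \<bar>w N z\<bar> \<le> B N} \<in> sets cylinder" by measurable
    show "AE x in interval. AE t in circle. \<bar>w N (t, x)\<bar> \<le> B N"
      using sup
    proof eventually_elim
      case (elim x)
      have "\<bar>w N (t, x)\<bar> \<le> B N" for t
      proof -
        have "cmod (\<Sum>k\<in>K N. c k x * wave k t) \<le> (\<Sum>k\<in>K N. cmod (c k x))"
          by (rule order_trans[OF norm_sum]) (simp add: norm_mult)
        also have "\<dots> \<le> B N" unfolding B_def using elim by (intro sum_mono real_le_rsqrt) auto
        finally show ?thesis using w_le[of N t x] by linarith
      qed
      then show ?case by simp
    qed
  qed
  have int4: "integrable cylinder (\<lambda>z. (w N z) ^ 4)" for N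
  proof (rule cylinder.integrable_const_bound[of _ "B N ^ 4"])
    show "AE z in cylinder. norm ((w N z) ^ 4) \<le> B N ^ 4"
      using bounded[of N]
    proof eventually_elim
      case (elim z)
      show ?case using power_mono[OF elim abs_ge_zero, of 4] by (simp add: power_abs)
    qed
  qed measurable
  have A: "AE x in interval. (\<Sum>k\<in>K N. sqrt (b k) * (cmod (c k x))\<^sup>2) \<le> 4 * (sqrt X * R)" for N
    using sup
  proof eventually_elim
    case (elim x)
    have "(\<Sum>k\<in>K N. sqrt (b k) * (cmod (c k x))\<^sup>2) \<le> (\<Sum>k\<in>K N. sqrt (b k) * (4 * sqrt (U k) * sqrt (W k)))"
      using elim nn by (intro sum_mono mult_left_mono) (auto intro: order_trans[OF zero_le_one])
    also have "\<dots> = 4 * (\<Sum>k\<in>K N. sqrt (b k * U k) * sqrt (W k))"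
      by (simp add: sum_distrib_left real_sqrt_mult mult_ac)
    also have "(\<Sum>k\<in>K N. sqrt (b k * U k) * sqrt (W k)) \<le> sqrt X * R"
    proof (rule power2_le_imp_le)
      have "(\<Sum>k\<in>K N. sqrt (b k * U k) * sqrt (W k))\<^sup>2
        \<le> (\<Sum>k\<in>K N. (sqrt (b k * U k))\<^sup>2) * (\<Sum>k\<in>K N. (sqrt (W k))\<^sup>2)"
        by (rule Cauchy_Schwarz_ineq_sum)
      also have "\<dots> = (\<Sum>k\<in>K N. b k * U k) * (\<Sum>k\<in>K N. W k)"
        using nn order_trans[OF zero_le_one nn(3)] by simp
      also have "\<dots> \<le> X * R\<^sup>2"
        using X[OF fin[of N]] time_coeff_Bessel[OF L(2) fin[of N]] nn X0
        by (intro mult_mono) (auto simp: b_def U_def c_def W_def R_def intro: sum_nonneg)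
      also have "\<dots> = (sqrt X * R)\<^sup>2" using X0 by (simp add: power_mult_distrib)
      finally show "(\<Sum>k\<in>K N. sqrt (b k * U k) * sqrt (W k))\<^sup>2 \<le> (sqrt X * R)\<^sup>2" .
      show "0 \<le> sqrt X * R" using X0 by (simp add: R_def)
    qed
    finally show ?case by simp
  qed
  have le: "(LINT z|cylinder. (w N z) ^ 4) \<le> 8 * S * R * (X * sqrt X)" for N
  proof -
    have int4': "integrable cylinder (case_prod (\<lambda>t x. (w N (t, x)) ^ 4))"
      using int4[of N] by (simp add: case_prod_unfold)
    have "(LINT z|cylinder. (w N z) ^ 4) = (LINT x|interval. LINT t|circle. (w N (t, x)) ^ 4)"
      using cylinder.integral_snd[OF int4'] by (simp add: case_prod_unfold)
    also have "\<dots> \<le> (LINT x|interval. 2 * S * (4 * (sqrt X * R)) * (\<Sum>k\<in>K N. b k * (cmod (c k x))\<^sup>2))"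
    proof (rule integral_mono_AE)
      show "integrable interval (\<lambda>x. LINT t|circle. (w N (t, x)) ^ 4)"
        by (rule cylinder.integrable_snd[OF int4'])
      show "integrable interval (\<lambda>x. 2 * S * (4 * (sqrt X * R)) * (\<Sum>k\<in>K N. b k * (cmod (c k x))\<^sup>2))"
        using c2 by auto
      show "AE x in interval. (LINT t|circle. (w N (t, x)) ^ 4)
        \<le> 2 * S * (4 * (sqrt X * R)) * (\<Sum>k\<in>K N. b k * (cmod (c k x))\<^sup>2)"
        using A[of N] AE_space
      proof eventually_elim
        case (elim x)
        have [measurable]: "(\<lambda>t. w N (t, x)) \<in> borel_measurable circle"
          using elim(2) by measurable
        have "(LINT t|circle. (w N (t, x)) ^ 4) \<le> (LINT t|circle. (cmod (\<Sum>k\<in>K N. c k x * wave k t)) ^ 4)"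
        proof (rule integral_mono)
          have bd: "cmod (\<Sum>k\<in>K N. c k x * wave k t) \<le> (\<Sum>k\<in>K N. cmod (c k x))" for t
            by (rule order_trans[OF norm_sum]) (simp add: norm_mult)
          show "integrable circle (\<lambda>t. (cmod (\<Sum>k\<in>K N. c k x * wave k t)) ^ 4)"
            using bd by (intro circle.integrable_const_bound[of _ "(\<Sum>k\<in>K N. cmod (c k x)) ^ 4"]) (auto
                intro!: power_mono)
          show le4: "(w N (t, x)) ^ 4 \<le> (cmod (\<Sum>k\<in>K N. c k x * wave k t)) ^ 4" for t
            using power_mono[OF w_le[of N t x], of 4] by simp
          show "integrable circle (\<lambda>t. (w N (t, x)) ^ 4)"
            by (rule Bochner_Integration.integrable_bound[OF \<open>integrable circle (\<lambda>t. (cmod (\<Sum>k\<in>K N. c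
                k x * wave k t)) ^ 4)\<close>])
              (use le4 in auto)
        qed
        also have "\<dots> \<le> 2 * S * (\<Sum>k\<in>K N. sqrt (b k) * (cmod (c k x))\<^sup>2) * (\<Sum>k\<in>K N. b k * (cmod (c k x))\<^sup>2)"
          unfolding b_def by (rule integral_wave_sum_fourth[OF S(2)]) (auto simp: K_def)
        also have "\<dots> \<le> 2 * S * (4 * (sqrt X * R)) * (\<Sum>k\<in>K N. b k * (cmod (c k x))\<^sup>2)"
          using elim(1) S(1) order_trans[OF zero_le_one nn(3)]
          by (intro mult_right_mono mult_left_mono sum_nonneg mult_nonneg_nonneg) auto
        finally show ?case .
      qed
    qed
    also have "\<dots> = 2 * S * (4 * (sqrt X * R)) * (\<Sum>k\<in>K N. b k * U k)"
      using c2 by (simp add: U_def Bochner_Integration.integral_sum)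
    also have "\<dots> \<le> 2 * S * (4 * (sqrt X * R)) * X"
      using X[OF fin[of N]] S(1) X0 by (intro mult_left_mono) (auto simp: b_def U_def c_def R_def)
    finally show ?thesis by (simp add: mult_ac)
  qed
  have "(\<lambda>N. L2_norm cylinder (\<lambda>z. w N z - u z)) \<longlonglongrightarrow> 0"
    unfolding w_def K_def c_def by (rule wave_sum_limit[OF L(1)])
  \<comment> \<open>\<open>L2\<close> convergence gives pointwise convergence only along a
    subsequence; this suffices because the bound is uniform in \<open>N\<close>.\<close>
  then obtain r :: "nat \<Rightarrow> nat" where r: "AE z in cylinder. (\<lambda>n. w (r n) z) \<longlonglongrightarrow> u z"
    using L2_limit_AE_subseq[where f = w, OF wL L(1)] by blast
  have lim: "AE z in cylinder. (\<lambda>n. (w (r n) z) ^ 4) \<longlonglongrightarrow> ((u z)\<^sup>2)\<^sup>2"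
    using r
  proof eventually_elim
    case (elim z)
    then have "(\<lambda>n. (w (r n) z) ^ 4) \<longlonglongrightarrow> (u z) ^ 4" by (intro tendsto_intros)
    then show ?case by simp
  qed
  have "integrable cylinder (\<lambda>z. ((u z)\<^sup>2)\<^sup>2)" "(LINT z|cylinder. ((u z)\<^sup>2)\<^sup>2) \<le> 8 * S * R * (X * sqrt X)"
    using integral_le_of_AE_limit[OF int4 _ le lim] by auto
  then show "(\<lambda>z. (u z)\<^sup>2) \<in> L2 cylinder"
    "(L2_norm cylinder (\<lambda>z. (u z)\<^sup>2))\<^sup>2 \<le> 8 * S * L2_norm cylinder (x_deriv u) * (X * sqrt X)"
    unfolding L2_norm_square R_def by (auto intro!: L2_I)
qed

section \<open>The a priori bound\<close>

text \<open>The sign is opposite to the customary -i sgn k: with this one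
  \<open>half_symbol k * half_symbol k * cnj (hilbert_symbol k)\<close> is the nonnegative number 2
  pi |k|.\<close>

definition hilbert_symbol :: "int \<Rightarrow> complex"
  where "hilbert_symbol k = \<i> * of_int (sgn k)"

text \<open>The half derivative contributes 2 pi |k|, which dominates |k|. The remaining 1, and with
  it the frequency 0 that the half derivative does not see, is paid for by Bessel for
  \<open>u\<close> and Poincare.\<close>

lemma time_coeff_weight_sum:
  assumes u: "u \<in> H_half_1_0" and F: "finite F"
  shows "(\<Sum>k\<in>F. (1 + \<bar>real_of_int k\<bar>) * time_energy u k)
    \<le> (L2_norm cylinder (frac_deriv (1/2) u))\<^sup>2 + (L2_norm cylinder (x_deriv u))\<^sup>2"
proof -
  have uT: "u \<in> H_time (1/2)" and u0: "u \<in> L2_H1_0" using u by (auto simp: H_half_1_0_def)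
  note L = L2_H1_0_slices[OF u0]
  define U where "U k = time_energy u k" for k
  have U: "U k \<ge> 0" for k by (simp add: U_def)
  have D: "frac_deriv (1/2) u \<in> L2 cylinder"
    "\<And>k. AE x in interval. time_coeff (frac_deriv (1/2) u) k x = half_symbol k * time_coeff u k x"
    using frac_deriv_half(1)[OF uT] by (auto simp: is_time_multiplier_def)
  note [measurable] = L2_measurable[OF D(1)] L2_measurable[OF L(1)]
  have D2: "time_energy (frac_deriv (1/2) u) k = 2 * pi * \<bar>of_int k\<bar> * U k" for k
  proof -
    have "time_energy (frac_deriv (1/2) u) k
      = (LINT x|interval. (cmod (half_symbol k))\<^sup>2 * (cmod (time_coeff u k x))\<^sup>2)"
      using D(2)[of k] by (intro integral_cong_AE) (auto elim!: eventually_mono simp: norm_mult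
          power_mult_distrib)
    then show ?thesis by (simp add: cmod_half_symbol U_def)
  qed
  have "(\<Sum>k\<in>F. (1 + \<bar>real_of_int k\<bar>) * U k) \<le> (\<Sum>k\<in>F. 2 * pi * \<bar>of_int k\<bar> * U k + U k)"
  proof (rule sum_mono)
    fix k
    have "1 * (\<bar>real_of_int k\<bar> * U k) \<le> (2 * pi) * (\<bar>real_of_int k\<bar> * U k)"
      using U pi_gt3 by (intro mult_right_mono) auto
    then show "(1 + \<bar>real_of_int k\<bar>) * U k \<le> 2 * pi * \<bar>of_int k\<bar> * U k + U k"
      by (simp add: algebra_simps)
  qed
  also have "\<dots> \<le> (L2_norm cylinder (frac_deriv (1/2) u))\<^sup>2 + (L2_norm cylinder u)\<^sup>2"
    using time_coeff_Bessel[OF D(1) F] time_coeff_Bessel[OF L(1) F]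
    unfolding D2 by (simp add: sum.distrib U_def)
  also have "(L2_norm cylinder u)\<^sup>2 \<le> (L2_norm cylinder (x_deriv u))\<^sup>2"
    by (intro power_mono L2_H1_0_Poincare u0) simp
  finally show ?thesis by (simp add: U_def)
qed

lemma frac_deriv_inner_self_zero:
  assumes u: "u \<in> H_time (1/2)"
  shows "L2_inner cylinder (frac_deriv (1/2) u) (frac_deriv_adj (1/2) u) = 0"
proof -
  have uL: "u \<in> L2 cylinder" using u by (simp add: H_time_def)
  have "((\<lambda>k. Re (half_symbol k * cnj (cnj (half_symbol k) * 1)) * time_energy u k)
    has_sum L2_inner cylinder (frac_deriv (1/2) u) (frac_deriv_adj (1/2) u)) UNIV"
    using frac_deriv_half[OF u] by (intro L2_inner_time_multiplier[OF uL uL]) auto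
  moreover have "Re (half_symbol k * cnj (cnj (half_symbol k) * 1)) = 0" for k
  proof -
    have "half_symbol k * cnj (cnj (half_symbol k) * 1) = half_symbol k * half_symbol k" by simp
    then show ?thesis unfolding half_symbol_square by simp
  qed
  ultimately have "((\<lambda>k::int. 0) has_sum L2_inner cylinder (frac_deriv (1/2) u) (frac_deriv_adj (1/2)
      u)) UNIV"
    by simp
  then show ?thesis by (rule has_sum_unique) (simp add: has_sum_0)
qed

text \<open>
  The Hilbert transform in time of \<open>u\<close>, given by its derivative in space: the primitive of the Hilbert
  transform of \<open>u\<^sub>x\<close> vanishes on both ends of the interval for almost every time.
\<close>

lemma hilbert_transform:
  assumes u: "u \<in> H_half_1_0"
  obtains v where "v \<in> H_half_1_0"
    "L2_norm cylinder (x_deriv v) \<le> L2_norm cylinder (x_deriv u)"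
    "L2_inner cylinder (x_deriv u) (x_deriv v) = 0"
    "L2_inner cylinder (frac_deriv (1/2) u) (frac_deriv_adj (1/2) v) = (L2_norm cylinder (frac_deriv
        (1/2) u))\<^sup>2"
proof -
  have uT: "u \<in> H_time (1/2)" and u0: "u \<in> L2_H1_0" using u by (auto simp: H_half_1_0_def)
  note L = L2_H1_0_slices[OF u0]
  define w where "w = x_deriv u"
  have w: "w \<in> L2 cylinder" unfolding w_def by (rule L)
  note [measurable] = L2_measurable[OF w] L2_measurable[OF L(1)]
  have hs: "hilbert_symbol (- k) = cnj (hilbert_symbol k)" for k
    by (simp add: hilbert_symbol_def sgn_minus)
  have hn: "(cmod (hilbert_symbol k))\<^sup>2 \<le> 1" for k
    by (simp add: hilbert_symbol_def norm_mult sgn_if)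
  have "(\<lambda>k::int. (cmod (hilbert_symbol k))\<^sup>2 * time_energy w k) summable_on UNIV"
    using mult_right_mono[OF hn]
    by (intro summable_on_comparison_test[OF time_coeff_square_summable[OF w]]) auto
  from time_multiplier_exists[OF w hs this]
  obtain z where zm: "is_time_multiplier hilbert_symbol w z" by blast
  have z: "z \<in> L2 cylinder" and zc: "\<And>k. AE x in interval. time_coeff z k x = hilbert_symbol k *
      time_coeff w k x"
    using zm by (auto simp: is_time_multiplier_def)
  note [measurable] = L2_measurable[OF z]
  have wm: "is_time_multiplier (\<lambda>k. 1) w w" using w by (simp add: is_time_multiplier_def)
  have "((\<lambda>k. Re (1 * cnj (hilbert_symbol k * 1)) * time_energy w k)
    has_sum L2_inner cylinder w z) UNIV"
    by (rule L2_inner_time_multiplier[OF w w wm zm]) simp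
  moreover have "Re (1 * cnj (hilbert_symbol k * 1)) = 0" for k by (simp add: hilbert_symbol_def)
  ultimately have "((\<lambda>k::int. 0) has_sum L2_inner cylinder w z) UNIV" by simp
  then have wz: "L2_inner cylinder w z = 0" by (rule has_sum_unique) (simp add: has_sum_0)
  have z_le: "L2_norm cylinder z \<le> L2_norm cylinder w"
  proof (rule power2_le_imp_le)
    have "((\<lambda>k. Re (hilbert_symbol k * cnj (hilbert_symbol k * 1)) * time_energy w k)
      has_sum L2_inner cylinder z z) UNIV"
      by (rule L2_inner_time_multiplier[OF w w zm zm]) simp
    then have "L2_inner cylinder z z \<le> (L2_norm cylinder w)\<^sup>2"
    proof (rule has_sum_mono[OF _ Parseval_norm[OF w]])
      fix k :: int
      have "Re (hilbert_symbol k * cnj (hilbert_symbol k * 1)) \<le> 1"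
        by (simp add: hilbert_symbol_def sgn_if)
      then show "Re (hilbert_symbol k * cnj (hilbert_symbol k * 1)) * time_energy w k
        \<le> time_energy w k"
        using mult_right_mono[of _ 1 "time_energy w k"] by fastforce
    qed
    then show "(L2_norm cylinder z)\<^sup>2 \<le> (L2_norm cylinder w)\<^sup>2" by (simp only: L2_inner_self)
  qed simp
  have zero: "AE t in circle. (LINT x|interval. z (t, x)) = 0"
    unfolding mean_zero_iff_time_coeff[OF z]
  proof
    fix k
    have "(LINT x|interval. time_coeff z k x) = (LINT x|interval. hilbert_symbol k * time_coeff w k x)"
      using zc[of k] by (intro integral_cong_AE) auto
    then show "(LINT x|interval. time_coeff z k x) = 0"
      using time_coeff_L2_H1_0(2)[OF u0] by (simp add: w_def)
  qed
  define v where "v = xprim z"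
  have v0: "v \<in> L2_H1_0" and vx: "AE p in cylinder. x_deriv v p = z p"
    unfolding v_def by (rule xprim_in_L2_H1_0[OF z zero])+
  note Lv = L2_H1_0_slices[OF v0]
  note [measurable] = L2_measurable[OF Lv(1)] L2_measurable[OF Lv(2)]
  \<comment> \<open>\<open>v\<close> was built from the \<open>x\<close>-derivative; here it is
    recognized as the Hilbert transform of \<open>u\<close> itself, since the symbol does not depend
    on the variable of integration.\<close>
  have vc: "AE x in interval. time_coeff v k x = hilbert_symbol k * time_coeff u k x" for k
    using time_coeff_L2_H1_0(1)[OF u0]
  proof eventually_elim
    case (elim x)
    have "time_coeff v k x = (LINT y|interval. (if y < x then time_coeff z k y else 0))"
      unfolding v_def by (rule time_coeff_xprim[OF z])
    also have "\<dots> = (LINT y|interval. hilbert_symbol k * (if y < x then time_coeff w k y else 0))"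
      using zc[of k] by (intro integral_cong_AE) auto
    also have "\<dots> = hilbert_symbol k * time_coeff u k x"
      using elim unfolding w_def by simp
    finally show ?case .
  qed
  have vT: "v \<in> H_time (1/2)"
    unfolding H_time_def
  proof (intro CollectI conjI Lv(1))
    have le: "time_energy v k \<le> time_energy u k" for k
    proof (rule integral_mono_AE[OF time_coeff_square_integrable[OF Lv(1)]
        time_coeff_square_integrable[OF L(1)]])
      show "AE x in interval. (cmod (time_coeff v k x))\<^sup>2 \<le> (cmod (time_coeff u k x))\<^sup>2"
        using vc[of k]
      proof eventually_elim
        case (elim x)
        show ?case
          using mult_right_mono[OF hn[of k], of "(cmod (time_coeff u k x))\<^sup>2"]
          by (simp add: elim norm_mult power_mult_distrib)
      qed
    qed
    show "(\<lambda>k::int. (1 + (of_int k)\<^sup>2) powr (1/2) * time_energy v k) summable_on UNIV"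
    proof (rule summable_on_comparison_test)
      show "(\<lambda>k::int. (1 + (of_int k)\<^sup>2) powr (1/2) * time_energy u k) summable_on UNIV"
        using uT by (simp add: H_time_def)
    qed (simp_all add: mult_left_mono[OF le])
  qed
  have "((\<lambda>k. Re (half_symbol k * cnj (cnj (half_symbol k) * hilbert_symbol k)) * time_energy u k)
    has_sum L2_inner cylinder (frac_deriv (1/2) u) (frac_deriv_adj (1/2) v)) UNIV"
    by (rule L2_inner_time_multiplier[OF L(1) Lv(1) frac_deriv_half(1)[OF uT] frac_deriv_half(2)[OF vT] vc])
  moreover have "((\<lambda>k. Re (half_symbol k * cnj (half_symbol k * 1)) * time_energy u k)
    has_sum L2_inner cylinder (frac_deriv (1/2) u) (frac_deriv (1/2) u)) UNIV"
    by (rule L2_inner_time_multiplier[OF L(1) L(1) frac_deriv_half(1)[OF uT] frac_deriv_half(1)[OF uT]]) simp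
  \<comment> \<open>Both weights are 2 pi |k|. At \<open>k = 0\<close>, where the Hilbert symbol
    fails to have modulus 1, \<open>half_symbol k\<close> is 0 as well.\<close>
  moreover have "Re (half_symbol k * cnj (cnj (half_symbol k) * hilbert_symbol k)) = Re (half_symbol k
      * cnj (half_symbol k * 1))" for k
  proof -
    have "half_symbol k * cnj (cnj (half_symbol k) * hilbert_symbol k) = half_symbol k * half_symbol k
        * cnj (hilbert_symbol k)"
      by simp
    also have "\<dots> = of_real (2 * pi * \<bar>of_int k\<bar>)"
      unfolding half_symbol_square hilbert_symbol_def by (auto simp: sgn_if)
    also have "\<dots> = half_symbol k * cnj (half_symbol k * 1)"
      by (simp add: cmod_half_symbol[symmetric] complex_norm_square del: of_real_power of_real_mult)
    finally show ?thesis by (simp only:)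
  qed
  ultimately have "L2_inner cylinder (frac_deriv (1/2) u) (frac_deriv_adj (1/2) v)
    = L2_inner cylinder (frac_deriv (1/2) u) (frac_deriv (1/2) u)"
    by (simp only: has_sum_unique)
  then have inner: "L2_inner cylinder (frac_deriv (1/2) u) (frac_deriv_adj (1/2) v) = (L2_norm
      cylinder (frac_deriv (1/2) u))\<^sup>2"
    by (simp only: L2_inner_self)
  have "L2_norm cylinder (x_deriv v) = L2_norm cylinder z"
    using vx by (intro L2_norm_cong_AE) auto
  moreover have "L2_inner cylinder (x_deriv u) (x_deriv v) = L2_inner cylinder w z"
    unfolding w_def[symmetric] using vx by (intro L2_inner_cong_AE) auto
  ultimately show ?thesis
    using that[of v] v0 vT z_le wz inner by (simp add: H_half_1_0_def w_def)
qed

text \<open>Since \<open>y \<ge> 1\<close>, the constant may be multiplied by \<open>y ^ 3\<close>,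
  after which that factor cancels.\<close>

lemma quartic_cubic_bound:
  fixes y c\<^sub>1 c\<^sub>2 :: real
  assumes "y ^ 4 \<le> c\<^sub>1 * y ^ 3 + c\<^sub>2" "y \<ge> 1" "c\<^sub>2 \<ge> 0"
  shows "y \<le> c\<^sub>1 + c\<^sub>2"
proof -
  have "y ^ 3 \<ge> 1" using assms(2) by simp
  then have "c\<^sub>2 \<le> c\<^sub>2 * y ^ 3" using assms(3) by (simp add: mult_le_cancel_left1)
  then have "y * y ^ 3 \<le> (c\<^sub>1 + c\<^sub>2) * y ^ 3"
    using assms(1) by (simp add: algebra_simps power4_eq_xxxx power3_eq_cube)
  then show ?thesis using assms(2) by (simp add: mult_le_cancel_right)
qed

theorem theorem1:
  fixes \<mu> :: real and f :: "(real \<times> real \<Rightarrow> real) \<Rightarrow> real"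
  assumes "\<mu> > 0" and "f \<in> L2_Hminus1"
  shows "\<exists>C. \<forall>u \<in> (\<Union>lam\<in>{0..1::real}.
           {u \<in> H_half_1_0. \<forall>v\<in>H_half_1_0. op_L \<mu> u v + lam * op_S u v = f v}).
         H_half_1_norm u \<le> C"
proof -
  obtain B\<^sub>0 where B\<^sub>0: "\<forall>v\<in>L2_H1_0. \<bar>f v\<bar> \<le> B\<^sub>0 * L2_H1_norm v"
    using assms(2) unfolding L2_Hminus1_def by blast
  \<comment> \<open>By Poincare the norm of \<open>L2_H1_norm\<close> is at most twice that of the
    \<open>x\<close>-derivative. The absolute value is taken because nothing excludes a negative
    \<open>B\<^sub>0\<close>.\<close>
  define B where "B = 2 * \<bar>B\<^sub>0\<bar>"
  have B: "\<bar>f v\<bar> \<le> B * L2_norm cylinder (x_deriv v)" if "v \<in> H_half_1_0" for v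
  proof -
    have v: "v \<in> L2_H1_0" using that by (simp add: H_half_1_0_def)
    define r where "r = L2_norm cylinder (x_deriv v)"
    have "(L2_norm cylinder v)\<^sup>2 \<le> r\<^sup>2"
      unfolding r_def by (intro power_mono L2_H1_0_Poincare v) simp
    moreover have "(2 * r)\<^sup>2 = 4 * r\<^sup>2" by (simp add: power_mult_distrib)
    ultimately have "(L2_norm cylinder v)\<^sup>2 + r\<^sup>2 \<le> (2 * r)\<^sup>2"
      using zero_le_power2[of r] by linarith
    then have "L2_H1_norm v \<le> sqrt ((2 * r)\<^sup>2)"
      unfolding L2_H1_norm_def r_def by (rule real_sqrt_le_mono)
    then have n: "L2_H1_norm v \<le> 2 * r" unfolding real_sqrt_abs by (simp add: r_def)
    have "\<bar>f v\<bar> \<le> \<bar>B\<^sub>0\<bar> * L2_H1_norm v"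
      by (rule order_trans[OF bspec[OF B\<^sub>0 v]]) (auto intro!: mult_right_mono simp: L2_H1_norm_def)
    also have "\<dots> \<le> \<bar>B\<^sub>0\<bar> * (2 * r)" using n by (intro mult_left_mono) auto
    finally show ?thesis by (simp add: B_def r_def)
  qed
  have B_nonneg: "B \<ge> 0" by (simp add: B_def)
  obtain S where S: "S \<ge> 0" "\<And>F::int set. finite F \<Longrightarrow> (\<Sum>k\<in>F. (1 + \<bar>real_of_int k\<bar>) powr (-3/2)) \<le> S"
    using weight_sum_bounded by blast
  define R\<^sub>0 where "R\<^sub>0 = B / \<mu>"
  have R\<^sub>0: "R\<^sub>0 \<ge> 0" using B_nonneg assms(1) by (simp add: R\<^sub>0_def)
  define c\<^sub>1 where "c\<^sub>1 = sqrt (8 * S * R\<^sub>0) * R\<^sub>0"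
  define c\<^sub>2 where "c\<^sub>2 = B * R\<^sub>0 + R\<^sub>0\<^sup>2 + 1"
  \<comment> \<open>These constants involve only \<open>\<mu>\<close>, \<open>S\<close> and the
    bound on \<open>f\<close>. \<open>R\<^sub>0\<close> bounds \<open>R\<close>,
    \<open>c\<^sub>1\<close> collects the nonlinear term, and \<open>c\<^sub>2\<close> the forcing
    together with what is added to E^2 in \<open>X\<close>. The three squares of the norm are at
    most \<open>2 * X\<close>, because two of them are at most
    \<open>R\<^sub>0\<^sup>2\<close>.\<close>
  have "H_half_1_norm u \<le> sqrt (2 * (c\<^sub>1 + c\<^sub>2) ^ 4)"
    if u: "u \<in> H_half_1_0" and lam: "0 \<le> lam" "lam \<le> 1"
      and eq: "\<And>v. v \<in> H_half_1_0 \<Longrightarrow> op_L \<mu> u v + lam * op_S u v = f v" for u lam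
  proof -
    have uT: "u \<in> H_time (1/2)" and u0: "u \<in> L2_H1_0" using u by (auto simp: H_half_1_0_def)
    note L = L2_H1_0_slices[OF u0]
    define R where "R = L2_norm cylinder (x_deriv u)"
    define E where "E = L2_norm cylinder (frac_deriv (1/2) u)"
    have R_nonneg: "R \<ge> 0" by (simp add: R_def)
    have "\<mu> * R\<^sup>2 = f u"
      using eq[OF u] unfolding op_L_def op_S_def frac_deriv_inner_self_zero[OF uT]
          L2_inner_square_x_deriv[OF u0]
      by (simp add: L2_inner_self R_def)
    also have "\<dots> \<le> B * R" using B[OF u] by (simp add: R_def)
    finally have "(\<mu> * R) * R \<le> B * R" by (simp add: power2_eq_square mult.assoc)
    then have R_le: "R \<le> R\<^sub>0"
      using R_nonneg assms(1) R\<^sub>0 by (cases "R = 0") (auto simp: R\<^sub>0_def field_simps)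
    obtain v where v: "v \<in> H_half_1_0" "L2_norm cylinder (x_deriv v) \<le> R"
      "L2_inner cylinder (x_deriv u) (x_deriv v) = 0"
      "L2_inner cylinder (frac_deriv (1/2) u) (frac_deriv_adj (1/2) v) = E\<^sup>2"
      using hilbert_transform[OF u] unfolding R_def E_def by blast
    \<comment> \<open>\<open>R\<^sub>0\<close> in place of \<open>R\<close> keeps the constants free
      of \<open>u\<close>. The summand 1 gives \<open>y \<ge> 1\<close> for the fourth root
      \<open>y\<close> of \<open>X\<close>, in which the estimate becomes polynomial.\<close>
    define X where "X = E\<^sup>2 + R\<^sub>0\<^sup>2 + 1"
    have X: "X \<ge> 1" by (simp add: X_def)
    define y where "y = sqrt (sqrt X)"
    have y: "y \<ge> 1" "y ^ 4 = X" "y\<^sup>2 = sqrt X"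
    proof -
      show "y\<^sup>2 = sqrt X" using X by (simp add: y_def)
      then have "(y\<^sup>2)\<^sup>2 = X" using X by simp
      then show "y ^ 4 = X" by simp
    qed (use X in \<open>simp add: y_def\<close>)
    have weight: "(\<Sum>k\<in>F. (1 + \<bar>real_of_int k\<bar>) * time_energy u k) \<le> X" if "finite F" for F
    proof -
      have "R\<^sup>2 \<le> R\<^sub>0\<^sup>2" using R_le R_nonneg by (intro power_mono)
      then show ?thesis using time_coeff_weight_sum[OF u that] by (simp add: X_def E_def R_def)
    qed
    define Q where "Q = L2_norm cylinder (\<lambda>z. (u z)\<^sup>2)"
    have usq: "(\<lambda>z. (u z)\<^sup>2) \<in> L2 cylinder" by (rule square_L2_bound(1)[OF S u0 weight])
    have "Q\<^sup>2 \<le> 8 * S * R * (X * sqrt X)"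
      unfolding Q_def R_def by (rule square_L2_bound(2)[OF S u0 weight])
    also have "\<dots> \<le> 8 * S * R\<^sub>0 * (X * sqrt X)"
      using R_le S(1) X by (intro mult_right_mono mult_left_mono) auto
    also have "X * sqrt X = (y ^ 3)\<^sup>2"
      by (subst y(3)[symmetric], subst y(2)[symmetric]) (simp flip: power_add power_mult)
    also have "8 * S * R\<^sub>0 * (y ^ 3)\<^sup>2 = (sqrt (8 * S * R\<^sub>0) * y ^ 3)\<^sup>2"
      using S(1) R\<^sub>0 by (simp add: power_mult_distrib)
    finally have Q: "Q \<le> sqrt (8 * S * R\<^sub>0) * y ^ 3"
      by (rule power2_le_imp_le) (use y(1) S(1) R\<^sub>0 in auto)
    have v0: "v \<in> L2_H1_0" using v(1) by (simp add: H_half_1_0_def)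
    have "\<bar>L2_inner cylinder (\<lambda>z. (u z)\<^sup>2) (x_deriv v)\<bar> \<le> Q * L2_norm cylinder (x_deriv v)"
      unfolding Q_def by (intro L2_inner_Cauchy_Schwarz usq L2_H1_0_slices v0)
    also have "\<dots> \<le> (sqrt (8 * S * R\<^sub>0) * y ^ 3) * R\<^sub>0"
      using Q v(2) R_le y(1) S(1) R\<^sub>0 by (intro mult_mono) auto
    finally have I: "\<bar>L2_inner cylinder (\<lambda>z. (u z)\<^sup>2) (x_deriv v)\<bar> \<le> c\<^sub>1 * y ^ 3"
      by (simp add: c\<^sub>1_def mult_ac)
    have "E\<^sup>2 = f v + lam * (1/2 * L2_inner cylinder (\<lambda>z. (u z)\<^sup>2) (x_deriv v))"
      using eq[OF v(1)] unfolding op_L_def op_S_def v(3,4) by simp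
    also have "f v \<le> B * R\<^sub>0"
      using B[OF v(1)] v(2) R_le B_nonneg mult_left_mono[of "L2_norm cylinder (x_deriv v)" "R\<^sub>0" B] by
          linarith
    \<comment> \<open>This is where \<open>lam \<le> 1\<close> enters; the factor 1/2 is given
      away.\<close>
    also have "lam * (1/2 * L2_inner cylinder (\<lambda>z. (u z)\<^sup>2) (x_deriv v)) \<le> 1 * (c\<^sub>1 * y ^ 3)"
    proof -
      have "lam * (1/2 * L2_inner cylinder (\<lambda>z. (u z)\<^sup>2) (x_deriv v))
        \<le> lam * \<bar>L2_inner cylinder (\<lambda>z. (u z)\<^sup>2) (x_deriv v)\<bar>"
        using lam by (intro mult_left_mono) auto
      also have "\<dots> \<le> 1 * (c\<^sub>1 * y ^ 3)" using lam I by (intro mult_mono) auto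
      finally show ?thesis .
    qed
    finally have "y ^ 4 \<le> c\<^sub>1 * y ^ 3 + c\<^sub>2" unfolding y(2) by (simp add: X_def c\<^sub>2_def)
    moreover have "c\<^sub>2 \<ge> 0" using B_nonneg R\<^sub>0 by (simp add: c\<^sub>2_def)
    ultimately have "y \<le> c\<^sub>1 + c\<^sub>2" using quartic_cubic_bound y(1) by blast
    then have "X \<le> (c\<^sub>1 + c\<^sub>2) ^ 4" unfolding y(2)[symmetric] using y(1) by (intro power_mono) auto
    moreover have "(L2_norm cylinder u)\<^sup>2 \<le> R\<^sub>0\<^sup>2" "R\<^sup>2 \<le> R\<^sub>0\<^sup>2"
      using L2_H1_0_Poincare[OF u0] R_le R_nonneg by (auto intro!: power_mono simp: R_def)
    ultimately have "(L2_norm cylinder u)\<^sup>2 + E\<^sup>2 + R\<^sup>2 \<le> 2 * (c\<^sub>1 + c\<^sub>2) ^ 4"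
      using zero_le_power2[of E] unfolding X_def by linarith
    then show ?thesis unfolding H_half_1_norm_def E_def R_def by (rule real_sqrt_le_mono)
  qed
  then show ?thesis by (intro exI[of _ "sqrt (2 * (c\<^sub>1 + c\<^sub>2) ^ 4)"]) auto
qed

end
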